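(* Let $\sigma:[0,T]\times\mathbb{R}^d\times\mathbb{R}\to\mathbb{R}^{d\times m}$, $b:[0,T]\times\mathbb{R}^d\times\mathbb{R}\times\mathbb{R}^m\to\mathbb{R}^d$, $f:[0,T]\times\mathbb{R}^d\times\mathbb{R}\times\mathbb{R}^m\to\mathbb{R}$, $g:\mathbb{R}^d\to\mathbb{R}$, and let $$G(t,x,y,z,\gamma)=\tfrac12[\sigma\sigma^\top](t,x,y):\gamma+b\big(t,x,y,\sigma^\top(t,x,y)z\big)\cdot z+f\big(t,x,y,\sigma^\top(t,x,y)z\big).$$ Assume: (i) $\sigma,b,f,g$ are bounded, continuous in all variables, and uniformly Lipschitz continuous in $(x,y,z)$; (ii) Assumption (M) holds for this $G$; (iii) the PDE $-\partial_tu-G(t,x,u,Du,D^2u)=0$ on $[0,T)\times\mathbb{R}^d$, $u(T,\cdot)=g$, has a classical solution $u\in C^{[4]}_b([0,T]\times\mathbb{R}^d)$. Let $u_h$, $h=T/n$, be the approximating solution of the scheme built from the pair $(\sigma_0,p)$ of Assumption (M). Then there is a constant $C$, independent of $h$ and of $(t,x)$, such that $|u_h-u|\le Ch$ on $[0,T]\times\mathbb{R}^d$ when $h$ is small enough.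
   Context: Notation. $T>0$, $d,m\ge1$; $\mathbb{S}^d$ is the set of symmetric $d\times d$ matrices with its usual partial order ($\gamma\le\tilde\gamma$ iff $\tilde\gamma-\gamma$ is nonnegative definite); $\mathbb{R}^{d\times d}_+$ is the set of nondegenerate (invertible) $d\times d$ matrices. $\gamma:\tilde\gamma=\operatorname{tr}(\gamma\tilde\gamma^\top)$, $|\gamma|=\sqrt{\gamma:\gamma}$. For a matrix $\gamma$, $D[\gamma]$ is the diagonal matrix with the same diagonal entries as $\gamma$. $\sigma_0^{-\top}:=(\sigma_0^{-1})^\top$. Function spaces. $C^{[2]}_b([0,T]\times\mathbb{R}^d)$ is the set of $u\in C^{1,2}([0,T]\times\mathbb{R}^d)$ such that $u,\partial_tu,Du,D^2u$ are bounded; $C^{[4]}_b([0,T]\times\mathbb{R}^d)$ is the set of $u\in C^{[2]}_b$ such that each component of $\partial_tu,Du,D^2u$ is also in $C^{[2]}_b$. $G$ has arguments $(t,x,y,z,\gamma)\in[0,T]\times\mathbb{R}^d\times\mathbb{R}\times\mathbb{R}^d\times\mathbb{S}^d$; $G_\gamma$ is its ($\mathbb{S}^d$-valued) derivative in $\gamma$ (here $G_\gamma=\frac12\sigma\sigma^\top(t,x,y)$). Scheme. Given $\sigma_0:[0,T]\times\mathbb{R}^d\to\mathbb{R}^{d\times d}_+$ and $p:[0,T]\times\mathbb{R}^d\to(0,1)$ with $\sigma_0,\sigma_0^{-1},p^{-1}$ bounded (note $\sigma_0$ is different from $\sigma$), put $a_0=\sigma_0\sigma_0^\top$, $F(t,x,y,z,\gamma)=G(t,x,y,z,\gamma)-\frac12a_0(t,x):\gamma$,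 and $\widetilde G_\gamma=\sigma_0^{-1}G_\gamma\sigma_0^{-\top}$ (with $\sigma_0=\sigma_0(t,x)$). For each $(t,x)$ let $\xi=\xi^{t,x}$ be an $\mathbb{R}^d$-valued random variable with i.i.d. components, $\mathbb{P}(\xi_i=\pm1/\sqrt p)=p/2$ for each sign, $\mathbb{P}(\xi_i=0)=1-p$, $p=p(t,x)$. For $t\in[0,T)$, $h>0$ with $t+h\le T$, and measurable $\varphi:\mathbb{R}^d\to\mathbb{R}$, define (with $\sigma_0,p,\xi$ taken at $(t,x)$) $$\mathcal{D}^{t,i}_h\varphi(x)=\mathbb{E}[\varphi(x+\sqrt h\,\sigma_0\xi)K_i(\xi)],\ i=0,1,2,\quad K_0=1,\quad K_1(\xi)=\frac{\sigma_0^{-\top}\xi}{\sqrt h},$$ $$K_2(\xi)=\frac{\sigma_0^{-\top}\big[(1-p)\xi\xi^\top-(1-3p)D[\xi\xi^\top]-2pI_d\big]\sigma_0^{-1}}{(1-p)h},$$ $$\mathbb{T}^t_h[\varphi](x)=\mathcal{D}^{t,0}_h\varphi(x)+hF\big(t,x,\mathcal{D}^{t,0}_h\varphi(x),\mathcal{D}^{t,1}_h\varphi(x),\mathcal{D}^{t,2}_h\varphi(x)\big).$$ For $n\ge1$, $h=T/n$, $t_i=ih$, set $u_h(t_n,\cdot)=g$ and, for $i=n,\dots,1$, $u_h(t,\cdot)=\mathbb{T}^t_{t_i-t}[u_h(t_i,\cdot)]$ for $t\in[t_{i-1},t_i)$. Assumption (M): there exist $\sigma_0,p$ with $\sigma_0,\sigma_0^{-1},p^{-1}$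 bounded satisfying (M1), (M2) below. Associated to $\sigma_0$ define $\underline\alpha(t,x)=\sup\{\alpha>0:\alpha I_d\le D[\widetilde G_\gamma](t,x,y,z,\gamma)\ \forall(y,z,\gamma)\}$, $\bar\alpha(t,x)=\inf\{\alpha>0:\alpha I_d\ge D[\widetilde G_\gamma](t,x,y,z,\gamma)\ \forall(y,z,\gamma)\}$, $\Lambda=\bar\alpha/\underline\alpha$, $\theta(t,x)=\inf\{\theta\ge0:D[\widetilde G_\gamma]\le(1+\theta)\widetilde G_\gamma\ \forall (y,z,\gamma)\}$, and for $p\in(0,1)$ $$\alpha_p=\frac{p(2+3\theta)-\theta}{p(1+\theta)},\quad c_p=\sqrt{2p\Lambda+\alpha_p-2p},\quad \lambda_p=\sqrt p\Big[(1-p+pd)c_p-\frac{2pd\Lambda}{c_p}\Big]\frac{\sqrt{\underline\alpha}}{|\sigma_0^{-1}|},$$ $$\lambda^*=\inf_{(t,x)\in[0,T]\times\mathbb{R}^d}\ \sup_{p\in[\frac{\theta}{2(1+\theta)},\frac13]\cap(0,\frac13]}\lambda_p(t,x).$$ (M1) $\theta(t,x)\le2$ for all $(t,x)$ and $\lambda^*>0$. (M2) For all $(t,x)$, with $p=p(t,x)$: $p\in[\frac{\theta}{2(1+\theta)},\frac13]\cap(0,\frac13]$, $\lambda_p\ge\lambda^*/2$, and $\underline\alpha=c_p^{-2}$. *)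

theory Defs
  imports "HOL-Analysis.Analysis" "HOL-Probability.Probability" "HOL-Probability.Product_PMF"
begin

section \<open>Matrices\<close>

text \<open>A \<open>d \<times> m\<close> matrix is an element of \<^typ>\<open>real^'m^'d\<close>.  Its library norm is the Frobenius
  norm, i.e. \<open>|A| = sqrt (frob A A)\<close>.\<close>

definition frob :: "real^'n^'k \<Rightarrow> real^'n^'k \<Rightarrow> real" where
  "frob A B = trace (A ** transpose B)"

definition sym_mats :: "(real^'d^'d) set" where
  "sym_mats = {A. transpose A = A}"

text \<open>Only ever applied to symmetric matrices.\<close>

definition loewner_le :: "real^'d^'d \<Rightarrow> real^'d^'d \<Rightarrow> bool" where
  "loewner_le A B \<longleftrightarrow> (\<forall>v. 0 \<le> v \<bullet> ((B - A) *v v))"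

definition diag_part :: "real^'d^'d \<Rightarrow> real^'d^'d" where
  "diag_part A = (\<chi> i j. if i = j then A $ i $ j else 0)"

section \<open>Function spaces on \<open>[0,T] \<times> \<real>\<^sup>d\<close>\<close>

text \<open>Functions on \<open>[0,T] \<times> \<real>\<^sup>d\<close> are total functions whose values at times outside \<open>[0,T]\<close> are
  irrelevant; in particular the time derivative is one-sided at \<open>0\<close> and \<open>T\<close>.\<close>

definition dt :: "real \<Rightarrow> (real \<Rightarrow> real^'d \<Rightarrow> real) \<Rightarrow> real \<Rightarrow> real^'d \<Rightarrow> real" where
  "dt T u t x = vector_derivative (\<lambda>s. u s x) (at t within {0..T})"

definition grad :: "(real^'d \<Rightarrow> real) \<Rightarrow> real^'d \<Rightarrow> real^'d" where
  "grad \<phi> x = (\<chi> i. frechet_derivative \<phi> (at x) (axis i 1))"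

definition hess :: "(real^'d \<Rightarrow> real) \<Rightarrow> real^'d \<Rightarrow> real^'d^'d" where
  "hess \<phi> x = matrix (frechet_derivative (grad \<phi>) (at x))"

definition C12 :: "real \<Rightarrow> (real \<Rightarrow> real^'d \<Rightarrow> real) \<Rightarrow> bool" where
  "C12 T u \<longleftrightarrow>
     (\<forall>t\<in>{0..T}. \<forall>x. (\<lambda>s. u s x) differentiable (at t within {0..T}) \<and>
        u t differentiable (at x) \<and> grad (u t) differentiable (at x)) \<and>
     continuous_on ({0..T} \<times> UNIV) (\<lambda>(t, x). u t x) \<and>
     continuous_on ({0..T} \<times> UNIV) (\<lambda>(t, x). dt T u t x) \<and>
     continuous_on ({0..T} \<times> UNIV) (\<lambda>(t, x). grad (u t) x) \<and>
     continuous_on ({0..T} \<times> UNIV) (\<lambda>(t, x). hess (u t) x)"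

definition C2b :: "real \<Rightarrow> (real \<Rightarrow> real^'d \<Rightarrow> real) \<Rightarrow> bool" where
  "C2b T u \<longleftrightarrow> C12 T u \<and>
     bounded ((\<lambda>(t, x). u t x) ` ({0..T} \<times> UNIV)) \<and>
     bounded ((\<lambda>(t, x). dt T u t x) ` ({0..T} \<times> UNIV)) \<and>
     bounded ((\<lambda>(t, x). grad (u t) x) ` ({0..T} \<times> UNIV)) \<and>
     bounded ((\<lambda>(t, x). hess (u t) x) ` ({0..T} \<times> UNIV))"

definition C4b :: "real \<Rightarrow> (real \<Rightarrow> real^'d \<Rightarrow> real) \<Rightarrow> bool" where
  "C4b T u \<longleftrightarrow> C2b T u \<and> C2b T (dt T u) \<and>
     (\<forall>i. C2b T (\<lambda>t x. grad (u t) x $ i)) \<and>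
     (\<forall>i j. C2b T (\<lambda>t x. hess (u t) x $ i $ j))"

section \<open>The equation\<close>

type_synonym 'd nonlinearity =
  "real \<Rightarrow> real^'d \<Rightarrow> real \<Rightarrow> real^'d \<Rightarrow> real^'d^'d \<Rightarrow> real"

definition quasilinear_G ::
  "(real \<Rightarrow> real^'d \<Rightarrow> real \<Rightarrow> real^'m^'d) \<Rightarrow> (real \<Rightarrow> real^'d \<Rightarrow> real \<Rightarrow> real^'m \<Rightarrow> real^'d) \<Rightarrow>
   (real \<Rightarrow> real^'d \<Rightarrow> real \<Rightarrow> real^'m \<Rightarrow> real) \<Rightarrow> 'd nonlinearity" where
  "quasilinear_G \<sigma> b f t x y z \<gamma> =
     1/2 * frob (\<sigma> t x y ** transpose (\<sigma> t x y)) \<gamma>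
     + b t x y (transpose (\<sigma> t x y) *v z) \<bullet> z
     + f t x y (transpose (\<sigma> t x y) *v z)"

definition classical_solution ::
  "real \<Rightarrow> 'd nonlinearity \<Rightarrow> (real^'d \<Rightarrow> real) \<Rightarrow> (real \<Rightarrow> real^'d \<Rightarrow> real) \<Rightarrow> bool" where
  "classical_solution T G g u \<longleftrightarrow> C12 T u \<and>
     (\<forall>t\<in>{0..<T}. \<forall>x. - dt T u t x - G t x (u t x) (grad (u t) x) (hess (u t) x) = 0) \<and>
     (\<forall>x. u T x = g x)"

text \<open>The derivative in \<open>\<gamma>\<close> is taken along symmetric matrices, and is represented by a symmetric
  matrix; that makes it unique.\<close>

definition G_gamma ::
  "'d nonlinearity \<Rightarrow> real \<Rightarrow> real^'d \<Rightarrow> real \<Rightarrow> real^'d \<Rightarrow> real^'d^'d \<Rightarrow> real^'d^'d" where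
  "G_gamma G t x y z \<gamma> = (THE A. A \<in> sym_mats \<and>
     ((\<lambda>\<eta>. G t x y z \<eta>) has_derivative (\<lambda>\<eta>. frob A \<eta>)) (at \<gamma> within sym_mats))"

section \<open>Assumption (M)\<close>

definition Gtilde_gamma ::
  "'d nonlinearity \<Rightarrow> (real \<Rightarrow> real^'d \<Rightarrow> real^'d^'d) \<Rightarrow>
   real \<Rightarrow> real^'d \<Rightarrow> real \<Rightarrow> real^'d \<Rightarrow> real^'d^'d \<Rightarrow> real^'d^'d" where
  "Gtilde_gamma G \<sigma>0 t x y z \<gamma> =
     matrix_inv (\<sigma>0 t x) ** G_gamma G t x y z \<gamma> ** transpose (matrix_inv (\<sigma>0 t x))"

text \<open>Suprema and infima are taken in the extended reals, so that an empty set of admissible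
  constants yields \<open>-\<infinity>\<close> (supremum) or \<open>\<infinity>\<close> (infimum) rather than an unspecified real.\<close>

definition alpha_lower ::
  "'d nonlinearity \<Rightarrow> (real \<Rightarrow> real^'d \<Rightarrow> real^'d^'d) \<Rightarrow> real \<Rightarrow> real^'d \<Rightarrow> ereal" where
  "alpha_lower G \<sigma>0 t x = (SUP \<alpha>\<in>{\<alpha>. 0 < \<alpha> \<and> (\<forall>y z. \<forall>\<gamma>\<in>sym_mats.
     loewner_le (\<alpha> *\<^sub>R mat 1) (diag_part (Gtilde_gamma G \<sigma>0 t x y z \<gamma>)))}. ereal \<alpha>)"

definition alpha_upper ::
  "'d nonlinearity \<Rightarrow> (real \<Rightarrow> real^'d \<Rightarrow> real^'d^'d) \<Rightarrow> real \<Rightarrow> real^'d \<Rightarrow> ereal" where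
  "alpha_upper G \<sigma>0 t x = (INF \<alpha>\<in>{\<alpha>. 0 < \<alpha> \<and> (\<forall>y z. \<forall>\<gamma>\<in>sym_mats.
     loewner_le (diag_part (Gtilde_gamma G \<sigma>0 t x y z \<gamma>)) (\<alpha> *\<^sub>R mat 1))}. ereal \<alpha>)"

definition theta ::
  "'d nonlinearity \<Rightarrow> (real \<Rightarrow> real^'d \<Rightarrow> real^'d^'d) \<Rightarrow> real \<Rightarrow> real^'d \<Rightarrow> ereal" where
  "theta G \<sigma>0 t x = (INF \<theta>\<in>{\<theta>. 0 \<le> \<theta> \<and> (\<forall>y z. \<forall>\<gamma>\<in>sym_mats.
     loewner_le (diag_part (Gtilde_gamma G \<sigma>0 t x y z \<gamma>))
                ((1 + \<theta>) *\<^sub>R Gtilde_gamma G \<sigma>0 t x y z \<gamma>))}. ereal \<theta>)"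

text \<open>The quantities below are computed from the real values of the three above.  No infinite value
  gets silently converted under (M): it asks for \<open>theta \<le> 2\<close> and \<open>alpha_lower = c_p\<^sup>-\<^sup>2\<close> as extended
  reals, while \<open>alpha_upper\<close> is finite as soon as \<open>G_gamma\<close> is bounded in \<open>(y,z,\<gamma>)\<close>.\<close>

definition Lam ::
  "'d nonlinearity \<Rightarrow> (real \<Rightarrow> real^'d \<Rightarrow> real^'d^'d) \<Rightarrow> real \<Rightarrow> real^'d \<Rightarrow> real" where
  "Lam G \<sigma>0 t x = real_of_ereal (alpha_upper G \<sigma>0 t x) / real_of_ereal (alpha_lower G \<sigma>0 t x)"

definition alpha_p ::
  "'d nonlinearity \<Rightarrow> (real \<Rightarrow> real^'d \<Rightarrow> real^'d^'d) \<Rightarrow> real \<Rightarrow> real^'d \<Rightarrow> real \<Rightarrow> real" where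
  "alpha_p G \<sigma>0 t x p = (let \<theta> = real_of_ereal (theta G \<sigma>0 t x) in
     (p * (2 + 3 * \<theta>) - \<theta>) / (p * (1 + \<theta>)))"

definition c_p ::
  "'d nonlinearity \<Rightarrow> (real \<Rightarrow> real^'d \<Rightarrow> real^'d^'d) \<Rightarrow> real \<Rightarrow> real^'d \<Rightarrow> real \<Rightarrow> real" where
  "c_p G \<sigma>0 t x p = sqrt (2 * p * Lam G \<sigma>0 t x + alpha_p G \<sigma>0 t x p - 2 * p)"

definition lambda_p ::
  "'d::finite nonlinearity \<Rightarrow> (real \<Rightarrow> real^'d \<Rightarrow> real^'d^'d) \<Rightarrow> real \<Rightarrow> real^'d \<Rightarrow> real \<Rightarrow> real" where
  "lambda_p G \<sigma>0 t x p = (let d = real CARD('d); c = c_p G \<sigma>0 t x p in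
     sqrt p * ((1 - p + p * d) * c - 2 * p * d * Lam G \<sigma>0 t x / c)
     * (sqrt (real_of_ereal (alpha_lower G \<sigma>0 t x)) / norm (matrix_inv (\<sigma>0 t x))))"

definition p_range ::
  "'d nonlinearity \<Rightarrow> (real \<Rightarrow> real^'d \<Rightarrow> real^'d^'d) \<Rightarrow> real \<Rightarrow> real^'d \<Rightarrow> real set" where
  "p_range G \<sigma>0 t x = (let \<theta> = real_of_ereal (theta G \<sigma>0 t x) in
     {\<theta> / (2 * (1 + \<theta>)) .. 1/3} \<inter> {0 <.. 1/3})"

definition lambda_star ::
  "real \<Rightarrow> 'd::finite nonlinearity \<Rightarrow> (real \<Rightarrow> real^'d \<Rightarrow> real^'d^'d) \<Rightarrow> ereal" where
  "lambda_star T G \<sigma>0 =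
     (INF (t, x)\<in>{0..T} \<times> UNIV. SUP p\<in>p_range G \<sigma>0 t x. ereal (lambda_p G \<sigma>0 t x p))"

definition scheme_data ::
  "real \<Rightarrow> (real \<Rightarrow> real^'d \<Rightarrow> real^'d^'d) \<Rightarrow> (real \<Rightarrow> real^'d \<Rightarrow> real) \<Rightarrow> bool" where
  "scheme_data T \<sigma>0 p \<longleftrightarrow>
     (\<forall>t\<in>{0..T}. \<forall>x. invertible (\<sigma>0 t x) \<and> 0 < p t x \<and> p t x < 1) \<and>
     bounded ((\<lambda>(t, x). \<sigma>0 t x) ` ({0..T} \<times> UNIV)) \<and>
     bounded ((\<lambda>(t, x). matrix_inv (\<sigma>0 t x)) ` ({0..T} \<times> UNIV)) \<and>
     bounded ((\<lambda>(t, x). inverse (p t x)) ` ({0..T} \<times> UNIV))"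

definition assumption_M1 ::
  "real \<Rightarrow> 'd::finite nonlinearity \<Rightarrow> (real \<Rightarrow> real^'d \<Rightarrow> real^'d^'d) \<Rightarrow> bool" where
  "assumption_M1 T G \<sigma>0 \<longleftrightarrow>
     (\<forall>t\<in>{0..T}. \<forall>x. theta G \<sigma>0 t x \<le> 2) \<and> 0 < lambda_star T G \<sigma>0"

definition assumption_M2 ::
  "real \<Rightarrow> 'd::finite nonlinearity \<Rightarrow> (real \<Rightarrow> real^'d \<Rightarrow> real^'d^'d) \<Rightarrow>
   (real \<Rightarrow> real^'d \<Rightarrow> real) \<Rightarrow> bool" where
  "assumption_M2 T G \<sigma>0 p \<longleftrightarrow> (\<forall>t\<in>{0..T}. \<forall>x.
     p t x \<in> p_range G \<sigma>0 t x \<and>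
     lambda_star T G \<sigma>0 / 2 \<le> ereal (lambda_p G \<sigma>0 t x (p t x)) \<and>
     alpha_lower G \<sigma>0 t x = ereal (1 / (c_p G \<sigma>0 t x (p t x))\<^sup>2))"

text \<open>Assumption (M) is the existence of a pair \<open>(\<sigma>0, p)\<close> with the following property.\<close>

definition satisfies_M ::
  "real \<Rightarrow> 'd::finite nonlinearity \<Rightarrow> (real \<Rightarrow> real^'d \<Rightarrow> real^'d^'d) \<Rightarrow>
   (real \<Rightarrow> real^'d \<Rightarrow> real) \<Rightarrow> bool" where
  "satisfies_M T G \<sigma>0 p \<longleftrightarrow>
     scheme_data T \<sigma>0 p \<and> assumption_M1 T G \<sigma>0 \<and> assumption_M2 T G \<sigma>0 p"

section \<open>The scheme\<close>

text \<open>The law of one component of \<open>\<xi>\<close> (see \<open>pmf_xi1\<close> below for the weights), and of \<open>\<xi>\<close> itself.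
  As the law has finite support, the expectations below are finite sums and make sense for
  arbitrary \<open>\<phi>\<close>, measurable or not.\<close>

definition xi1_pmf :: "real \<Rightarrow> real pmf" where
  "xi1_pmf p = bind_pmf (bernoulli_pmf p)
     (\<lambda>b. if b then pmf_of_set {1 / sqrt p, - (1 / sqrt p)} else return_pmf 0)"

definition xi_pmf :: "real \<Rightarrow> (real^'d) pmf" where
  "xi_pmf p = map_pmf (\<lambda>\<omega>. \<chi> i. \<omega> i) (Pi_pmf (UNIV :: 'd set) 0 (\<lambda>_. xi1_pmf p))"

definition K1 :: "real^'d^'d \<Rightarrow> real \<Rightarrow> real^'d \<Rightarrow> real^'d" where
  "K1 s h \<xi> = (1 / sqrt h) *\<^sub>R (transpose (matrix_inv s) *v \<xi>)"

definition K2 :: "real^'d^'d \<Rightarrow> real \<Rightarrow> real \<Rightarrow> real^'d \<Rightarrow> real^'d^'d" where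
  "K2 s p h \<xi> = (let X = (\<chi> i j. \<xi> $ i * \<xi> $ j) in
     (1 / ((1 - p) * h)) *\<^sub>R
       (transpose (matrix_inv s) **
        ((1 - p) *\<^sub>R X - (1 - 3 * p) *\<^sub>R diag_part X - (2 * p) *\<^sub>R mat 1) **
        matrix_inv s))"

definition Dop0 :: "real^'d^'d \<Rightarrow> real \<Rightarrow> real \<Rightarrow> (real^'d \<Rightarrow> real) \<Rightarrow> real^'d \<Rightarrow> real" where
  "Dop0 s p h \<phi> x = measure_pmf.expectation (xi_pmf p) (\<lambda>\<xi>. \<phi> (x + sqrt h *\<^sub>R (s *v \<xi>)))"

definition Dop1 :: "real^'d^'d \<Rightarrow> real \<Rightarrow> real \<Rightarrow> (real^'d \<Rightarrow> real) \<Rightarrow> real^'d \<Rightarrow> real^'d" where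
  "Dop1 s p h \<phi> x =
     measure_pmf.expectation (xi_pmf p) (\<lambda>\<xi>. \<phi> (x + sqrt h *\<^sub>R (s *v \<xi>)) *\<^sub>R K1 s h \<xi>)"

definition Dop2 :: "real^'d^'d \<Rightarrow> real \<Rightarrow> real \<Rightarrow> (real^'d \<Rightarrow> real) \<Rightarrow> real^'d \<Rightarrow> real^'d^'d" where
  "Dop2 s p h \<phi> x =
     measure_pmf.expectation (xi_pmf p) (\<lambda>\<xi>. \<phi> (x + sqrt h *\<^sub>R (s *v \<xi>)) *\<^sub>R K2 s p h \<xi>)"

definition F_of ::
  "'d nonlinearity \<Rightarrow> (real \<Rightarrow> real^'d \<Rightarrow> real^'d^'d) \<Rightarrow> 'd nonlinearity" where
  "F_of G \<sigma>0 t x y z \<gamma> = G t x y z \<gamma> - 1/2 * frob (\<sigma>0 t x ** transpose (\<sigma>0 t x)) \<gamma>"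

definition T_op ::
  "'d nonlinearity \<Rightarrow> (real \<Rightarrow> real^'d \<Rightarrow> real^'d^'d) \<Rightarrow> (real \<Rightarrow> real^'d \<Rightarrow> real) \<Rightarrow>
   real \<Rightarrow> real \<Rightarrow> (real^'d \<Rightarrow> real) \<Rightarrow> real^'d \<Rightarrow> real" where
  "T_op G \<sigma>0 p t h \<phi> x =
     Dop0 (\<sigma>0 t x) (p t x) h \<phi> x
     + h * F_of G \<sigma>0 t x (Dop0 (\<sigma>0 t x) (p t x) h \<phi> x)
             (Dop1 (\<sigma>0 t x) (p t x) h \<phi> x) (Dop2 (\<sigma>0 t x) (p t x) h \<phi> x)"

text \<open>\<open>u\<close> is the approximating solution with \<open>n\<close> time steps; by \<open>ex_approx_solution\<close> and
  \<open>approx_solution_unique\<close> below these equations determine it on \<open>[0,T]\<close>.\<close>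

definition approx_solution ::
  "real \<Rightarrow> 'd nonlinearity \<Rightarrow> (real \<Rightarrow> real^'d \<Rightarrow> real^'d^'d) \<Rightarrow> (real \<Rightarrow> real^'d \<Rightarrow> real) \<Rightarrow>
   (real^'d \<Rightarrow> real) \<Rightarrow> nat \<Rightarrow> (real \<Rightarrow> real^'d \<Rightarrow> real) \<Rightarrow> bool" where
  "approx_solution T G \<sigma>0 p g n u \<longleftrightarrow>
     (let h = T / real n; tm = (\<lambda>i. real i * h) in
       u (tm n) = g \<and>
       (\<forall>i\<in>{1..n}. \<forall>t\<in>{tm (i - 1)..<tm i}. u t = T_op G \<sigma>0 p t (tm i - t) (u (tm i))))"

section \<open>Sanity checks\<close>

lemma frob_inner: "frob A B = A \<bullet> B"
  by (simp add: frob_def trace_def matrix_matrix_mult_def transpose_def inner_vec_def)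

lemma norm_frob: "norm A = sqrt (frob A A)"
  by (simp add: frob_inner norm_eq_sqrt_inner)

lemma G_gamma_eqI:
  fixes A \<gamma> :: "real^'d^'d"
  assumes A: "A \<in> sym_mats" and \<gamma>: "\<gamma> \<in> sym_mats"
    and d: "((\<lambda>\<eta>. G t x y z \<eta>) has_derivative (\<lambda>\<eta>. frob A \<eta>)) (at \<gamma> within sym_mats)"
  shows "G_gamma G t x y z \<gamma> = A"
  unfolding G_gamma_def
proof (rule the_equality)
  show "A \<in> sym_mats \<and> (G t x y z has_derivative frob A) (at \<gamma> within sym_mats)"
    using A d by simp
next
  fix B assume B: "B \<in> sym_mats \<and> (G t x y z has_derivative frob B) (at \<gamma> within sym_mats)"
  define v where "v = A - B"
  have tr: "transpose (M + c *\<^sub>R N) = transpose M + c *\<^sub>R transpose N" for M N :: "real^'d^'d" and c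
    by (simp add: transpose_def vec_eq_iff)
  have v: "v \<in> sym_mats"
    using A B tr[of A "-1" B] by (simp add: v_def sym_mats_def)
  have line: "((\<lambda>s. G t x y z (\<gamma> + s *\<^sub>R v)) has_derivative (\<lambda>s. frob C (s *\<^sub>R v))) (at 0)"
    if C: "(G t x y z has_derivative frob C) (at \<gamma> within sym_mats)" for C
  proof -
    have l: "((\<lambda>s. \<gamma> + s *\<^sub>R v) has_derivative (\<lambda>s. s *\<^sub>R v)) (at (0::real) within UNIV)"
      by (auto intro!: derivative_eq_intros)
    have "range (\<lambda>s. \<gamma> + s *\<^sub>R v) \<subseteq> sym_mats"
      using v \<gamma> by (auto simp: sym_mats_def tr)
    hence "(G t x y z has_derivative frob C) (at (\<gamma> + 0 *\<^sub>R v) within range (\<lambda>s. \<gamma> + s *\<^sub>R v))"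
      using has_derivative_subset[OF C] by simp
    from has_derivative_in_compose[OF l this] show ?thesis by simp
  qed
  have "(\<lambda>s. frob A (s *\<^sub>R v)) = (\<lambda>s. frob B (s *\<^sub>R v))"
    using has_derivative_unique[OF line[OF d] line] B by blast
  hence "frob A (1 *\<^sub>R v) = frob B (1 *\<^sub>R v)" by (rule fun_cong)
  hence "v \<bullet> v = 0" by (simp add: frob_inner v_def inner_diff_left)
  thus "B = A" by (simp add: v_def)
qed

lemma G_gamma_quasilinear:
  assumes "\<gamma> \<in> sym_mats"
  shows "G_gamma (quasilinear_G \<sigma> b f) t x y z \<gamma> = (1/2) *\<^sub>R (\<sigma> t x y ** transpose (\<sigma> t x y))"
proof (rule G_gamma_eqI[OF _ assms])
  have "transpose (c *\<^sub>R M) = c *\<^sub>R transpose M" for M :: "real^'a^'a" and c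
    by (simp add: transpose_def vec_eq_iff)
  thus "(1/2) *\<^sub>R (\<sigma> t x y ** transpose (\<sigma> t x y)) \<in> sym_mats"
    by (simp add: sym_mats_def matrix_transpose_mul)
  show "(quasilinear_G \<sigma> b f t x y z has_derivative
      frob ((1/2) *\<^sub>R (\<sigma> t x y ** transpose (\<sigma> t x y)))) (at \<gamma> within sym_mats)"
    unfolding quasilinear_G_def[abs_def] frob_inner[abs_def]
    by (auto intro!: derivative_eq_intros)
qed

lemma pmf_xi1:
  assumes "0 < p" "p < 1"
  shows "pmf (xi1_pmf p) (1 / sqrt p) = p / 2" "pmf (xi1_pmf p) (- (1 / sqrt p)) = p / 2"
    "pmf (xi1_pmf p) 0 = 1 - p"
proof -
  have "1 / sqrt p \<noteq> - (1 / sqrt p)"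
    using assms by (simp add: divide_simps)
  with assms show "pmf (xi1_pmf p) (1 / sqrt p) = p / 2"
    "pmf (xi1_pmf p) (- (1 / sqrt p)) = p / 2" "pmf (xi1_pmf p) 0 = 1 - p"
    by (simp_all add: xi1_pmf_def pmf_bind pmf_of_set card_insert_if indicator_def)
qed

lemma ex_approx_solution:
  assumes T: "0 < T" and n: "0 < n"
  shows "\<exists>u. approx_solution T G \<sigma>0 p g n u"
proof -
  define h where "h = T / real n"
  define tm where "tm i = real i * h" for i
  have h: "0 < h" using T n by (simp add: h_def)
  have tmT: "tm n = T" using n by (simp add: tm_def h_def)
  define W where "W = rec_nat g
    (\<lambda>k \<phi>. T_op G \<sigma>0 p (tm (n - Suc k)) (tm (n - k) - tm (n - Suc k)) \<phi>)"
  have W0: "W 0 = g" by (simp add: W_def)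
  have WS: "W (Suc k) = T_op G \<sigma>0 p (tm (n - Suc k)) (tm (n - k) - tm (n - Suc k)) (W k)" for k
    by (simp add: W_def)
  define u where "u t = (if t = T then g else
    T_op G \<sigma>0 p t (tm (Suc (nat \<lfloor>t / h\<rfloor>)) - t) (W (n - Suc (nat \<lfloor>t / h\<rfloor>))))" for t
  have fl: "nat \<lfloor>t / h\<rfloor> = i" if "t \<in> {tm i..<tm (Suc i)}" for t i
  proof -
    have "\<lfloor>t / h\<rfloor> = int i"
      using that h by (intro floor_unique) (auto simp: tm_def field_simps)
    thus ?thesis by simp
  qed
  have uT: "u (tm n) = g" by (simp add: u_def tmT)
  have step: "u t = T_op G \<sigma>0 p t (tm (Suc i) - t) (W (n - Suc i))"
    if "i < n" "t \<in> {tm i..<tm (Suc i)}" for t i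
  proof -
    have "tm (Suc i) \<le> tm n" using that(1) h by (simp add: tm_def)
    hence "t \<noteq> T" using that(2) tmT by auto
    thus ?thesis using fl[OF that(2)] by (simp add: u_def)
  qed
  have layer: "u (tm i) = W (n - i)" if "i \<le> n" for i
  proof (cases "i = n")
    case True thus ?thesis by (simp add: uT W0)
  next
    case False
    hence i: "i < n" using that by simp
    have "tm i \<in> {tm i..<tm (Suc i)}" using h by (simp add: tm_def)
    from step[OF i this] WS[of "n - Suc i"] i show ?thesis
      by (simp add: Suc_diff_Suc Suc_diff_le)
  qed
  have "u t = T_op G \<sigma>0 p t (tm i - t) (u (tm i))"
    if "i \<in> {1..n}" "t \<in> {tm (i - 1)..<tm i}" for i t
    using that step[of "i - 1" t] layer[of i] by auto
  hence "approx_solution T G \<sigma>0 p g n u"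
    using uT unfolding approx_solution_def Let_def tm_def h_def by blast
  thus ?thesis by blast
qed

lemma approx_solution_unique:
  assumes T: "0 < T" and n: "0 < n"
    and u: "approx_solution T G \<sigma>0 p g n u" and v: "approx_solution T G \<sigma>0 p g n v"
    and t: "t \<in> {0..T}"
  shows "u t = v t"
proof -
  define h where "h = T / real n"
  define tm where "tm i = real i * h" for i
  have h: "0 < h" using T n by (simp add: h_def)
  have tmT: "tm n = T" using n by (simp add: tm_def h_def)
  have uT: "u (tm n) = v (tm n)"
    using u v unfolding approx_solution_def Let_def tm_def h_def by simp
  have us: "w t = T_op G \<sigma>0 p t (tm (Suc i) - t) (w (tm (Suc i)))"
    if "approx_solution T G \<sigma>0 p g n w" "i < n" "t \<in> {tm i..<tm (Suc i)}" for w t i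
  proof -
    have "\<forall>i\<in>{1..n}. \<forall>t\<in>{tm (i - 1)..<tm i}. w t = T_op G \<sigma>0 p t (tm i - t) (w (tm i))"
      using that(1) unfolding approx_solution_def Let_def tm_def h_def by blast
    from bspec[OF this, of "Suc i"] that(2,3) show ?thesis by simp
  qed
  have layer: "u (tm i) = v (tm i)" if "i \<le> n" for i
    using that
  proof (induction rule: inc_induct)
    case base show ?case by (rule uT)
  next
    case (step i)
    have "tm i \<in> {tm i..<tm (Suc i)}" using h by (simp add: tm_def)
    from us[OF u step(2) this] us[OF v step(2) this] step(3) show ?case by simp
  qed
  show ?thesis
  proof (cases "t = T")
    case True thus ?thesis using uT tmT by simp
  next
    case False
    define i where "i = nat \<lfloor>t / h\<rfloor>"
    have "0 \<le> t / h" using t h by simp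
    hence "real i \<le> t / h" "t / h < real i + 1" by (auto simp: i_def)
    hence ti: "t \<in> {tm i..<tm (Suc i)}" using h by (auto simp: tm_def field_simps)
    have "tm i < tm n" using ti t False tmT by auto
    hence "i < n" using h by (simp add: tm_def)
    from us[OF u this ti] us[OF v this ti] layer[of "Suc i"] \<open>i < n\<close> show ?thesis by simp
  qed
qed

end

theory Submission
  imports Defs
begin

text \<open>With frozen coefficients, one step of the scheme applied to a difference \<open>\<delta>\<close> is an average of
  \<open>\<delta>\<close> over the increments \<open>\<xi>\<close> with weights \<open>1 + h S : K\<^sub>2 + h \<beta> \<cdot> K\<^sub>1\<close>, where
  \<open>S = G\<^sub>\<gamma> - a\<^sub>0 / 2\<close> and \<open>\<beta>\<close> is bounded; these weights have mean one.  The choice of \<open>c\<^sub>p\<close> in (M)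
  makes \<open>1 + h S : K\<^sub>2\<close> at least \<open>\<lambda>\<^sub>p |\<sigma>\<^sub>0\<^sup>-\<^sup>1| / \<surd>p\<close>, which dominates \<open>h \<beta> \<cdot> K\<^sub>1 = O(\<surd>h)\<close> once \<open>h\<close> is
  small, so the step is stable up to a factor \<open>1 + C h\<close>.  Although the scheme is not monotone in
  \<open>u\<^sub>h\<close> itself, this suffices because the dependence of \<open>\<sigma>\<close> on \<open>y\<close> is only ever multiplied by
  discrete derivatives of the smooth solution.  A Taylor expansion to fourth order and the moments of
  \<open>\<xi>\<close> give a local error \<open>O(h\<^sup>2)\<close>, and the two add up to \<open>O(h)\<close>.\<close>

section \<open>Matrices in the Frobenius norm\<close>

text \<open>Three points shape the estimates. No bound is available on the discrete derivatives of
  the approximate solution, so products are differenced asymmetrically: differences of coefficients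
  only meet discrete derivatives of \<open>u\<close>. This also concerns
  \<open>b \<bullet> z\<close>, which need not be Lipschitz in \<open>z\<close>. Next, the factor
  \<open>|\<sigma>0^-1| / sqrt p\<close> in the lower bound for the weights is also the factor in
  the size of \<open>K1\<close>, apart from \<open>sqrt d\<close>. It cancels, and the smallness
  condition on \<open>h\<close> does not depend on \<open>(t, x)\<close>. Last, the cubic Taylor
  term has size \<open>h * sqrt h\<close>; against \<open>K2\<close>, of size \<open>1 / h\<close>,
  it would spoil the Hessian by an error of order \<open>sqrt h\<close>. The symmetry of \<xi>
  removes it there and in \<open>Dop0\<close>, where the weights are even. Against the odd weight
  \<open>K1\<close>, of size \<open>1 / sqrt h\<close>, it survives, but costs only O(h) in the
  gradient, which the factor \<open>h\<close> in front of \<open>F\<close> makes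
  O(\<open>h\<^sup>2\<close>).\<close>

lemma norm_vec_sq: "(norm (x :: 'a::real_inner^'n))\<^sup>2 = (\<Sum>i\<in>UNIV. (norm (x $ i))\<^sup>2)"
  by (simp add: power2_norm_eq_inner inner_vec_def)

lemma norm_matrix_vector_mult_le:
  fixes A :: "real^'n^'k"
  shows "norm (A *v v) \<le> norm A * norm v"
proof -
  have "(norm (A *v v))\<^sup>2 = (\<Sum>i\<in>UNIV. (A $ i \<bullet> v)\<^sup>2)"
    by (simp add: norm_vec_sq matrix_vector_mult_def inner_vec_def)
  also have "\<dots> \<le> (\<Sum>i\<in>UNIV. (norm (A $ i))\<^sup>2 * (norm v)\<^sup>2)"
    by (intro sum_mono) (metis Cauchy_Schwarz_ineq power2_norm_eq_inner)
  also have "\<dots> = (norm A * norm v)\<^sup>2"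
    by (simp add: norm_vec_sq[of A] power_mult_distrib sum_distrib_right)
  finally show ?thesis by (rule power2_le_imp_le) simp
qed

lemma norm_transpose_real:
  fixes A :: "real^'n^'k"
  shows "norm (transpose A) = norm A"
proof -
  have "(norm (transpose A))\<^sup>2 = (norm A)\<^sup>2"
    by (simp add: norm_vec_sq transpose_def) (rule sum.swap)
  thus ?thesis by simp
qed

lemma norm_matrix_matrix_mult_le:
  fixes A :: "real^'n^'k" and B :: "real^'l^'n"
  shows "norm (A ** B) \<le> norm A * norm B"
proof -
  have row: "(A ** B) $ i = transpose B *v (A $ i)" for i
    by (simp add: vec_eq_iff matrix_matrix_mult_def matrix_vector_mult_def transpose_def mult.commute)
  have "(norm (A ** B))\<^sup>2 = (\<Sum>i\<in>UNIV. (norm (transpose B *v (A $ i)))\<^sup>2)"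
    by (simp add: norm_vec_sq[of "A ** B"] row)
  also have "\<dots> \<le> (\<Sum>i\<in>UNIV. (norm B * norm (A $ i))\<^sup>2)"
    by (intro sum_mono power_mono)
      (use norm_matrix_vector_mult_le[of "transpose B"] in \<open>auto simp: norm_transpose_real\<close>)
  also have "\<dots> = (norm A * norm B)\<^sup>2"
    by (simp add: norm_vec_sq[of A] power_mult_distrib sum_distrib_left mult.commute)
  finally show ?thesis by (rule power2_le_imp_le) simp
qed

lemma inner_matrix_mult_left:
  fixes A :: "real^'n^'k" and P :: "real^'k^'l" and X :: "real^'n^'l"
  shows "A \<bullet> (transpose P ** X) = (P ** A) \<bullet> X"
proof -
  have "A \<bullet> (transpose P ** X) = (\<Sum>i\<in>UNIV. \<Sum>j\<in>UNIV. \<Sum>k\<in>UNIV. P$k$i * A$i$j * X$k$j)"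
    by (simp add: inner_vec_def matrix_matrix_mult_def transpose_def sum_distrib_left mult_ac)
  also have "\<dots> = (\<Sum>i\<in>UNIV. \<Sum>k\<in>UNIV. \<Sum>j\<in>UNIV. P$k$i * A$i$j * X$k$j)"
    by (intro sum.cong refl sum.swap)
  also have "\<dots> = (\<Sum>k\<in>UNIV. \<Sum>i\<in>UNIV. \<Sum>j\<in>UNIV. P$k$i * A$i$j * X$k$j)"
    by (rule sum.swap)
  also have "\<dots> = (\<Sum>k\<in>UNIV. \<Sum>j\<in>UNIV. \<Sum>i\<in>UNIV. P$k$i * A$i$j * X$k$j)"
    by (intro sum.cong refl sum.swap)
  also have "\<dots> = (P ** A) \<bullet> X"
    by (simp add: inner_vec_def matrix_matrix_mult_def sum_distrib_right)
  finally show ?thesis .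
qed

lemma inner_matrix_mult_right:
  fixes A :: "real^'n^'k" and P :: "real^'n^'l" and X :: "real^'l^'k"
  shows "A \<bullet> (X ** P) = (A ** transpose P) \<bullet> X"
proof -
  have "A \<bullet> (X ** P) = (\<Sum>i\<in>UNIV. \<Sum>j\<in>UNIV. \<Sum>k\<in>UNIV. A$i$j * P$k$j * X$i$k)"
    by (simp add: inner_vec_def matrix_matrix_mult_def sum_distrib_left mult_ac)
  also have "\<dots> = (\<Sum>i\<in>UNIV. \<Sum>k\<in>UNIV. \<Sum>j\<in>UNIV. A$i$j * P$k$j * X$i$k)"
    by (intro sum.cong refl sum.swap)
  also have "\<dots> = (A ** transpose P) \<bullet> X"
    by (simp add: inner_vec_def matrix_matrix_mult_def transpose_def sum_distrib_right)
  finally show ?thesis .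
qed

text \<open>Adjointness moves the conjugation by the inverse of \<sigma>0 from \<open>K2\<close> to
  the coefficient matrix; this is how the conjugated matrix \<open>Gtilde_gamma\<close>, in which
  (M) is phrased, enters the weights.\<close>

lemma inner_congruence:
  fixes A :: "real^'k^'k" and P :: "real^'k^'l" and X :: "real^'l^'l"
  shows "A \<bullet> (transpose P ** X ** P) = (P ** A ** transpose P) \<bullet> X"
  by (simp only: inner_matrix_mult_right[of A "transpose P ** X" P] inner_matrix_mult_left matrix_mul_assoc)

lemma matrix_inv_works:
  fixes s :: "real^'d^'d"
  assumes "invertible s"
  shows "s ** matrix_inv s = mat 1" "matrix_inv s ** s = mat 1"
  using someI_ex[OF assms[unfolded invertible_def]] by (auto simp: matrix_inv_def)

section \<open>The law of the scheme's increments\<close>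

lemma set_xi1_pmf:
  assumes "0 < p" "p < 1"
  shows "set_pmf (xi1_pmf p) = {1 / sqrt p, - (1 / sqrt p), 0}"
  using assms by (auto simp: xi1_pmf_def set_pmf_bernoulli split: if_splits)

lemma expectation_xi1:
  assumes "0 < p" "p < 1"
  shows "measure_pmf.expectation (xi1_pmf p) F
    = p / 2 * (F (1 / sqrt p) + F (- (1 / sqrt p))) + (1 - p) * (F 0 :: real)"
proof -
  have ne: "1 / sqrt p \<noteq> - (1 / sqrt p)" using assms by (simp add: divide_simps)
  have "measure_pmf.expectation (xi1_pmf p) F
    = (\<Sum>a\<in>{1 / sqrt p, - (1 / sqrt p), 0}. F a * pmf (xi1_pmf p) a)"
    by (rule integral_measure_pmf_real) (use set_xi1_pmf[OF assms] in auto)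
  also have "\<dots> = F (1 / sqrt p) * (p/2) + F (- (1 / sqrt p)) * (p/2) + F 0 * (1 - p)"
    using ne assms by (simp add: pmf_xi1[OF assms])
  finally show ?thesis by (simp add: algebra_simps)
qed

lemma map_uminus_xi1_pmf:
  assumes "0 < p" "p < 1"
  shows "map_pmf uminus (xi1_pmf p) = xi1_pmf p"
proof (rule pmf_eqI)
  fix x :: real
  have m: "pmf (map_pmf uminus (xi1_pmf p)) x = pmf (xi1_pmf p) (- x)"
    using pmf_map_inj'[of uminus "xi1_pmf p" "- x"] by simp
  show "pmf (map_pmf uminus (xi1_pmf p)) x = pmf (xi1_pmf p) x"
  proof (cases "x \<in> {1 / sqrt p, - (1 / sqrt p), 0}")
    case True
    thus ?thesis unfolding m using pmf_xi1[OF assms] by auto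
  next
    case False
    hence "- x \<notin> {1 / sqrt p, - (1 / sqrt p), 0}" by (auto simp: minus_equation_iff)
    with False have "x \<notin> set_pmf (xi1_pmf p)" "- x \<notin> set_pmf (xi1_pmf p)"
      by (auto simp: set_xi1_pmf[OF assms])
    thus ?thesis unfolding m by (simp add: set_pmf_iff)
  qed
qed

text \<open>The sign of a component is irrelevant to the bounds on the weights, so the support is
  recorded through squares and without square roots.\<close>

lemma set_xi_pmf:
  assumes "0 < p" "p < 1" and "\<xi> \<in> set_pmf (xi_pmf p)"
  shows "\<xi> $ i = 0 \<or> p * (\<xi> $ i)\<^sup>2 = 1"
proof -
  have "\<xi> $ i \<in> set_pmf (xi1_pmf p)"
    using assms(3) by (auto simp: xi_pmf_def set_Pi_pmf PiE_dflt_def)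
  thus ?thesis using assms(1,2) by (auto simp: set_xi1_pmf power_divide)
qed

lemma finite_set_xi_pmf:
  assumes "0 < p" "p < 1"
  shows "finite (set_pmf (xi_pmf p :: (real^'d) pmf))"
  unfolding xi_pmf_def set_map_pmf
  by (intro finite_imageI finite_subset[OF set_Pi_pmf_subset'] finite_PiE_dflt)
     (simp_all add: set_xi1_pmf[OF assms])

lemma integrable_xi_pmf:
  fixes F :: "real^'d \<Rightarrow> 'b::{banach, second_countable_topology}"
  assumes "0 < p" "p < 1"
  shows "integrable (measure_pmf (xi_pmf p)) F"
  by (rule integrable_measure_pmf_finite[OF finite_set_xi_pmf[OF assms]])

text \<open>The law is invariant under a change of sign, so the expectation of an odd integrand
  equals its own negative. Terms of odd total order in the expansions vanish this way, without
  computing moments.\<close>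

lemma expectation_xi_odd:
  fixes F :: "real^'d \<Rightarrow> 'b::{banach, second_countable_topology}"
  assumes "0 < p" "p < 1" and odd: "\<And>\<xi>. F (- \<xi>) = - F \<xi>"
  shows "measure_pmf.expectation (xi_pmf p) F = 0"
proof -
  have "map_pmf uminus (xi_pmf p :: (real^'d) pmf)
      = map_pmf (\<lambda>\<omega>. \<chi> i. \<omega> i) (map_pmf (\<lambda>h. uminus \<circ> h) (Pi_pmf (UNIV :: 'd set) 0 (\<lambda>_. xi1_pmf p)))"
    by (auto simp: xi_pmf_def pmf.map_comp o_def vec_eq_iff intro!: map_pmf_cong)
  also have "map_pmf (\<lambda>h. uminus \<circ> h) (Pi_pmf (UNIV :: 'd set) 0 (\<lambda>_. xi1_pmf p))
      = Pi_pmf UNIV 0 (\<lambda>_. xi1_pmf p)"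
    using Pi_pmf_map[of "UNIV :: 'd set" uminus "0::real" 0 "\<lambda>_. xi1_pmf p"]
    by (simp add: map_uminus_xi1_pmf[OF assms(1,2)])
  finally have sym: "map_pmf uminus (xi_pmf p :: (real^'d) pmf) = xi_pmf p"
    by (simp add: xi_pmf_def)
  have "measure_pmf.expectation (xi_pmf p) F = measure_pmf.expectation (map_pmf uminus (xi_pmf p)) F"
    by (simp add: sym)
  also have "\<dots> = - measure_pmf.expectation (xi_pmf p) F"
    by (simp add: odd)
  finally have "measure_pmf.expectation (xi_pmf p) F + measure_pmf.expectation (xi_pmf p) F = 0"
    by (simp add: eq_neg_iff_add_eq_0)
  thus ?thesis by (simp add: scaleR_2[symmetric])
qed

text \<open>Independence of the components, in the form that reduces every mixed moment to
  one-dimensional ones.\<close>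

lemma expectation_xi_prod:
  fixes F :: "'d::finite \<Rightarrow> real \<Rightarrow> real"
  assumes "0 < p" "p < 1"
  shows "measure_pmf.expectation (xi_pmf p) (\<lambda>\<xi>. \<Prod>i\<in>UNIV. F i (\<xi> $ i))
    = (\<Prod>i\<in>UNIV. measure_pmf.expectation (xi1_pmf p) (F i))"
proof -
  let ?P = "Pi_pmf (UNIV :: 'd set) 0 (\<lambda>_. xi1_pmf p)"
  have fin: "finite (set_pmf ?P)"
    by (intro finite_subset[OF set_Pi_pmf_subset'] finite_PiE_dflt)
       (simp_all add: set_xi1_pmf[OF assms])
  have ind: "prob_space.indep_vars (measure_pmf ?P) (\<lambda>_. borel) (\<lambda>i \<omega>. F i (\<omega> i)) UNIV"
    by (rule prob_space.indep_vars_compose2[OF _ indep_vars_Pi_pmf])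
       (auto intro: measure_pmf.prob_space_axioms)
  have "measure_pmf.expectation ?P (\<lambda>\<omega>. \<Prod>i\<in>UNIV. F i (\<omega> i))
    = (\<Prod>i\<in>UNIV. measure_pmf.expectation ?P (\<lambda>\<omega>. F i (\<omega> i)))"
    by (rule prob_space.indep_vars_lebesgue_integral[OF _ _ ind])
       (auto intro: measure_pmf.prob_space_axioms integrable_measure_pmf_finite[OF fin])
  also have "\<dots> = (\<Prod>i\<in>UNIV. measure_pmf.expectation (map_pmf (\<lambda>\<omega>. \<omega> i) ?P) (F i))"
    by simp
  also have "\<dots> = (\<Prod>i\<in>UNIV. measure_pmf.expectation (xi1_pmf p) (F i))"
    by (simp only: Pi_pmf_component[OF finite_class.finite_UNIV]) simp
  finally show ?thesis by (simp add: xi_pmf_def)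
qed

section \<open>Moments of the increments\<close>

abbreviation xi_expect :: "real \<Rightarrow> (real^'d \<Rightarrow> real) \<Rightarrow> real" where
  "xi_expect p F \<equiv> measure_pmf.expectation (xi_pmf p) F"

text \<open>The zeroth power is included because the products below run over all coordinates, also
  those absent from a monomial. The fourth moment is \<open>p * (1 / sqrt p) ^ 4\<close>.\<close>

lemma expectation_xi1_power:
  assumes "0 < p" "p < 1"
  shows "measure_pmf.expectation (xi1_pmf p) (\<lambda>x. x ^ 0) = (1::real)"
    "measure_pmf.expectation (xi1_pmf p) (\<lambda>x. x ^ 2) = (1::real)"
    "measure_pmf.expectation (xi1_pmf p) (\<lambda>x. x ^ 4) = (1 / p::real)"
    "odd n \<Longrightarrow> measure_pmf.expectation (xi1_pmf p) (\<lambda>x. x ^ n) = (0::real)"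
proof -
  have 4: "(sqrt p)^4 = p^2" using assms by (simp add: power4_eq_xxxx power2_eq_square)
  show "measure_pmf.expectation (xi1_pmf p) (\<lambda>x. x ^ 0) = (1::real)"
    "measure_pmf.expectation (xi1_pmf p) (\<lambda>x. x ^ 2) = (1::real)"
    "measure_pmf.expectation (xi1_pmf p) (\<lambda>x. x ^ 4) = (1 / p::real)"
    "odd n \<Longrightarrow> measure_pmf.expectation (xi1_pmf p) (\<lambda>x. x ^ n) = (0::real)"
    using assms
    by (simp_all only: expectation_xi1)
       (auto simp: 4 power_divide field_simps power2_eq_square odd_pos)
qed

text \<open>A coordinate as a product over all coordinates: multiplying such expressions turns a
  monomial into a product of powers \<open>\<xi> $ m ^ c m\<close>, where \<open>c m\<close> counts
  the occurrences of \<open>m\<close> among the indices, and independence applies.\<close>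

lemma prod_power_of_bool:
  fixes \<xi> :: "real^'d"
  shows "(\<Prod>m\<in>UNIV. \<xi> $ m ^ of_bool (m = i)) = \<xi> $ i"
proof -
  have "(\<Prod>m\<in>UNIV. \<xi> $ m ^ of_bool (m = i)) = (\<Prod>m\<in>UNIV. if m = i then \<xi> $ m else 1)"
    by (intro prod.cong) auto
  thus ?thesis by simp
qed

lemma xi_second_moment:
  assumes "0 < p" "p < 1"
  shows "xi_expect p (\<lambda>\<xi>. \<xi> $ i * \<xi> $ j) = of_bool (i = j)"
proof -
  define c :: "'a \<Rightarrow> nat" where "c m = of_bool (m = i) + of_bool (m = j)" for m
  have "xi_expect p (\<lambda>\<xi>. \<xi> $ i * \<xi> $ j) = xi_expect p (\<lambda>\<xi>. \<Prod>m\<in>UNIV. \<xi> $ m ^ c m)"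
    by (simp add: c_def power_add prod.distrib prod_power_of_bool)
  also have "\<dots> = (\<Prod>m\<in>UNIV. measure_pmf.expectation (xi1_pmf p) (\<lambda>x. x ^ c m))"
    by (rule expectation_xi_prod[OF assms])
  also have "\<dots> = of_bool (i = j)"
  proof (cases "i = j")
    case True
    hence "c m = 0 \<or> c m = 2" for m by (auto simp: c_def)
    hence "measure_pmf.expectation (xi1_pmf p) (\<lambda>x. x ^ c m) = 1" for m
      using expectation_xi1_power(1,2)[OF assms] by metis
    thus ?thesis using True by simp
  next
    case False
    hence "odd (c i)" by (simp add: c_def)
    thus ?thesis using False expectation_xi1_power(4)[OF assms]
      by (auto intro!: prod_zero)
  qed
  finally show ?thesis .
qed

text \<open>The three pairings are those of a standard Gaussian vector (Wick's formula); the last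
  term is the excess kurtosis of one component, felt only when all four indices agree.\<close>

lemma xi_fourth_moment:
  assumes "0 < p" "p < 1"
  shows "xi_expect p (\<lambda>\<xi>. \<xi> $ i * \<xi> $ j * \<xi> $ k * \<xi> $ l)
    = of_bool (i = j) * of_bool (k = l) + of_bool (i = k) * of_bool (j = l)
    + of_bool (i = l) * of_bool (j = k)
    + (1 / p - 3) * (of_bool (i = j) * of_bool (j = k) * of_bool (k = l))" (is "_ = ?R")
proof -
  define c :: "'a \<Rightarrow> nat" where
    "c m = of_bool (m = i) + of_bool (m = j) + of_bool (m = k) + of_bool (m = l)" for m
  let ?\<mu> = "\<lambda>m. measure_pmf.expectation (xi1_pmf p) (\<lambda>x. x ^ c m)"
  have "xi_expect p (\<lambda>\<xi>. \<xi> $ i * \<xi> $ j * \<xi> $ k * \<xi> $ l)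
      = xi_expect p (\<lambda>\<xi>. \<Prod>m\<in>UNIV. \<xi> $ m ^ c m)"
    by (simp add: c_def power_add prod.distrib prod_power_of_bool)
  also have "\<dots> = (\<Prod>m\<in>UNIV. ?\<mu> m)"
    by (rule expectation_xi_prod[OF assms])
  also have "\<dots> = ?R"
  \<comment> \<open>An index of odd multiplicity kills the moment, and no pairing can match
    it.\<close>
  proof (cases "\<exists>m. odd (c m)")
    case True
    then obtain m where m: "odd (c m)" ..
    have "?R = 0" using m by (auto simp: c_def split: if_splits)
    moreover have "(\<Prod>m\<in>UNIV. ?\<mu> m) = 0"
      using expectation_xi1_power(4)[OF assms m] by (auto intro!: prod_zero)
    ultimately show ?thesis by simp
  next
    case False
    hence ev: "even (c m)" for m by simp
    show ?thesis
    proof (cases "i = j \<and> j = k \<and> k = l")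
      case True
      hence "c m = (if m = i then 4 else 0)" for m by (simp add: c_def)
      hence "?\<mu> m = (if m = i then 1 / p else 1)" for m
        using expectation_xi1_power(1,3)[OF assms] by auto
      thus ?thesis using True by simp
    next
      case False
      \<comment> \<open>Four indices with even multiplicities that are not all equal form two
        distinct values, each taken twice: exactly one pairing holds.\<close>
      have "c m = 0 \<or> c m = 2" for m
        using ev[of m] ev[of i] ev[of j] False by (auto simp: c_def split: if_splits)
      hence "?\<mu> m = 1" for m using expectation_xi1_power(1,2)[OF assms] by metis
      moreover have "?R = 1"
        using ev[of i] ev[of j] ev[of k] False by (auto simp: c_def split: if_splits)
      ultimately show ?thesis by simp
    qed
  qed
  finally show ?thesis .
qed

lemma xi_expect_mono:
  fixes F G :: "real^'d \<Rightarrow> real"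
  assumes "0 < p" "p < 1" and "\<And>\<xi>. \<xi> \<in> set_pmf (xi_pmf p) \<Longrightarrow> F \<xi> \<le> G \<xi>"
  shows "xi_expect p F \<le> xi_expect p G"
  by (intro integral_mono_AE integrable_xi_pmf assms(1,2)) (simp add: AE_measure_pmf_iff assms(3))

lemma xi_expect_abs_le:
  fixes F :: "real^'d \<Rightarrow> real"
  assumes "0 < p" "p < 1" and "\<And>\<xi>. \<xi> \<in> set_pmf (xi_pmf p) \<Longrightarrow> \<bar>F \<xi>\<bar> \<le> c"
  shows "\<bar>xi_expect p F\<bar> \<le> c"
proof -
  have "F \<xi> \<le> c" "- c \<le> F \<xi>" if "\<xi> \<in> set_pmf (xi_pmf p)" for \<xi>
    using assms(3)[OF that] by linarith+
  hence "xi_expect p F \<le> xi_expect p (\<lambda>_::real^'d. c)" "xi_expect p (\<lambda>_::real^'d. - c) \<le> xi_expect p F"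
    using xi_expect_mono[OF assms(1,2), of F "\<lambda>_. c"] xi_expect_mono[OF assms(1,2), of "\<lambda>_. - c" F]
    by blast+
  thus ?thesis by simp
qed

lemma norm_xi_le:
  fixes \<xi> :: "real^'d"
  assumes "0 < p" "p < 1" and "\<xi> \<in> set_pmf (xi_pmf p)"
  shows "norm \<xi> \<le> sqrt (real CARD('d) / p)"
proof -
  have "(\<xi> $ i)\<^sup>2 \<le> 1 / p" for i
    using set_xi_pmf[OF assms, of i] assms(1) by (auto simp: field_simps)
  hence "(\<Sum>i\<in>UNIV. (\<xi> $ i)\<^sup>2) \<le> (\<Sum>i\<in>(UNIV::'d set). 1 / p)" by (intro sum_mono)
  hence "(norm \<xi>)\<^sup>2 \<le> real CARD('d) / p" by (simp add: norm_vec_sq)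
  thus ?thesis by (rule real_le_rsqrt)
qed

text \<open>The bracket of \<open>K2\<close>, without the conjugation and the factor
  \<open>1 / ((1 - p) * h)\<close>, and entrywise so that the moment formulas apply. The multiple of
  the identity makes it centred; the correction of the diagonal compensates the excess
  kurtosis.\<close>

definition K2_core :: "real \<Rightarrow> real^'d \<Rightarrow> real^'d^'d" where
  "K2_core p \<xi> = (\<chi> k l. (1 - p) * (\<xi> $ k * \<xi> $ l)
     - (1 - 3 * p) * (of_bool (k = l) * (\<xi> $ k * \<xi> $ l)) - 2 * p * of_bool (k = l))"

lemma K2_eq_core:
  "K2 s p h \<xi> = (1 / ((1 - p) * h)) *\<^sub>R
     (transpose (matrix_inv s) ** K2_core p \<xi> ** matrix_inv s)"
proof -
  have "(1 - p) *\<^sub>R (\<chi> i j. \<xi> $ i * \<xi> $ j) - (1 - 3 * p) *\<^sub>R diag_part (\<chi> i j. \<xi> $ i * \<xi> $ j)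
      - (2 * p) *\<^sub>R mat 1 = K2_core p \<xi>"
    by (simp add: K2_core_def diag_part_def mat_def vec_eq_iff)
  thus ?thesis by (simp add: K2_def)
qed

lemma inner_K2:
  "S \<bullet> K2 s p h \<xi>
     = ((matrix_inv s ** S ** transpose (matrix_inv s)) \<bullet> K2_core p \<xi>) / ((1 - p) * h)"
  by (simp add: K2_eq_core inner_congruence)

lemma K2_core_uminus: "K2_core p (- \<xi>) = K2_core p \<xi>"
  by (simp add: K2_core_def)

lemma expectation_inner_K2_core:
  fixes R :: "real^'d^'d"
  assumes "0 < p" "p < 1"
  shows "xi_expect p (\<lambda>\<xi>. R \<bullet> K2_core p \<xi>) = 0"
proof -
  note [simp] = integrable_xi_pmf[OF assms]
  have e: "xi_expect p (\<lambda>\<xi>. K2_core p \<xi> $ k $ l) = 0" for k l :: 'd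
    by (simp add: K2_core_def xi_second_moment[OF assms])
  show ?thesis by (simp add: inner_vec_def e)
qed

text \<open>Paired with a quadratic form, the core acts as \<open>1 - p\<close> times the
  symmetrizer, with no trace of the kurtosis; symmetry of \<open>R\<close> merges the two pairings
  into the factor 2. This is why \<open>K2\<close> recovers the Hessian exactly from the quadratic
  Taylor term.\<close>

lemma expectation_quadratic_K2_core:
  fixes R B :: "real^'d^'d"
  assumes "0 < p" "p < 1" and R: "transpose R = R"
  shows "xi_expect p (\<lambda>\<xi>. (\<xi> \<bullet> (B *v \<xi>)) * (R \<bullet> K2_core p \<xi>)) = 2 * (1 - p) * (B \<bullet> R)"
proof -
  note [simp] = integrable_xi_pmf[OF assms(1,2)]
  have e: "xi_expect p (\<lambda>\<xi>. (\<xi> $ i * \<xi> $ j) * K2_core p \<xi> $ k $ l)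
      = (1 - p) * (of_bool (i = k) * of_bool (j = l) + of_bool (i = l) * of_bool (j = k))"
    for i j k l :: 'd
  proof -
    have "xi_expect p (\<lambda>\<xi>. (\<xi> $ i * \<xi> $ j) * K2_core p \<xi> $ k $ l)
      = xi_expect p (\<lambda>\<xi>. (1 - p) * (\<xi> $ i * \<xi> $ j * \<xi> $ k * \<xi> $ l)
          - (1 - 3 * p) * of_bool (k = l) * (\<xi> $ i * \<xi> $ j * \<xi> $ k * \<xi> $ l)
          - 2 * p * of_bool (k = l) * (\<xi> $ i * \<xi> $ j))"
      by (simp add: K2_core_def algebra_simps)
    also have "\<dots> = (1 - p) * xi_expect p (\<lambda>\<xi>. \<xi> $ i * \<xi> $ j * \<xi> $ k * \<xi> $ l)
          - (1 - 3 * p) * of_bool (k = l) * xi_expect p (\<lambda>\<xi>. \<xi> $ i * \<xi> $ j * \<xi> $ k * \<xi> $ l)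
          - 2 * p * of_bool (k = l) * xi_expect p (\<lambda>\<xi>. \<xi> $ i * \<xi> $ j)"
      by simp
    \<comment> \<open>For \<open>k = l\<close> the pairing \<open>i = j\<close> is removed by the
      term \<open>2 * p\<close>, and \<open>2 * p * (2 + 1 / p - 3) = 2 * (1 - p)\<close> brings the
      rest to the same factor as off the diagonal.\<close>
    also have "\<dots> = (1 - p) * (of_bool (i = k) * of_bool (j = l) + of_bool (i = l) * of_bool (j = k))"
      unfolding xi_fourth_moment[OF assms(1,2)] xi_second_moment[OF assms(1,2)]
      using assms by (auto simp: of_bool_def field_simps)
    finally show ?thesis .
  qed
  have "xi_expect p (\<lambda>\<xi>. (\<xi> \<bullet> (B *v \<xi>)) * (R \<bullet> K2_core p \<xi>))
     = xi_expect p (\<lambda>\<xi>. \<Sum>i\<in>UNIV. \<Sum>j\<in>UNIV. \<Sum>k\<in>UNIV. \<Sum>l\<in>UNIV.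
         B$i$j * R$k$l * ((\<xi> $ i * \<xi> $ j) * K2_core p \<xi> $ k $ l))"
  proof (rule arg_cong[where f = "xi_expect p"], rule ext)
    fix \<xi> :: "real^'d"
    have "(\<xi> \<bullet> (B *v \<xi>)) * X = (\<Sum>i\<in>UNIV. \<Sum>j\<in>UNIV. B$i$j * (\<xi> $ i * \<xi> $ j) * X)" for X
      by (simp add: inner_vec_def matrix_vector_mult_def sum_distrib_left sum_distrib_right mult_ac)
    also have "(\<Sum>i\<in>UNIV. \<Sum>j\<in>UNIV. B$i$j * (\<xi> $ i * \<xi> $ j) * (R \<bullet> K2_core p \<xi>)) =
      (\<Sum>i\<in>UNIV. \<Sum>j\<in>UNIV. \<Sum>k\<in>UNIV. \<Sum>l\<in>UNIV.
         B$i$j * R$k$l * ((\<xi> $ i * \<xi> $ j) * K2_core p \<xi> $ k $ l))"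
      by (simp add: inner_vec_def sum_distrib_left mult_ac)
    finally show "(\<xi> \<bullet> (B *v \<xi>)) * (R \<bullet> K2_core p \<xi>) = \<dots>" .
  qed
  also have "\<dots> = (\<Sum>i\<in>UNIV. \<Sum>j\<in>UNIV. \<Sum>k\<in>UNIV. \<Sum>l\<in>UNIV. B$i$j * R$k$l *
       ((1 - p) * (of_bool (i = k) * of_bool (j = l) + of_bool (i = l) * of_bool (j = k))))"
    by (simp add: e)
  also have "\<dots> = (1 - p) * (\<Sum>i\<in>UNIV. \<Sum>j\<in>UNIV. B$i$j * (R$i$j + R$j$i))"
  proof -
    have d: "(\<Sum>k\<in>UNIV. \<Sum>l\<in>UNIV. R$k$l * (of_bool (a = k) * of_bool (b = l))) = R$a$b" for a b
      by (simp add: of_bool_def if_distrib[of "\<lambda>x. x * _"] if_distrib[of "\<lambda>x. _ * x"] cong: if_cong)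
    have "(\<Sum>k\<in>UNIV. \<Sum>l\<in>UNIV. B$i$j * R$k$l *
        ((1 - p) * (of_bool (i = k) * of_bool (j = l) + of_bool (i = l) * of_bool (j = k))))
      = (1 - p) * (B$i$j * ((\<Sum>k\<in>UNIV. \<Sum>l\<in>UNIV. R$k$l * (of_bool (i = k) * of_bool (j = l)))
         + (\<Sum>k\<in>UNIV. \<Sum>l\<in>UNIV. R$k$l * (of_bool (j = k) * of_bool (i = l)))))" for i j
      by (simp only: sum_distrib_left sum.distrib[symmetric]) (simp add: algebra_simps)
    thus ?thesis by (simp only: d) (simp only: sum_distrib_left)
  qed
  also have "(\<Sum>i\<in>UNIV. \<Sum>j\<in>UNIV. B$i$j * (R$i$j + R$j$i)) = 2 * (B \<bullet> R)"
  proof -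
    have "R$j$i = R$i$j" for i j using R by (metis transpose_def vec_lambda_beta)
    thus ?thesis by (simp add: inner_vec_def sum_distrib_left mult.left_commute)
  qed
  finally show ?thesis by simp
qed

lemma expectation_bilinear_xi:
  assumes "0 < p" "p < 1"
  shows "xi_expect p (\<lambda>\<xi>. \<xi> \<bullet> (B *v \<xi>)) = (\<Sum>i\<in>UNIV. B $ i $ i)"
proof -
  note [simp] = integrable_xi_pmf[OF assms(1,2)]
  have "xi_expect p (\<lambda>\<xi>. \<xi> \<bullet> (B *v \<xi>)) = xi_expect p (\<lambda>\<xi>. \<Sum>i\<in>UNIV. \<Sum>j\<in>UNIV. B$i$j * (\<xi> $ i * \<xi> $ j))"
    by (simp add: inner_vec_def matrix_vector_mult_def sum_distrib_left mult_ac)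
  also have "\<dots> = (\<Sum>i\<in>UNIV. B $ i $ i)"
    by (simp add: xi_second_moment[OF assms] of_bool_def if_distrib[of "\<lambda>x. _ * x"] cong: if_cong)
  finally show ?thesis .
qed

section \<open>Consistency of the discrete derivatives\<close>

lemma inner_matrix_vector_left: "(A *v x) \<bullet> y = x \<bullet> (transpose A *v (y :: real^'k))"
  by (metis dot_lmul_matrix transpose_matrix_vector transpose_transpose)

lemma matrix_vector_mult_minus: "A *v (- x) = - (A *v (x :: real^'n))"
  by (rule linear_neg) (rule matrix_vector_mul_linear)

lemma matrix_quadratic_congruence:
  fixes s H :: "real^'d^'d"
  shows "(s *v \<xi>) \<bullet> (H *v (s *v \<xi>)) = \<xi> \<bullet> ((transpose s ** H ** s) *v \<xi>)"
  by (simp add: inner_matrix_vector_left matrix_vector_mul_assoc matrix_mul_assoc)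

lemma expectation_linear_linear:
  assumes "0 < p" "p < 1"
  shows "xi_expect p (\<lambda>\<xi>. (a \<bullet> \<xi>) * (b \<bullet> \<xi>)) = a \<bullet> b"
proof -
  note [simp] = integrable_xi_pmf[OF assms(1,2)]
  have "xi_expect p (\<lambda>\<xi>. (a \<bullet> \<xi>) * (b \<bullet> \<xi>))
    = xi_expect p (\<lambda>\<xi>. \<Sum>i\<in>UNIV. \<Sum>j\<in>UNIV. (a$i * b$j) * (\<xi> $ i * \<xi> $ j))"
    by (simp add: inner_vec_def sum_product mult_ac)
  also have "\<dots> = (\<Sum>i\<in>UNIV. \<Sum>j\<in>UNIV. (a$i * b$j) * of_bool (i = j))"
    by (simp add: xi_second_moment[OF assms])
  also have "\<dots> = a \<bullet> b"
    by (simp add: inner_vec_def of_bool_def if_distrib[of "\<lambda>x. _ * x"] cong: if_cong)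
  finally show ?thesis .
qed

lemma norm_matrix_le_card:
  fixes A :: "real^'d^'d"
  assumes "\<And>i j. \<bar>A $ i $ j\<bar> \<le> c"
  shows "norm A \<le> real CARD('d) * c"
proof -
  have c: "0 \<le> c" using assms[of undefined undefined] by linarith
  have "(A $ i $ j)\<^sup>2 \<le> c\<^sup>2" for i j using assms[of i j] by (rule abs_le_square_iff[THEN iffD1, OF order_trans]) (simp add: c)
  hence "(\<Sum>i\<in>UNIV. \<Sum>j\<in>UNIV. (A $ i $ j)\<^sup>2) \<le> (\<Sum>i\<in>(UNIV::'d set). \<Sum>j\<in>(UNIV::'d set). c\<^sup>2)"
    by (intro sum_mono)
  hence "(norm A)\<^sup>2 \<le> (real CARD('d) * c)\<^sup>2"
    unfolding norm_vec_sq[of A] by (simp add: norm_vec_sq power_mult_distrib power2_eq_square[of "real _"] mult_ac)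
  thus ?thesis by (rule power2_le_imp_le) (simp add: c)
qed

text \<open>Each of the three terms of an entry is at most \<open>1 / p\<close> in absolute value;
  \<open>p \<le> 1/3\<close> keeps the coefficient \<open>1 - 3 * p\<close> between 0 and 1.\<close>

lemma norm_K2_core_le:
  fixes \<xi> :: "real^'d"
  assumes "0 < p" "p \<le> 1/3" and "\<xi> \<in> set_pmf (xi_pmf p)"
  shows "norm (K2_core p \<xi>) \<le> real CARD('d) * (3 / p)"
proof (rule norm_matrix_le_card)
  fix k l :: 'd
  have a: "\<bar>\<xi> $ i\<bar> \<le> 1 / sqrt p" for i
  proof -
    have "(\<xi> $ i)\<^sup>2 \<le> 1 / p"
      using set_xi_pmf[OF assms(1) _ assms(3), of i] assms(1,2) by (auto simp: field_simps)
    from real_sqrt_le_mono[OF this] show ?thesis by (simp add: real_sqrt_divide)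
  qed
  have "\<bar>\<xi> $ k * \<xi> $ l\<bar> \<le> 1 / sqrt p * (1 / sqrt p)"
    unfolding abs_mult by (intro mult_mono a) (use assms in auto)
  hence x: "\<bar>\<xi> $ k * \<xi> $ l\<bar> \<le> 1 / p" using assms(1) by simp
  have p1: "1 \<le> 1 / p" using assms by simp
  have 1: "\<bar>(1 - p) * (\<xi> $ k * \<xi> $ l)\<bar> \<le> 1 * (1 / p)"
    unfolding abs_mult[of "1 - p"] by (intro mult_mono x) (use assms in auto)
  have 2: "\<bar>(1 - 3 * p) * (of_bool (k = l) * (\<xi> $ k * \<xi> $ l))\<bar> \<le> 1 * (1 / p)"
    unfolding abs_mult[of "1 - 3 * p"] by (intro mult_mono) (use x assms in \<open>auto simp: of_bool_def\<close>)
  have 3: "\<bar>2 * p * of_bool (k = l)\<bar> \<le> 1 / p" using order_trans[OF _ p1, of "2 * p"] assms by (auto simp: of_bool_def)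
  show "\<bar>K2_core p \<xi> $ k $ l\<bar> \<le> 3 / p"
    using 1 2 3 unfolding K2_core_def vec_lambda_beta by (simp only: abs_le_iff) (simp add: field_simps)
qed

lemma inner_K1_le:
  fixes \<xi> :: "real^'d"
  assumes "0 < h" "norm \<xi> \<le> R"
  shows "\<bar>\<beta> \<bullet> K1 s h \<xi>\<bar> \<le> norm \<beta> * (norm (matrix_inv s) * R) / sqrt h"
proof -
  have "norm (transpose (matrix_inv s) *v \<xi>) \<le> norm (matrix_inv s) * norm \<xi>"
    using norm_matrix_vector_mult_le[of "transpose (matrix_inv s)" \<xi>] by (simp add: norm_transpose_real)
  also have "\<dots> \<le> norm (matrix_inv s) * R" using assms by (intro mult_left_mono) auto
  finally have *: "norm (transpose (matrix_inv s) *v \<xi>) \<le> norm (matrix_inv s) * R" .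
  have "\<bar>\<beta> \<bullet> (transpose (matrix_inv s) *v \<xi>)\<bar> \<le> norm \<beta> * (norm (matrix_inv s) * R)"
    by (rule order_trans[OF Cauchy_Schwarz_ineq2 mult_left_mono[OF *]]) simp
  thus ?thesis using assms by (simp add: K1_def abs_mult divide_right_mono)
qed

text \<open>Pairing with a fixed vector turns the discrete gradient into a scalar expectation with
  weight \<open>\<beta> \<bullet> K1\<close>, so that all three discrete operators fall under a
  single weighted Taylor expansion.\<close>

lemma inner_Dop1:
  assumes "0 < p" "p < 1"
  shows "\<beta> \<bullet> Dop1 s p h \<phi> x = xi_expect p (\<lambda>\<xi>. \<phi> (x + sqrt h *\<^sub>R (s *v \<xi>)) * (\<beta> \<bullet> K1 s h \<xi>))"
  unfolding Dop1_def by (subst integral_inner_right[symmetric]) (simp_all add: integrable_xi_pmf[OF assms])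

lemma inner_Dop2:
  assumes "0 < p" "p < 1"
  shows "S \<bullet> Dop2 s p h \<phi> x = xi_expect p (\<lambda>\<xi>. \<phi> (x + sqrt h *\<^sub>R (s *v \<xi>)) * (S \<bullet> K2 s p h \<xi>))"
  unfolding Dop2_def by (subst integral_inner_right[symmetric]) (simp_all add: integrable_xi_pmf[OF assms])

text \<open>One expansion serves the weights \<open>1\<close>, \<open>\<beta> \<bullet> K1\<close>
  and \<open>S \<bullet> K2\<close>. The cubic term \<open>C\<close> stays abstract, since only its
  oddness or its size is used later; a remainder of fourth order along
  \<open>sqrt h *\<^sub>R (s *v \<xi>)\<close> gives the factor \<open>h\<^sup>2\<close>.\<close>

lemma expectation_taylor:
  fixes s H :: "real^'d^'d" and \<psi> C :: "real^'d \<Rightarrow> real"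
  assumes p: "0 < p" "p < 1" and h: "0 \<le> h" and M: "0 \<le> M"
    and rem: "\<And>v. \<bar>\<psi> (x + v) - \<psi> x - g \<bullet> v - (v \<bullet> (H *v v)) / 2 - C v\<bar> \<le> M * norm v ^ 4"
    and \<rho>: "\<And>\<xi>. \<xi> \<in> set_pmf (xi_pmf p) \<Longrightarrow> norm (s *v \<xi>) \<le> \<rho>"
    and w: "\<And>\<xi>. \<xi> \<in> set_pmf (xi_pmf p) \<Longrightarrow> \<bar>w \<xi>\<bar> \<le> \<omega>"
  shows "\<bar>xi_expect p (\<lambda>\<xi>. \<psi> (x + sqrt h *\<^sub>R (s *v \<xi>)) * w \<xi>)
     - (\<psi> x * xi_expect p w + sqrt h * xi_expect p (\<lambda>\<xi>. (g \<bullet> (s *v \<xi>)) * w \<xi>)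
        + h / 2 * xi_expect p (\<lambda>\<xi>. (\<xi> \<bullet> ((transpose s ** H ** s) *v \<xi>)) * w \<xi>)
        + xi_expect p (\<lambda>\<xi>. C (sqrt h *\<^sub>R (s *v \<xi>)) * w \<xi>))\<bar> \<le> M * \<rho>^4 * h\<^sup>2 * \<omega>"
proof -
  note int[simp] = integrable_xi_pmf[OF p]
  let ?v = "\<lambda>\<xi>. sqrt h *\<^sub>R (s *v \<xi>)"
  let ?r = "\<lambda>v. \<psi> (x + v) - \<psi> x - g \<bullet> v - (v \<bullet> (H *v v)) / 2 - C v"
  have "\<bar>?r (?v \<xi>) * w \<xi>\<bar> \<le> M * \<rho>^4 * h\<^sup>2 * \<omega>" if "\<xi> \<in> set_pmf (xi_pmf p)" for \<xi>
  proof -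
    have "norm (?v \<xi>) ^ 4 = (sqrt h)^4 * norm (s *v \<xi>) ^ 4"
      using h by (simp add: power_mult_distrib)
    also have "(sqrt h)^4 = h\<^sup>2" using h by (simp add: power4_eq_xxxx power2_eq_square)
    finally have e: "norm (?v \<xi>) ^ 4 = h\<^sup>2 * norm (s *v \<xi>) ^ 4" .
    have "\<bar>?r (?v \<xi>)\<bar> \<le> M * (h\<^sup>2 * norm (s *v \<xi>) ^ 4)" using rem[of "?v \<xi>"] unfolding e .
    also have "\<dots> \<le> M * (h\<^sup>2 * \<rho> ^ 4)"
      by (intro mult_left_mono power_mono \<rho>[OF that] M) auto
    finally have "\<bar>?r (?v \<xi>)\<bar> * \<bar>w \<xi>\<bar> \<le> (M * (h\<^sup>2 * \<rho> ^ 4)) * \<omega>"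
      by (intro mult_mono w[OF that]) (auto simp: M)
    thus ?thesis by (simp add: abs_mult mult_ac)
  qed
  hence "\<bar>xi_expect p (\<lambda>\<xi>. ?r (?v \<xi>) * w \<xi>)\<bar> \<le> M * \<rho>^4 * h\<^sup>2 * \<omega>"
    by (rule xi_expect_abs_le[OF p])
  also have "xi_expect p (\<lambda>\<xi>. ?r (?v \<xi>) * w \<xi>) = xi_expect p (\<lambda>\<xi>. \<psi> (x + ?v \<xi>) * w \<xi>
     - (\<psi> x * w \<xi> + sqrt h * ((g \<bullet> (s *v \<xi>)) * w \<xi>)
       + h / 2 * ((\<xi> \<bullet> ((transpose s ** H ** s) *v \<xi>)) * w \<xi>) + C (?v \<xi>) * w \<xi>))"
  proof (rule arg_cong[where f = "xi_expect p"], rule ext)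
    fix \<xi>
    have "?v \<xi> \<bullet> (H *v ?v \<xi>) = h * (\<xi> \<bullet> ((transpose s ** H ** s) *v \<xi>))"
      using h by (simp add: matrix_quadratic_congruence[symmetric] matrix_vector_mult_scaleR)
    thus "?r (?v \<xi>) * w \<xi> = \<psi> (x + ?v \<xi>) * w \<xi>
     - (\<psi> x * w \<xi> + sqrt h * ((g \<bullet> (s *v \<xi>)) * w \<xi>)
       + h / 2 * ((\<xi> \<bullet> ((transpose s ** H ** s) *v \<xi>)) * w \<xi>) + C (?v \<xi>) * w \<xi>)"
      by (simp add: algebra_simps)
  qed
  also have "\<dots> = xi_expect p (\<lambda>\<xi>. \<psi> (x + ?v \<xi>) * w \<xi>)
     - (\<psi> x * xi_expect p w + sqrt h * xi_expect p (\<lambda>\<xi>. (g \<bullet> (s *v \<xi>)) * w \<xi>)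
        + h / 2 * xi_expect p (\<lambda>\<xi>. (\<xi> \<bullet> ((transpose s ** H ** s) *v \<xi>)) * w \<xi>)
        + xi_expect p (\<lambda>\<xi>. C (?v \<xi>) * w \<xi>))"
    by (simp only: Bochner_Integration.integral_diff Bochner_Integration.integral_add int integral_mult_right_zero)
  finally show ?thesis .
qed

lemma Dop0_consistency:
  fixes s H :: "real^'d^'d" and \<psi> C :: "real^'d \<Rightarrow> real"
  assumes p: "0 < p" "p < 1" and h: "0 \<le> h" and M: "0 \<le> M"
    and rem: "\<And>v. \<bar>\<psi> (x + v) - \<psi> x - g \<bullet> v - (v \<bullet> (H *v v)) / 2 - C v\<bar> \<le> M * norm v ^ 4"
    and odd: "\<And>v. C (- v) = - C v"
    and \<rho>: "\<And>\<xi>. \<xi> \<in> set_pmf (xi_pmf p) \<Longrightarrow> norm (s *v \<xi>) \<le> \<rho>"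
  shows "\<bar>Dop0 s p h \<psi> x - (\<psi> x + h / 2 * ((s ** transpose s) \<bullet> H))\<bar> \<le> M * \<rho>^4 * h\<^sup>2"
proof -
  have 1: "xi_expect p (\<lambda>\<xi>. g \<bullet> (s *v \<xi>)) = 0"
    by (rule expectation_xi_odd[OF p]) (simp add: matrix_vector_mult_minus)
  have 3: "xi_expect p (\<lambda>\<xi>. C (sqrt h *\<^sub>R (s *v \<xi>))) = 0"
    by (rule expectation_xi_odd[OF p]) (simp add: matrix_vector_mult_minus odd)
  \<comment> \<open>The trace is written as an inner product with the identity, to which
    \<open>inner_congruence\<close> applies.\<close>
  have "(\<Sum>i\<in>UNIV. (transpose s ** H ** s) $ i $ i) = mat 1 \<bullet> (transpose s ** H ** s)"
    by (simp add: inner_vec_def mat_def if_distrib[of "\<lambda>x. x * _"] cong: if_cong)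
  also have "\<dots> = (s ** transpose s) \<bullet> H" by (simp add: inner_congruence)
  finally have 2: "xi_expect p (\<lambda>\<xi>. \<xi> \<bullet> ((transpose s ** H ** s) *v \<xi>)) = (s ** transpose s) \<bullet> H"
    using expectation_bilinear_xi[OF p] by metis
  show ?thesis
    using expectation_taylor[OF p h M rem \<rho>, of "\<lambda>_. 1" 1] by (simp add: 1 2 3 Dop0_def)
qed

text \<open>By duality: the error is paired with itself, its square is bounded by a multiple of its
  norm, and one factor is cancelled. The linear term reproduces \<open>g\<close> because
  \<open>s\<close> cancels its inverse in \<open>K1\<close>; the quadratic term is odd against
  \<open>K1\<close>; the cubic one contributes \<open>h * sqrt h / sqrt h = h\<close>.\<close>

lemma Dop1_consistency:
  fixes s H :: "real^'d^'d" and \<psi> C :: "real^'d \<Rightarrow> real"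
  assumes p: "0 < p" "p < 1" and h: "0 < h" "h \<le> 1" and M: "0 \<le> M"
    and rem: "\<And>v. \<bar>\<psi> (x + v) - \<psi> x - g \<bullet> v - (v \<bullet> (H *v v)) / 2 - C v\<bar> \<le> M * norm v ^ 4"
    and C: "\<And>v. \<bar>C v\<bar> \<le> M * norm v ^ 3"
    and s: "invertible s"
    and \<rho>: "\<And>\<xi>. \<xi> \<in> set_pmf (xi_pmf p) \<Longrightarrow> norm (s *v \<xi>) \<le> \<rho>" "0 \<le> \<rho>"
    and R: "\<And>\<xi>::real^'d. \<xi> \<in> set_pmf (xi_pmf p) \<Longrightarrow> norm \<xi> \<le> R" "0 \<le> R"
  shows "norm (Dop1 s p h \<psi> x - g) \<le> M * (\<rho>^3 + \<rho>^4) * (norm (matrix_inv s) * R) * h"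
proof -
  let ?Q = "norm (matrix_inv s) * R"
  \<comment> \<open>The test vector is the error itself.\<close>
  define \<beta> where "\<beta> = Dop1 s p h \<psi> x - g"
  have wb: "\<bar>\<beta> \<bullet> K1 s h \<xi>\<bar> \<le> norm \<beta> * ?Q / sqrt h" if "\<xi> \<in> set_pmf (xi_pmf p)" for \<xi>
    by (rule inner_K1_le[OF h(1) R(1)[OF that]])
  have K1m: "K1 s h (- \<xi>) = - K1 s h \<xi>" for \<xi> by (simp add: K1_def matrix_vector_mult_minus)
  have 0: "xi_expect p (\<lambda>\<xi>. \<beta> \<bullet> K1 s h \<xi>) = 0"
    by (rule expectation_xi_odd[OF p]) (simp add: K1m)
  have 2: "xi_expect p (\<lambda>\<xi>. (\<xi> \<bullet> ((transpose s ** H ** s) *v \<xi>)) * (\<beta> \<bullet> K1 s h \<xi>)) = 0"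
    by (rule expectation_xi_odd[OF p]) (simp add: K1m matrix_vector_mult_minus)
  have e1: "(g \<bullet> (s *v \<xi>)) * (\<beta> \<bullet> K1 s h \<xi>)
      = (1 / sqrt h) * (((transpose s *v g) \<bullet> \<xi>) * ((matrix_inv s *v \<beta>) \<bullet> \<xi>))" for \<xi>
  proof -
    have "g \<bullet> (s *v \<xi>) = (transpose s *v g) \<bullet> \<xi>"
      using inner_matrix_vector_left[of "transpose s" g \<xi>] unfolding transpose_transpose by (rule sym)
    moreover have "\<beta> \<bullet> (transpose (matrix_inv s) *v \<xi>) = (matrix_inv s *v \<beta>) \<bullet> \<xi>"
      by (rule inner_matrix_vector_left[symmetric])
    ultimately show ?thesis unfolding K1_def inner_scaleR_right by simp
  qed
  have "(transpose s *v g) \<bullet> (matrix_inv s *v \<beta>) = g \<bullet> (s *v (matrix_inv s *v \<beta>))"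
    using inner_matrix_vector_left[of "transpose s" g "matrix_inv s *v \<beta>"]
    unfolding transpose_transpose .
  also have "\<dots> = g \<bullet> \<beta>" by (simp add: matrix_vector_mul_assoc matrix_inv_works[OF s])
  finally have 1: "sqrt h * xi_expect p (\<lambda>\<xi>. (g \<bullet> (s *v \<xi>)) * (\<beta> \<bullet> K1 s h \<xi>)) = g \<bullet> \<beta>"
    unfolding e1 using h by (simp add: expectation_linear_linear[OF p])
  have hh: "h * sqrt h = (sqrt h)^3" using h by (simp add: power3_eq_cube)
  have "\<bar>C (sqrt h *\<^sub>R (s *v \<xi>)) * (\<beta> \<bullet> K1 s h \<xi>)\<bar> \<le> M * \<rho>^3 * (norm \<beta> * ?Q) * h"
    if "\<xi> \<in> set_pmf (xi_pmf p)" for \<xi>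
  proof -
    have "\<bar>C (sqrt h *\<^sub>R (s *v \<xi>))\<bar> \<le> M * (h * sqrt h * norm (s *v \<xi>) ^ 3)"
      using C[of "sqrt h *\<^sub>R (s *v \<xi>)"] h by (simp add: power_mult_distrib hh)
    also have "\<dots> \<le> M * (h * sqrt h * \<rho> ^ 3)"
      using h by (intro mult_left_mono power_mono \<rho>(1)[OF that] M) auto
    finally have "\<bar>C (sqrt h *\<^sub>R (s *v \<xi>))\<bar> * \<bar>\<beta> \<bullet> K1 s h \<xi>\<bar>
       \<le> M * (h * sqrt h * \<rho> ^ 3) * (norm \<beta> * ?Q / sqrt h)"
      using h by (intro mult_mono wb[OF that]) (auto simp: M \<rho>)
    also have "\<dots> = M * \<rho>^3 * (norm \<beta> * ?Q) * h" using h by simp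
    finally show ?thesis by (simp add: abs_mult)
  qed
  hence 3: "\<bar>xi_expect p (\<lambda>\<xi>. C (sqrt h *\<^sub>R (s *v \<xi>)) * (\<beta> \<bullet> K1 s h \<xi>))\<bar> \<le> M * \<rho>^3 * (norm \<beta> * ?Q) * h"
    by (rule xi_expect_abs_le[OF p])
  \<comment> \<open>The fourth-order remainder divided by the size of \<open>K1\<close> has order
    \<open>h * sqrt h\<close>, which is at most \<open>h\<close> since
    \<open>h \<le> 1\<close>.\<close>
  have "h\<^sup>2 / sqrt h = h * sqrt h" using h
    by (simp add: power2_eq_square divide_eq_eq)
  also have "\<dots> \<le> h * 1" using h by (intro mult_left_mono) auto
  finally have "M * \<rho>^4 * (norm \<beta> * ?Q) * (h\<^sup>2 / sqrt h) \<le> M * \<rho>^4 * (norm \<beta> * ?Q) * (h * 1)"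
    using M R by (intro mult_left_mono) auto
  hence 4: "M * \<rho>^4 * h\<^sup>2 * (norm \<beta> * ?Q / sqrt h) \<le> M * \<rho>^4 * (norm \<beta> * ?Q) * h"
    by (simp add: mult_ac)
  have "\<bar>\<beta> \<bullet> Dop1 s p h \<psi> x - (g \<bullet> \<beta> + xi_expect p (\<lambda>\<xi>. C (sqrt h *\<^sub>R (s *v \<xi>)) * (\<beta> \<bullet> K1 s h \<xi>)))\<bar>
     \<le> M * \<rho>^4 * h\<^sup>2 * (norm \<beta> * ?Q / sqrt h)"
    using expectation_taylor[where w = "\<lambda>\<xi>. \<beta> \<bullet> K1 s h \<xi>" and \<omega> = "norm \<beta> * ?Q / sqrt h", OF p less_imp_le[OF h(1)] M rem \<rho>(1) wb]
    unfolding 0 1 2 inner_Dop1[OF p] by simp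
  with 3 4 have "\<bar>\<beta> \<bullet> Dop1 s p h \<psi> x - g \<bullet> \<beta>\<bar> \<le> M * \<rho>^3 * (norm \<beta> * ?Q) * h + M * \<rho>^4 * (norm \<beta> * ?Q) * h"
    by linarith
  also have "\<beta> \<bullet> Dop1 s p h \<psi> x - g \<bullet> \<beta> = norm \<beta> * norm \<beta>"
    by (simp add: \<beta>_def inner_diff inner_commute dot_square_norm power2_eq_square[symmetric])
      (simp add: power2_norm_eq_inner inner_diff inner_commute)
  finally have "norm \<beta> * norm \<beta> \<le> norm \<beta> * (M * (\<rho>^3 + \<rho>^4) * ?Q * h)"
    by (simp add: algebra_simps)
  hence "norm \<beta> \<le> M * (\<rho>^3 + \<rho>^4) * ?Q * h \<or> norm \<beta> = 0"
    by (metis mult_le_cancel_left_pos norm_ge_zero order_le_less)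
  moreover have "0 \<le> M * (\<rho>^3 + \<rho>^4) * ?Q * h" using M \<rho> R h by simp
  ultimately show ?thesis unfolding \<beta>_def by auto
qed

text \<open>Even weights remove the linear and the cubic term, the quadratic one is exact, and the
  remainder \<open>h\<^sup>2\<close> meets a weight of size \<open>1 / h\<close>. The statement is
  tested on symmetric \<open>S\<close>, the form in which the discrete Hessian enters the
  scheme.\<close>

lemma Dop2_consistency:
  fixes s H S :: "real^'d^'d" and \<psi> C :: "real^'d \<Rightarrow> real"
  assumes p: "0 < p" "p \<le> 1/3" and h: "0 < h" and M: "0 \<le> M"
    and rem: "\<And>v. \<bar>\<psi> (x + v) - \<psi> x - g \<bullet> v - (v \<bullet> (H *v v)) / 2 - C v\<bar> \<le> M * norm v ^ 4"
    and odd: "\<And>v. C (- v) = - C v"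
    and s: "invertible s" and S: "transpose S = S"
    and \<rho>: "\<And>\<xi>. \<xi> \<in> set_pmf (xi_pmf p) \<Longrightarrow> norm (s *v \<xi>) \<le> \<rho>"
  shows "\<bar>S \<bullet> Dop2 s p h \<psi> x - S \<bullet> H\<bar>
    \<le> norm S * (M * \<rho>^4 * ((norm (matrix_inv s))\<^sup>2 * (6 * real CARD('d) / p))) * h"
proof -
  have p': "p < 1" using p by simp
  let ?P = "matrix_inv s"
  let ?R = "?P ** S ** transpose ?P"
  \<comment> \<open>The 6 is the 3 of \<open>norm_K2_core_le\<close> times a 2 from
    \<open>1 - p \<ge> 1/2\<close>.\<close>
  let ?\<omega> = "norm S * (norm ?P)\<^sup>2 * (6 * real CARD('d) / p) / h"
  have "norm ?R \<le> norm (?P ** S) * norm (transpose ?P)" by (rule norm_matrix_matrix_mult_le)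
  also have "\<dots> \<le> (norm ?P * norm S) * norm ?P"
    unfolding norm_transpose_real by (intro mult_right_mono norm_matrix_matrix_mult_le) auto
  finally have Rn: "norm ?R \<le> norm S * (norm ?P)\<^sup>2" by (simp add: power2_eq_square mult_ac)
  have wb: "\<bar>S \<bullet> K2 s p h \<xi>\<bar> \<le> ?\<omega>" if "\<xi> \<in> set_pmf (xi_pmf p)" for \<xi>
  proof -
    have "\<bar>?R \<bullet> K2_core p \<xi>\<bar> \<le> norm ?R * norm (K2_core p \<xi>)" by (rule Cauchy_Schwarz_ineq2)
    also have "\<dots> \<le> norm S * (norm ?P)\<^sup>2 * (real CARD('d) * (3 / p))"
      by (intro mult_mono Rn norm_K2_core_le[OF p that]) auto
    finally have "\<bar>?R \<bullet> K2_core p \<xi>\<bar> / ((1 - p) * h)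
        \<le> norm S * (norm ?P)\<^sup>2 * (real CARD('d) * (3 / p)) / (1/2 * h)"
      using p h by (intro frac_le) auto
    thus ?thesis using p h by (simp add: inner_K2 abs_mult mult_ac)
  qed
  have K2m: "K2 s p h (- \<xi>) = K2 s p h \<xi>" for \<xi> by (simp add: K2_eq_core K2_core_uminus)
  have 0: "xi_expect p (\<lambda>\<xi>. S \<bullet> K2 s p h \<xi>) = 0"
    using expectation_inner_K2_core[OF p(1) p', of ?R] by (simp add: inner_K2)
  have 1: "xi_expect p (\<lambda>\<xi>. (g \<bullet> (s *v \<xi>)) * (S \<bullet> K2 s p h \<xi>)) = 0"
    by (rule expectation_xi_odd[OF p(1) p']) (simp add: K2m matrix_vector_mult_minus)
  have 3: "xi_expect p (\<lambda>\<xi>. C (sqrt h *\<^sub>R (s *v \<xi>)) * (S \<bullet> K2 s p h \<xi>)) = 0"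
    by (rule expectation_xi_odd[OF p(1) p']) (simp add: K2m matrix_vector_mult_minus odd)
  have Rs: "transpose ?R = ?R" by (simp add: matrix_transpose_mul S matrix_mul_assoc)
  have "(transpose s ** H ** s) \<bullet> ?R = ?R \<bullet> (transpose s ** H ** s)" by (rule inner_commute)
  also have "\<dots> = (s ** ?R ** transpose s) \<bullet> H" by (rule inner_congruence)
  also have "s ** ?R ** transpose s = (s ** ?P) ** S ** transpose (s ** ?P)"
    by (simp add: matrix_transpose_mul matrix_mul_assoc)
  finally have BR: "(transpose s ** H ** s) \<bullet> ?R = S \<bullet> H" by (simp add: matrix_inv_works[OF s])
  have 2: "h / 2 * xi_expect p (\<lambda>\<xi>. (\<xi> \<bullet> ((transpose s ** H ** s) *v \<xi>)) * (S \<bullet> K2 s p h \<xi>)) = S \<bullet> H"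
    using expectation_quadratic_K2_core[OF p(1) p' Rs, of "transpose s ** H ** s"] p h
    by (simp add: inner_K2 BR)
  have "\<bar>S \<bullet> Dop2 s p h \<psi> x - S \<bullet> H\<bar> \<le> M * \<rho>^4 * h\<^sup>2 * ?\<omega>"
    using expectation_taylor[where w = "\<lambda>\<xi>. S \<bullet> K2 s p h \<xi>" and \<omega> = ?\<omega>, OF p(1) p' less_imp_le[OF h] M rem \<rho> wb]
    unfolding 0 1 2 3 inner_Dop2[OF p(1) p'] by simp
  also have "\<dots> = norm S * (M * \<rho>^4 * ((norm ?P)\<^sup>2 * (6 * real CARD('d) / p))) * h"
    using h by (simp add: power2_eq_square)
  finally show ?thesis .
qed

section \<open>Positivity of the weights\<close>

lemma inner_K2_core:
  fixes A :: "real^'d^'d"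
  shows "A \<bullet> K2_core p \<xi> = (1 - p) * (\<xi> \<bullet> (A *v \<xi>))
    - (1 - 3 * p) * (\<Sum>i\<in>UNIV. A $ i $ i * (\<xi> $ i)\<^sup>2) - 2 * p * (\<Sum>i\<in>UNIV. A $ i $ i)"
proof -
  have q: "\<xi> \<bullet> (A *v \<xi>) = (\<Sum>k\<in>UNIV. \<Sum>l\<in>UNIV. A$k$l * (\<xi> $ k * \<xi> $ l))"
    by (simp add: inner_vec_def matrix_vector_mult_def sum_distrib_left mult_ac)
  have "A \<bullet> K2_core p \<xi> = (\<Sum>k\<in>UNIV. \<Sum>l\<in>UNIV. (1 - p) * (A$k$l * (\<xi> $ k * \<xi> $ l))
      - (1 - 3 * p) * (if k = l then A$k$l * (\<xi> $ k * \<xi> $ l) else 0)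
      - 2 * p * (if k = l then A$k$l else 0))"
    unfolding inner_vec_def K2_core_def
    by (intro sum.cong refl) (simp add: algebra_simps)
  also have "\<dots> = (1 - p) * (\<xi> \<bullet> (A *v \<xi>))
    - (1 - 3 * p) * (\<Sum>i\<in>UNIV. A $ i $ i * (\<xi> $ i)\<^sup>2) - 2 * p * (\<Sum>i\<in>UNIV. A $ i $ i)"
    unfolding q by (simp add: sum_subtractf sum_distrib_left[symmetric] power2_eq_square)
  finally show ?thesis .
qed

text \<open>The coordinatewise bound behind the choice of \<open>c\<^sub>p\<close>: with \<open>c\<^sub>p\<^sup>2 \<alpha>l = 1\<close> the contributions of a
  vanishing and of a nonvanishing component of \<open>\<xi>\<close> have the same lower bound.\<close>

lemma K2_weight_ge:
  fixes s A :: "real^'d^'d" and \<theta> \<alpha>l \<alpha>u p :: real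
  defines "At \<equiv> matrix_inv s ** A ** transpose (matrix_inv s)"
  assumes p: "0 < p" "p \<le> 1/3" and s: "invertible s" and h: "0 < h"
    and \<xi>: "\<xi> \<in> set_pmf (xi_pmf p)"
    and \<theta>: "0 \<le> \<theta>" "\<And>v. (\<Sum>i\<in>UNIV. At $ i $ i * (v $ i)\<^sup>2) \<le> (1 + \<theta>) * (v \<bullet> (At *v v))"
    and \<alpha>: "\<And>i. \<alpha>l \<le> At $ i $ i" "\<And>i. At $ i $ i \<le> \<alpha>u" 
    and ap: "2 * p \<le> ap" "p * (1 + \<theta>) * ap = p * (2 + 3 * \<theta>) - \<theta>"
    and c: "2 * p * \<alpha>u + (ap - 2 * p) * \<alpha>l = 1"
  shows "1 - p + p * real CARD('d) - 2 * p * real CARD('d) * \<alpha>u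
    \<le> (1 - p) * (1 + h * ((A - (1/2) *\<^sub>R (s ** transpose s)) \<bullet> K2 s p h \<xi>))"
proof -
  let ?P = "matrix_inv s"
  let ?S = "A - (1/2) *\<^sub>R (s ** transpose s)"
  have "?P ** (s ** transpose s) ** transpose ?P = (?P ** s) ** transpose (?P ** s)"
    by (simp add: matrix_transpose_mul matrix_mul_assoc)
  also have "\<dots> = mat 1" by (simp add: matrix_inv_works[OF s])
  finally have I: "?P ** (s ** transpose s) ** transpose ?P = mat 1" .
  \<comment> \<open>The conjugation turns the reference diffusion \<open>s ** transpose s\<close>
    into the identity.\<close>
  have "((?P ** ?S) ** transpose ?P) = At - (1/2) *\<^sub>R (?P ** (s ** transpose s) ** transpose ?P)"
    unfolding At_def
    by (simp add: matrix_matrix_mult_def vec_eq_iff algebra_simps sum_subtractf sum_distrib_left sum_distrib_right sum_divide_distrib)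
  hence PS: "?P ** ?S ** transpose ?P = At - (1/2) *\<^sub>R mat 1" by (simp add: I)
  have id: "(mat 1 :: real^'d^'d) \<bullet> K2_core p \<xi> = 2 * p * (\<Sum>i\<in>UNIV. (\<xi> $ i)\<^sup>2) - 2 * p * real CARD('d)"
    unfolding inner_K2_core
    by (simp add: matrix_vector_mul_lid) (simp add: mat_def inner_vec_def power2_eq_square algebra_simps)
  have "(1 - p) * (1 + h * (?S \<bullet> K2 s p h \<xi>)) = 1 - p + (At - (1/2) *\<^sub>R mat 1) \<bullet> K2_core p \<xi>"
    using p h by (simp add: inner_K2 PS field_simps)
  also have "\<dots> = 1 - p + At \<bullet> K2_core p \<xi> - p * (\<Sum>i\<in>UNIV. (\<xi> $ i)\<^sup>2) + p * real CARD('d)"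
    by (simp add: inner_diff_left id field_simps)
  finally have e: "(1 - p) * (1 + h * (?S \<bullet> K2 s p h \<xi>)) = \<dots>" .
  let ?D = "\<Sum>i\<in>UNIV. At $ i $ i * (\<xi> $ i)\<^sup>2"
  \<comment> \<open>Origin of \<open>alpha_p\<close>: the quadratic form is at least
    \<open>1 / (1 + \<theta>)\<close> times its diagonal part and carries the coefficient
    \<open>1 - p\<close>; \<open>p * ap\<close> is what is left once the diagonal part has been
    subtracted \<open>1 - 3 * p\<close> times.\<close>
  have "p * ap * (1 + \<theta>) = (1 - p) - (1 - 3 * p) * (1 + \<theta>)"
    using ap(2) by (simp add: algebra_simps)
  hence ap': "p * ap + (1 - 3 * p) = (1 - p) / (1 + \<theta>)"
    using \<theta>(1) by (simp add: field_simps)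
  have "?D / (1 + \<theta>) \<le> \<xi> \<bullet> (At *v \<xi>)"
    using \<theta> by (simp add: divide_le_eq mult.commute)
  hence "(1 - p) * (?D / (1 + \<theta>)) \<le> (1 - p) * (\<xi> \<bullet> (At *v \<xi>))"
    using p by (intro mult_left_mono) auto
  hence "p * ap * ?D + (1 - 3 * p) * ?D \<le> (1 - p) * (\<xi> \<bullet> (At *v \<xi>))"
    by (simp add: ap' distrib_right[symmetric])
  hence g1: "p * ap * ?D - 2 * p * (\<Sum>i\<in>UNIV. At $ i $ i) \<le> At \<bullet> K2_core p \<xi>"
    unfolding inner_K2_core by linarith
  \<comment> \<open>A vanishing component is worst where \<open>At $ i $ i\<close> is largest, a
    nonvanishing one where it is smallest, since its coefficient \<open>ap - 2 * p\<close> is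
    nonnegative. The hypothesis \<open>c\<close> makes both worst cases equal.\<close>
  have coord: "p - 2 * p * \<alpha>u \<le> p * ap * (At $ i $ i * (\<xi> $ i)\<^sup>2) - 2 * p * At $ i $ i - p * (\<xi> $ i)\<^sup>2 + p" for i
  proof -
    consider "\<xi> $ i = 0" | "p * (\<xi> $ i)\<^sup>2 = 1" using set_xi_pmf[OF p(1) _ \<xi>, of i] p by auto
    thus ?thesis
  proof cases
    case z: 1
    have "2 * p * At $ i $ i \<le> 2 * p * \<alpha>u" using p by (intro mult_left_mono \<alpha>) auto
    with z show ?thesis by simp
  next
    case z: 2
    have "p * ap * (At $ i $ i * (\<xi> $ i)\<^sup>2) = ap * At $ i $ i * (p * (\<xi> $ i)\<^sup>2)" by (simp add: mult_ac)
    hence "p * ap * (At $ i $ i * (\<xi> $ i)\<^sup>2) = ap * At $ i $ i" using z by simp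
    moreover have "(ap - 2 * p) * \<alpha>l \<le> (ap - 2 * p) * At $ i $ i"
      using ap by (intro mult_left_mono \<alpha>) auto
    moreover have "(ap - 2 * p) * At $ i $ i = ap * At $ i $ i - 2 * p * At $ i $ i" by (simp add: algebra_simps)
    ultimately show ?thesis using c z by linarith
  qed
  qed
  have "(\<Sum>i\<in>(UNIV::'d set). p - 2 * p * \<alpha>u)
    \<le> (\<Sum>i\<in>UNIV. p * ap * (At $ i $ i * (\<xi> $ i)\<^sup>2) - 2 * p * At $ i $ i - p * (\<xi> $ i)\<^sup>2 + p)"
    by (intro sum_mono coord)
  hence "real CARD('d) * (p - 2 * p * \<alpha>u)
    \<le> p * ap * ?D - 2 * p * (\<Sum>i\<in>UNIV. At $ i $ i) - p * (\<Sum>i\<in>UNIV. (\<xi> $ i)\<^sup>2) + p * real CARD('d)"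
    by (simp add: sum.distrib sum_subtractf sum_distrib_left mult_ac)
  thus ?thesis unfolding e using g1 by (simp add: algebra_simps)
qed

text \<open>This explains the lower end of the admissible range of \<open>p\<close>: after clearing
  denominators, the difference of the two sides is
  \<open>(p * (2 * (1 + \<theta>)) - \<theta>) * (1 - p)\<close>. It provides the sign of
  \<open>ap - 2 * p\<close> in \<open>K2_weight_ge\<close>.\<close>

lemma alpha_p_ge:
  fixes p \<theta> :: real
  assumes "0 < p" "p \<le> 1/3" "0 \<le> \<theta>" "\<theta> / (2 * (1 + \<theta>)) \<le> p"
  shows "2 * p \<le> (p * (2 + 3 * \<theta>) - \<theta>) / (p * (1 + \<theta>))"
proof -
  have a: "0 \<le> p * (2 * (1 + \<theta>)) - \<theta>" using assms by (simp add: field_simps)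
  have "p * (2 + 3 * \<theta>) - \<theta> - 2 * p * (p * (1 + \<theta>)) = (p * (2 * (1 + \<theta>)) - \<theta>) * (1 - p)"
    by (simp add: algebra_simps)
  thus ?thesis
    using mult_nonneg_nonneg[OF a, of "1 - p"] assms by (simp add: le_divide_eq)
qed

section \<open>Matrix inequalities in scalar form, and the constants of (M)\<close>

lemma quadratic_diag_part: "v \<bullet> (diag_part A *v v) = (\<Sum>i\<in>UNIV. A $ i $ i * (v $ i)\<^sup>2)"
  by (simp add: inner_vec_def matrix_vector_mult_def diag_part_def if_distrib[of "\<lambda>x. x * _"]
      power2_eq_square cong: if_cong) (simp add: mult_ac)

lemma quadratic_scaled_identity: "v \<bullet> ((c *\<^sub>R mat 1) *v v) = c * (\<Sum>i\<in>UNIV. (v $ i)\<^sup>2)"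
  by (simp add: scaleR_matrix_vector_assoc[symmetric] inner_vec_def power2_eq_square)
     (simp add: sum_distrib_left mult.left_commute)

lemma loewner_le_iff: "loewner_le A B \<longleftrightarrow> (\<forall>v. v \<bullet> (A *v v) \<le> v \<bullet> (B *v v))"
  by (simp add: loewner_le_def matrix_vector_mult_diff_rdistrib inner_diff_right)

text \<open>Coordinate vectors as test vectors give the entrywise inequality.\<close>

lemma scalar_le_diag_part_iff:
  "loewner_le (c *\<^sub>R mat 1) (diag_part A) \<longleftrightarrow> (\<forall>i. c \<le> A $ i $ i)"
proof
  assume *: "loewner_le (c *\<^sub>R mat 1) (diag_part A)"
  show "\<forall>i. c \<le> A $ i $ i"
  proof
    fix i
    have "c * (\<Sum>j\<in>UNIV. (axis i 1 $ j :: real)\<^sup>2) \<le> (\<Sum>j\<in>UNIV. A $ j $ j * (axis i 1 $ j)\<^sup>2)"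
      using *[unfolded loewner_le_iff quadratic_diag_part quadratic_scaled_identity] by blast
    thus "c \<le> A $ i $ i"
      by (simp add: axis_def if_distrib[of "\<lambda>x. x\<^sup>2"] if_distrib[of "\<lambda>x. _ * x"] cong: if_cong)
  qed
next
  assume "\<forall>i. c \<le> A $ i $ i"
  thus "loewner_le (c *\<^sub>R mat 1) (diag_part A)"
    unfolding loewner_le_iff quadratic_diag_part quadratic_scaled_identity sum_distrib_left
    by (intro allI sum_mono mult_right_mono) auto
qed

lemma diag_part_le_scalar_iff:
  "loewner_le (diag_part A) (c *\<^sub>R mat 1) \<longleftrightarrow> (\<forall>i. A $ i $ i \<le> c)"
proof
  assume *: "loewner_le (diag_part A) (c *\<^sub>R mat 1)"
  show "\<forall>i. A $ i $ i \<le> c"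
  proof
    fix i
    have "(\<Sum>j\<in>UNIV. A $ j $ j * (axis i 1 $ j)\<^sup>2) \<le> c * (\<Sum>j\<in>UNIV. (axis i 1 $ j :: real)\<^sup>2)"
      using *[unfolded loewner_le_iff quadratic_diag_part quadratic_scaled_identity] by blast
    thus "A $ i $ i \<le> c"
      by (simp add: axis_def if_distrib[of "\<lambda>x. x\<^sup>2"] if_distrib[of "\<lambda>x. _ * x"] cong: if_cong)
  qed
next
  assume "\<forall>i. A $ i $ i \<le> c"
  thus "loewner_le (diag_part A) (c *\<^sub>R mat 1)"
    unfolding loewner_le_iff quadratic_diag_part quadratic_scaled_identity sum_distrib_left
    by (intro allI sum_mono mult_right_mono) auto
qed

lemma abs_matrix_entry_le_norm: "\<bar>(A :: real^'n^'k) $ i $ j\<bar> \<le> norm A"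
  by (rule order_trans[OF component_le_norm_cart Finite_Cartesian_Product.norm_nth_le])

text \<open>The passage from (M) to \<open>K2_weight_ge\<close>: the extended real suprema and
  infima are shown to be finite and to satisfy the inequalities that define them. With
  \<open>\<alpha>l\<close> normalized to \<open>1 / c\<^sup>2\<close>, the bound of
  \<open>K2_weight_ge\<close> becomes \<open>lambda_p\<close> times
  \<open>norm (matrix_inv (\<sigma>0 t x)) / sqrt (p t x)\<close>, and (M2) bounds
  \<open>lambda_p\<close> by \<open>l / 2\<close> from below.\<close>

lemma scheme_weight_ge:
  fixes \<sigma> :: "real \<Rightarrow> real^'d \<Rightarrow> real \<Rightarrow> real^'m^'d" and \<sigma>0 :: "real \<Rightarrow> real^'d \<Rightarrow> real^'d^'d"
  assumes sd: "scheme_data T \<sigma>0 p" and M2: "assumption_M2 T (quasilinear_G \<sigma> b f) \<sigma>0 p"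
    and th2: "theta (quasilinear_G \<sigma> b f) \<sigma>0 t x \<le> 2"
    and ls: "lambda_star T (quasilinear_G \<sigma> b f) \<sigma>0 = ereal l"
    and t: "t \<in> {0..T}" and bd: "\<And>y. norm (\<sigma> t x y) \<le> B"
    and \<xi>: "\<xi> \<in> set_pmf (xi_pmf (p t x))" and h: "0 < h"
  shows "l / 2 * norm (matrix_inv (\<sigma>0 t x)) / sqrt (p t x) \<le> (1 - p t x) *
    (1 + h * (((1/2) *\<^sub>R (\<sigma> t x y ** transpose (\<sigma> t x y)) - (1/2) *\<^sub>R (\<sigma>0 t x ** transpose (\<sigma>0 t x)))
       \<bullet> K2 (\<sigma>0 t x) (p t x) h \<xi>))"
proof -
  let ?G = "quasilinear_G \<sigma> b f"
  let ?P = "matrix_inv (\<sigma>0 t x)"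
  \<comment> \<open>The derivative of \<open>G\<close> in \<gamma> does not involve \<open>z\<close>
    or \<gamma>, so only \<open>y\<close> remains in the conditions that define the
    constants.\<close>
  define At where "At y = ?P ** ((1/2) *\<^sub>R (\<sigma> t x y ** transpose (\<sigma> t x y))) ** transpose ?P" for y
  have Gt: "Gtilde_gamma ?G \<sigma>0 t x y z \<gamma> = At y" if "\<gamma> \<in> sym_mats" for y z \<gamma>
    by (simp add: Gtilde_gamma_def G_gamma_quasilinear[OF that] At_def)
  have sym0: "0 \<in> sym_mats" by (simp add: sym_mats_def transpose_def vec_eq_iff)
  have s: "invertible (\<sigma>0 t x)" and p0: "0 < p t x" "p t x < 1"
    using sd t unfolding scheme_data_def by auto
  have M2': "p t x \<in> p_range ?G \<sigma>0 t x"
     "lambda_star T ?G \<sigma>0 / 2 \<le> ereal (lambda_p ?G \<sigma>0 t x (p t x))"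
     "alpha_lower ?G \<sigma>0 t x = ereal (1 / (c_p ?G \<sigma>0 t x (p t x))\<^sup>2)"
    using M2 t unfolding assumption_M2_def by auto

  define \<alpha>l where "\<alpha>l = 1 / (c_p ?G \<sigma>0 t x (p t x))\<^sup>2"
  have AL: "alpha_lower ?G \<sigma>0 t x = (SUP \<alpha>\<in>{\<alpha>. 0 < \<alpha> \<and> (\<forall>y i. \<alpha> \<le> At y $ i $ i)}. ereal \<alpha>)"
    unfolding alpha_lower_def using sym0
    by (auto simp: Gt scalar_le_diag_part_iff intro!: arg_cong[where f = Sup] image_cong)
  have ALr: "alpha_lower ?G \<sigma>0 t x = ereal \<alpha>l" using M2'(3) by (simp add: \<alpha>l_def)
  have al: "\<alpha>l \<le> At y $ i $ i" for y i
  proof -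
    have "ereal \<alpha>l \<le> ereal (At y $ i $ i)"
      unfolding ALr[symmetric] AL by (rule SUP_least) auto
    thus ?thesis by simp
  qed
  \<comment> \<open>Without an admissible constant the supremum would be minus infinity, whereas
    (M2) makes it real; any admissible constant is positive and lies below it.\<close>
  have al0: "0 < \<alpha>l"
  proof (cases "{\<alpha>. 0 < \<alpha> \<and> (\<forall>y i. \<alpha> \<le> At y $ i $ i)} = {}")
    case True
    have "ereal \<alpha>l = bot" using ALr unfolding AL True by simp
    thus ?thesis by (simp add: bot_ereal_def)
  next
    case False
    then obtain \<alpha> where \<alpha>: "\<alpha> \<in> {\<alpha>. 0 < \<alpha> \<and> (\<forall>y i. \<alpha> \<le> At y $ i $ i)}" by blast
    hence "ereal \<alpha> \<le> ereal \<alpha>l" unfolding ALr[symmetric] AL by (rule SUP_upper)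
    thus ?thesis using \<alpha> by simp
  qed

  have AU: "alpha_upper ?G \<sigma>0 t x = (INF \<alpha>\<in>{\<alpha>. 0 < \<alpha> \<and> (\<forall>y i. At y $ i $ i \<le> \<alpha>)}. ereal \<alpha>)"
    unfolding alpha_upper_def using sym0
    by (auto simp: Gt diag_part_le_scalar_iff intro!: arg_cong[where f = Inf] image_cong)
  obtain \<alpha>u where AUr: "alpha_upper ?G \<sigma>0 t x = ereal \<alpha>u" and au: "\<And>y i. At y $ i $ i \<le> \<alpha>u"
  proof -
    \<comment> \<open>The bound on \<sigma> makes \<open>alpha_upper\<close> finite; the added 1
      makes \<open>K\<close> strictly positive, as an admissible constant has to be.\<close>
    define K where "K = norm ?P * (1/2 * (B * B)) * norm ?P + 1"
    have B: "0 \<le> B" using order_trans[OF norm_ge_zero bd] .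
    have K: "At y $ i $ i \<le> K" for y i
    proof -
      have "norm (\<sigma> t x y ** transpose (\<sigma> t x y)) \<le> norm (\<sigma> t x y) * norm (transpose (\<sigma> t x y))"
        by (rule norm_matrix_matrix_mult_le)
      also have "\<dots> \<le> B * B" unfolding norm_transpose_real by (intro mult_mono bd B) auto
      finally have 1: "norm ((1/2) *\<^sub>R (\<sigma> t x y ** transpose (\<sigma> t x y))) \<le> 1/2 * (B * B)" by simp
      have "norm (At y) \<le> norm (?P ** ((1/2) *\<^sub>R (\<sigma> t x y ** transpose (\<sigma> t x y)))) * norm (transpose ?P)"
        unfolding At_def by (rule norm_matrix_matrix_mult_le)
      also have "\<dots> \<le> (norm ?P * norm ((1/2) *\<^sub>R (\<sigma> t x y ** transpose (\<sigma> t x y)))) * norm ?P"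
        unfolding norm_transpose_real by (intro mult_right_mono norm_matrix_matrix_mult_le) auto
      also have "\<dots> \<le> norm ?P * (1/2 * (B * B)) * norm ?P"
        by (intro mult_right_mono mult_left_mono 1) auto
      finally show ?thesis using abs_matrix_entry_le_norm[of "At y" i i] by (simp add: K_def)
    qed
    have "0 < K" unfolding K_def using B by (intro add_nonneg_pos mult_nonneg_nonneg) auto
    hence up: "alpha_upper ?G \<sigma>0 t x \<le> ereal K" unfolding AU using K by (intro INF_lower) auto
    have lo: "ereal (At y $ i $ i) \<le> alpha_upper ?G \<sigma>0 t x" for y i
      unfolding AU by (rule INF_greatest) auto
    show ?thesis
    proof (cases "alpha_upper ?G \<sigma>0 t x")
      case (real r)
      show ?thesis using that[OF real] lo unfolding real by simp
    qed (use up lo[of undefined undefined] in auto)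
  qed
  have au0: "0 < \<alpha>u" using al0 al[of undefined undefined] au[of undefined undefined] by linarith

  let ?S = "{\<theta>. 0 \<le> \<theta> \<and> (\<forall>y. loewner_le (diag_part (At y)) ((1 + \<theta>) *\<^sub>R At y))}"
  have TH: "theta ?G \<sigma>0 t x = (INF \<theta>\<in>?S. ereal \<theta>)"
    unfolding theta_def using sym0
    by (auto simp: Gt intro!: arg_cong[where f = Inf] image_cong)
  have "0 \<le> theta ?G \<sigma>0 t x" unfolding TH by (rule INF_greatest) auto
  then obtain \<theta> where THr: "theta ?G \<sigma>0 t x = ereal \<theta>" and th0: "0 \<le> \<theta>"
    using th2 by (cases "theta ?G \<sigma>0 t x") auto
  have lw: "(\<Sum>i\<in>UNIV. At y $ i $ i * (v $ i)\<^sup>2) \<le> (1 + \<theta>') * (v \<bullet> (At y *v v))" if "\<theta>' \<in> ?S" for \<theta>' y v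
    using that by (simp add: loewner_le_iff quadratic_diag_part scaleR_matrix_vector_assoc[symmetric])
  \<comment> \<open>The infimum is itself admissible. If the quadratic form is positive at
    \<open>v\<close>, then \<open>?D / ?q - 1\<close> is a lower bound of all admissible constants.
    Otherwise the inequality for any admissible constant passes to the smaller
    \<open>\<theta>\<close>, because multiplication by \<open>?q\<close> reverses the order.\<close>
  have th: "(\<Sum>i\<in>UNIV. At y $ i $ i * (v $ i)\<^sup>2) \<le> (1 + \<theta>) * (v \<bullet> (At y *v v))" (is "?D \<le> _ * ?q") for y v
  proof (cases "0 < ?q")
    case True
    have "ereal (?D / ?q - 1) \<le> ereal \<theta>"
      unfolding THr[symmetric] TH
    proof (rule INF_greatest)
      fix \<theta>' assume "\<theta>' \<in> ?S"
      from lw[OF this, of y v] True show "ereal (?D / ?q - 1) \<le> ereal \<theta>'"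
        by (simp add: field_simps)
    qed
    thus ?thesis using True by (simp add: field_simps)
  next
    case False
    have "?S \<noteq> {}"
    proof
      assume "?S = {}"
      with TH THr show False by (simp add: top_ereal_def)
    qed
    then obtain \<theta>' where m: "\<theta>' \<in> ?S" by blast
    hence "ereal \<theta> \<le> ereal \<theta>'" unfolding THr[symmetric] TH by (rule INF_lower)
    hence "(1 + \<theta>') * ?q \<le> (1 + \<theta>) * ?q" using False by (intro mult_right_mono_neg) auto
    with lw[OF m, of y v] show ?thesis by linarith
  qed

  let ?p = "p t x" and ?d = "real CARD('d)"
  have p: "0 < ?p" "?p \<le> 1/3" "\<theta> / (2 * (1 + \<theta>)) \<le> ?p"
    using M2'(1) unfolding p_range_def Let_def THr by auto
  define ap where "ap = alpha_p ?G \<sigma>0 t x ?p"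
  have ap_eq: "ap = (?p * (2 + 3 * \<theta>) - \<theta>) / (?p * (1 + \<theta>))"
    unfolding ap_def alpha_p_def Let_def THr by simp
  have ap: "2 * ?p \<le> ap" unfolding ap_eq by (rule alpha_p_ge[OF p(1,2) th0 p(3)])
  have ap2: "?p * (1 + \<theta>) * ap = ?p * (2 + 3 * \<theta>) - \<theta>"
    unfolding ap_eq using p th0 by simp
  define c where "c = c_p ?G \<sigma>0 t x ?p"
  have Lam: "Lam ?G \<sigma>0 t x = \<alpha>u / \<alpha>l" unfolding Lam_def AUr ALr by simp
  have c_eq: "c = sqrt (2 * ?p * (\<alpha>u / \<alpha>l) + ap - 2 * ?p)"
    unfolding c_def c_p_def Lam ap_def ..
  have rad: "0 \<le> 2 * ?p * (\<alpha>u / \<alpha>l) + (ap - 2 * ?p)"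
    using p al0 au0 ap by (intro add_nonneg_nonneg) auto
  hence c2: "c\<^sup>2 = 2 * ?p * (\<alpha>u / \<alpha>l) + ap - 2 * ?p" unfolding c_eq by simp
  have alc: "\<alpha>l = 1 / c\<^sup>2" by (simp add: \<alpha>l_def c_def)
  \<comment> \<open>For \<open>c = 0\<close> the quotient \<open>1 / c\<^sup>2\<close> would take
    the default value 0, which positivity of \<open>\<alpha>l\<close> excludes.\<close>
  have cne: "c \<noteq> 0" using alc al0 by auto
  have c0: "0 < c" using cne rad unfolding c_eq by (simp add: algebra_simps less_le)
  have "c\<^sup>2 * \<alpha>l = 1" using alc cne by simp
  hence c_id: "2 * ?p * \<alpha>u + (ap - 2 * ?p) * \<alpha>l = 1"
    unfolding c2 using al0 by (simp add: distrib_right left_diff_distrib)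
  have sq: "sqrt \<alpha>l = 1 / c" unfolding alc real_sqrt_divide using c0 by simp
  have P0: "0 < norm ?P"
  proof -
    have "?P \<noteq> 0"
    proof
      assume "?P = 0"
      hence "(mat 1 :: real^'d^'d) = 0"
        using matrix_inv_works(1)[OF s] by (simp add: matrix_matrix_mult_def vec_eq_iff)
      hence "(mat 1 :: real^'d^'d) $ undefined $ undefined = 0" by simp
      thus False by (simp add: mat_def)
    qed
    thus ?thesis by simp
  qed
  let ?L = "1 - ?p + ?p * ?d - 2 * ?p * ?d * \<alpha>u"
  \<comment> \<open>Since \<open>sqrt \<alpha>l = 1 / c\<close>, the powers of \<open>c\<close>
    cancel and the bracket of \<open>lambda_p\<close> becomes \<open>?L\<close>, the left side of
    \<open>K2_weight_ge\<close>.\<close>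
  have "lambda_p ?G \<sigma>0 t x ?p
      = sqrt ?p * ((1 - ?p + ?p * ?d) * c - 2 * ?p * ?d * (\<alpha>u / \<alpha>l) / c) * ((1 / c) / norm ?P)"
    unfolding lambda_p_def Let_def Lam ALr c_def[symmetric] real_of_ereal.simps sq ..
  also have "(1 - ?p + ?p * ?d) * c - 2 * ?p * ?d * (\<alpha>u / \<alpha>l) / c = ?L * c"
  proof -
    have "\<alpha>u / \<alpha>l = \<alpha>u * (c * c)" using c0 unfolding alc by (simp add: power2_eq_square)
    hence "2 * ?p * ?d * (\<alpha>u / \<alpha>l) / c = 2 * ?p * ?d * \<alpha>u * c" using c0 by simp
    thus ?thesis by (simp only: left_diff_distrib)
  qed
  also have "sqrt ?p * (?L * c) * ((1 / c) / norm ?P) = sqrt ?p * ?L / norm ?P"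
    using c0 by simp
  finally have lp: "lambda_p ?G \<sigma>0 t x ?p = sqrt ?p * ?L / norm ?P" .
  have "ereal l / 2 = ereal (l / 2)"
    using ereal_divide[of 2 l] by (simp add: numeral_eq_ereal)
  hence "l / 2 \<le> sqrt ?p * ?L / norm ?P"
    using M2'(2) unfolding ls lp by simp
  hence "l / 2 * norm ?P \<le> ?L * sqrt ?p"
    by (simp only: pos_le_divide_eq[OF P0] mult.commute[of "sqrt ?p"])
  hence "l / 2 * norm ?P / sqrt ?p \<le> ?L"
    using p(1) by (simp only: pos_divide_le_eq real_sqrt_gt_0_iff)
  also have "?L \<le> (1 - p t x) *
    (1 + h * (((1/2) *\<^sub>R (\<sigma> t x y ** transpose (\<sigma> t x y)) - (1/2) *\<^sub>R (\<sigma>0 t x ** transpose (\<sigma>0 t x)))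
       \<bullet> K2 (\<sigma>0 t x) (p t x) h \<xi>))"
    using K2_weight_ge[where A = "(1/2) *\<^sub>R (\<sigma> t x y ** transpose (\<sigma> t x y))" and s = "\<sigma>0 t x" and p = ?p
        and \<theta> = \<theta> and \<alpha>l = \<alpha>l and \<alpha>u = \<alpha>u and ap = ap and h = h and \<xi> = \<xi>,
        OF p(1,2) s h \<xi> th0, folded At_def, OF th al au ap ap2 c_id] .
  finally show ?thesis .
qed

section \<open>Regularity of the solution\<close>

text \<open>\<open>grad\<close> records the derivative along the axes only; linearity recovers it in
  all directions.\<close>

lemma grad_has_derivative:
  assumes "\<phi> differentiable (at x)"
  shows "(\<phi> has_derivative (\<lambda>w. grad \<phi> x \<bullet> w)) (at x)"
proof -
  let ?f = "frechet_derivative \<phi> (at x)"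
  have d: "(\<phi> has_derivative ?f) (at x)" using assms by (simp add: frechet_derivative_works)
  hence lin: "linear ?f" by (rule has_derivative_linear)
  have "?f w = grad \<phi> x \<bullet> w" for w
  proof -
    have "?f w = ?f (\<Sum>i\<in>UNIV. (w $ i) *\<^sub>R axis i 1)"
      using basis_expansion[of w] by (simp add: scalar_mult_eq_scaleR)
    also have "\<dots> = (\<Sum>i\<in>UNIV. w $ i * ?f (axis i 1))"
      by (simp add: linear_sum[OF lin] linear_cmul[OF lin])
    finally show ?thesis by (simp add: grad_def inner_vec_def mult.commute)
  qed
  hence "?f = (\<lambda>w. grad \<phi> x \<bullet> w)" by (rule ext)
  with d show ?thesis by simp
qed

lemma grad_line_derivative:
  assumes "\<phi> differentiable (at (x + r *\<^sub>R v))"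
  shows "((\<lambda>r. \<phi> (x + r *\<^sub>R v)) has_real_derivative grad \<phi> (x + r *\<^sub>R v) \<bullet> v) (at r)"
proof -
  have l: "((\<lambda>r. x + r *\<^sub>R v) has_derivative (\<lambda>r. r *\<^sub>R v)) (at r)"
    by (auto intro!: derivative_eq_intros)
  have "((\<lambda>r. \<phi> (x + r *\<^sub>R v)) has_derivative (\<lambda>w. grad \<phi> (x + r *\<^sub>R v) \<bullet> (w *\<^sub>R v))) (at r)"
    by (rule has_derivative_compose[OF l grad_has_derivative[OF assms]])
  thus ?thesis by (simp add: has_field_derivative_def mult_commute_abs)
qed

lemma hess_line_derivative:
  assumes "grad \<phi> differentiable (at (x + r *\<^sub>R v))"
  shows "((\<lambda>r. grad \<phi> (x + r *\<^sub>R v) \<bullet> v) has_real_derivative v \<bullet> (hess \<phi> (x + r *\<^sub>R v) *v v)) (at r)"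
proof -
  have l: "((\<lambda>r. x + r *\<^sub>R v) has_derivative (\<lambda>r. r *\<^sub>R v)) (at r)"
    by (auto intro!: derivative_eq_intros)
  have g: "(grad \<phi> has_derivative (\<lambda>w. hess \<phi> (x + r *\<^sub>R v) *v w)) (at (x + r *\<^sub>R v))"
    using assms by (simp add: jacobian_works jacobian_def hess_def)
  have "((\<lambda>r. grad \<phi> (x + r *\<^sub>R v)) has_derivative (\<lambda>w. hess \<phi> (x + r *\<^sub>R v) *v (w *\<^sub>R v))) (at r)"
    by (rule has_derivative_compose[OF l g])
  hence "((\<lambda>r. grad \<phi> (x + r *\<^sub>R v) \<bullet> v) has_derivative
      (\<lambda>w. (hess \<phi> (x + r *\<^sub>R v) *v (w *\<^sub>R v)) \<bullet> v)) (at r)"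
    by (rule has_derivative_inner_left)
  thus ?thesis
    by (simp add: has_field_derivative_def mult_commute_abs matrix_vector_mult_scaleR inner_commute[of v])
qed

section \<open>Uniform bounds and expansions in time and space\<close>

lemma bounded_strip_obtain:
  fixes w :: "real \<Rightarrow> 'a \<Rightarrow> 'b::real_normed_vector"
  assumes "bounded ((\<lambda>(t, x). w t x) ` ({0..T} \<times> UNIV))"
  obtains M where "0 \<le> M" "\<And>t x. t \<in> {0..T} \<Longrightarrow> norm (w t x) \<le> M"
proof -
  obtain M where "\<forall>z\<in>(\<lambda>(t, x). w t x) ` ({0..T} \<times> UNIV). norm z \<le> M"
    using assms by (auto simp: bounded_iff)
  moreover have "w t x \<in> (\<lambda>(t, x). w t x) ` ({0..T} \<times> UNIV)" if "t \<in> {0..T}" for t x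
    using that by (intro image_eqI[where x = "(t, x)"]) auto
  ultimately have "norm (w t x) \<le> max M 0" if "t \<in> {0..T}" for t x
    using that by (meson max.coboundedI1)
  thus ?thesis using that[of "max M 0"] by simp
qed

lemma C2b_time_lipschitz:
  assumes "C2b T w"
  obtains M where "0 \<le> M"
    "\<And>s t x. s \<in> {0..T} \<Longrightarrow> t \<in> {0..T} \<Longrightarrow> \<bar>w s x - w t x\<bar> \<le> M * \<bar>s - t\<bar>"
proof -
  obtain M where M: "0 \<le> M" "\<And>t x. t \<in> {0..T} \<Longrightarrow> norm (dt T w t x) \<le> M"
    using assms bounded_strip_obtain[of "dt T w" T] unfolding C2b_def by blast
  have "\<bar>w s x - w t x\<bar> \<le> M * \<bar>s - t\<bar>" if "s \<in> {0..T}" "t \<in> {0..T}" for s t x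
  proof -
    have "norm (w s x - w t x) \<le> M * norm (s - t)"
    proof (rule field_differentiable_bound[where f' = "\<lambda>r. dt T w r x" and B = M, OF _ _ _ that])
      fix r assume r: "r \<in> {0..T}"
      have "(\<lambda>s. w s x) differentiable (at r within {0..T})"
        using assms r unfolding C2b_def C12_def by blast
      thus "((\<lambda>s. w s x) has_field_derivative dt T w r x) (at r within {0..T})"
        unfolding dt_def has_real_derivative_iff_has_vector_derivative by (simp add: vector_derivative_works)
      show "norm (dt T w r x) \<le> M" using M(2)[OF r] .
    qed simp
    thus ?thesis by simp
  qed
  with M(1) that show ?thesis by blast
qed

text \<open>A quadratic remainder follows because the time derivative is itself Lipschitz in
  time.\<close>

lemma C2b_time_taylor:
  assumes "C2b T u" "C2b T (dt T u)"
  obtains M where "0 \<le> M"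
    "\<And>s t x. s \<in> {0..T} \<Longrightarrow> t \<in> {0..T} \<Longrightarrow> \<bar>u s x - u t x - (s - t) * dt T u t x\<bar> \<le> M * \<bar>s - t\<bar>\<^sup>2"
proof -
  obtain M where M: "0 \<le> M"
    "\<And>s t x. s \<in> {0..T} \<Longrightarrow> t \<in> {0..T} \<Longrightarrow> \<bar>dt T u s x - dt T u t x\<bar> \<le> M * \<bar>s - t\<bar>"
    using C2b_time_lipschitz[OF assms(2)] by metis
  have "\<bar>u s x - u t x - (s - t) * dt T u t x\<bar> \<le> M * \<bar>s - t\<bar>\<^sup>2"
    if st: "s \<in> {0..T}" "t \<in> {0..T}" for s t x
  proof -
    have sub: "closed_segment t s \<subseteq> {0..T}" using st by (auto simp: closed_segment_eq_real_ivl)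
    have "norm (u s x - u t x - (s - t) *\<^sub>R dt T u t x) \<le> norm (s - t) * (M * \<bar>s - t\<bar>)"
    proof (rule vector_differentiable_bound_linearization[where S = "closed_segment t s" and f' = "\<lambda>r. dt T u r x"])
      fix r assume r: "r \<in> closed_segment t s"
      have "(\<lambda>s. u s x) differentiable (at r within {0..T})"
        using assms(1) r sub unfolding C2b_def C12_def by blast
      hence "((\<lambda>s. u s x) has_vector_derivative dt T u r x) (at r within {0..T})"
        unfolding dt_def by (simp add: vector_derivative_works)
      thus "((\<lambda>s. u s x) has_vector_derivative dt T u r x) (at r within closed_segment t s)"
        by (rule has_vector_derivative_within_subset[OF _ sub])
      have "\<bar>dt T u r x - dt T u t x\<bar> \<le> M * \<bar>r - t\<bar>" using M(2) r sub st by blast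
      also have "\<dots> \<le> M * \<bar>s - t\<bar>"
        using r M(1) by (intro mult_left_mono) (auto simp: closed_segment_eq_real_ivl split: if_splits)
      finally show "norm (dt T u r x - dt T u t x) \<le> M * \<bar>s - t\<bar>" by simp
    qed auto
    thus ?thesis by (simp add: power2_eq_square mult_ac)
  qed
  with M(1) that show ?thesis by blast
qed

text \<open>Constants are found for one component at a time; their sum serves all
  components.\<close>

lemma finite_uniform_bound:
  fixes P :: "'i::finite \<Rightarrow> real \<Rightarrow> bool"
  assumes "\<And>i. \<exists>M\<ge>0. P i M" and mono: "\<And>i M M'. P i M \<Longrightarrow> M \<le> M' \<Longrightarrow> P i M'"
  obtains M where "0 \<le> M" "\<And>i. P i M"
proof -
  obtain m where m: "\<And>i. 0 \<le> m i" "\<And>i. P i (m i)" using assms(1) by metis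
  have "m i \<le> sum m UNIV" for i using m by (intro member_le_sum) auto
  thus ?thesis using that[of "sum m UNIV"] m mono by (simp add: sum_nonneg) blast
qed

text \<open>The function is restricted to the line through \<open>x\<close> in direction
  \<open>v\<close>. Its third and fourth derivatives there are obtained by differentiating the
  entries of the Hessian, each of which lies in \<open>C2b\<close>, so higher derivative tensors are
  avoided.\<close>

lemma C4b_space_taylor:
  fixes u :: "real \<Rightarrow> real^'d \<Rightarrow> real"
  assumes u: "C4b T u"
  obtains M C where "0 \<le> M"
    "\<And>t x v. t \<in> {0..T} \<Longrightarrow>
       \<bar>u t (x + v) - u t x - grad (u t) x \<bullet> v - (v \<bullet> (hess (u t) x *v v)) / 2 - C t x v\<bar> \<le> M * norm v ^ 4"
    "\<And>t x v. C t x (- v) = - C t x v"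
    "\<And>t x v. t \<in> {0..T} \<Longrightarrow> \<bar>C t x v\<bar> \<le> M * norm v ^ 3"
proof -
  define H where "H i j t x = hess (u t) x $ i $ j" for i j t x
  have H2: "C2b T (H i j)" for i j using u unfolding C4b_def H_def[abs_def] by blast
  define P where "P ij M \<longleftrightarrow> (\<forall>t\<in>{0..T}. \<forall>x. norm (grad (H (fst ij) (snd ij) t) x) \<le> M
     \<and> norm (hess (H (fst ij) (snd ij) t) x) \<le> M)" for ij M
  have ex: "\<exists>M\<ge>0. P ij M" for ij
  proof -
    let ?H = "H (fst ij) (snd ij)"
    obtain M1 where "0 \<le> M1" "\<And>t x. t \<in> {0..T} \<Longrightarrow> norm (grad (?H t) x) \<le> M1"
      using H2 bounded_strip_obtain[of "\<lambda>t x. grad (?H t) x" T] unfolding C2b_def by blast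
    moreover obtain M2 where "0 \<le> M2" "\<And>t x. t \<in> {0..T} \<Longrightarrow> norm (hess (?H t) x) \<le> M2"
      using H2 bounded_strip_obtain[of "\<lambda>t x. hess (?H t) x" T] unfolding C2b_def by blast
    ultimately show ?thesis by (intro exI[of _ "max M1 M2"]) (auto simp: le_max_iff_disj P_def)
  qed
  have mono: "P ij M'" if "P ij M" "M \<le> M'" for ij M M'
    using that unfolding P_def by (meson order_trans)
  obtain K where K: "0 \<le> K" "\<And>ij. P ij K"
    by (rule finite_uniform_bound[of P]) (use ex mono in blast)+
  have Kg: "norm (grad (H i j t) x) \<le> K" and Kh: "norm (hess (H i j t) x) \<le> K" if "t \<in> {0..T}" for i j t x
    using K(2)[of "(i, j)"] that by (auto simp: P_def)
  \<comment> \<open>The third derivative in direction \<open>v\<close>, divided by 3!; as a cubic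
    form it is odd in \<open>v\<close>.\<close>
  define C where "C t x v = (\<Sum>i\<in>UNIV. \<Sum>j\<in>UNIV. v $ i * v $ j * (grad (H i j t) x \<bullet> v)) / 6" for t x v
  \<comment> \<open>There are \<open>d\<^sup>2\<close> entries of the Hessian, each contributing at
    most \<open>K\<close>.\<close>
  define N where "N = (real CARD('d))\<^sup>2 * K"
  have N0: "0 \<le> N" using K by (simp add: N_def)
  have double_sum: "\<bar>\<Sum>i\<in>UNIV. \<Sum>j\<in>UNIV. v $ i * v $ j * w i j\<bar> \<le> N * norm v ^ (k + 2)"
    if w: "\<And>i j. \<bar>w i j\<bar> \<le> K * norm v ^ k" for v :: "real^'d" and w k
  proof -
    have "\<bar>\<Sum>i\<in>UNIV. \<Sum>j\<in>UNIV. v $ i * v $ j * w i j\<bar> \<le> (\<Sum>i\<in>UNIV. \<Sum>j\<in>UNIV. \<bar>v $ i * v $ j * w i j\<bar>)"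
      by (rule order_trans[OF sum_abs]) (intro sum_mono sum_abs)
    also have "\<dots> \<le> (\<Sum>i\<in>(UNIV::'d set). \<Sum>j\<in>(UNIV::'d set). norm v * norm v * (K * norm v ^ k))"
      unfolding abs_mult
      by (intro sum_mono mult_mono w component_le_norm_cart) auto
    also have "\<dots> = N * norm v ^ (k + 2)"
      by (simp add: N_def power2_eq_square power_add)
    finally show ?thesis .
  qed
  have Cb: "\<bar>C t x v\<bar> \<le> N * norm v ^ 3" if t: "t \<in> {0..T}" for t x v
  proof -
    have "\<bar>grad (H i j t) x \<bullet> v\<bar> \<le> K * norm v ^ 1" for i j
      using order_trans[OF Cauchy_Schwarz_ineq2 mult_right_mono[OF Kg[OF t]]] by simp
    from double_sum[OF this] have *: "\<bar>\<Sum>i\<in>UNIV. \<Sum>j\<in>UNIV. v $ i * v $ j * (grad (H i j t) x \<bullet> v)\<bar> \<le> N * norm v ^ 3"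
      by (simp add: numeral_3_eq_3)
    have "0 \<le> N * norm v ^ 3" using N0 by simp
    with * show ?thesis by (simp add: C_def)
  qed
  have rem: "\<bar>u t (x + v) - u t x - grad (u t) x \<bullet> v - (v \<bullet> (hess (u t) x *v v)) / 2 - C t x v\<bar> \<le> N * norm v ^ 4"
    if t: "t \<in> {0..T}" for t x v
  proof -
    have du: "u t differentiable (at y)" "grad (u t) differentiable (at y)" for y
      using u t unfolding C4b_def C2b_def C12_def by blast+
    have dH: "H i j t differentiable (at y)" "grad (H i j t) differentiable (at y)" for i j y
      using H2[of i j] t unfolding C2b_def C12_def by blast+
    have q: "v \<bullet> (hess (u t) y *v v) = (\<Sum>i\<in>UNIV. \<Sum>j\<in>UNIV. v $ i * v $ j * H i j t y)" for y
      by (simp add: inner_vec_def matrix_vector_mult_def H_def sum_distrib_left mult_ac)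
    \<comment> \<open>The successive derivatives of
      \<open>r \<mapsto> u t (x + r *\<^sub>R v)\<close>, in the shape required by Maclaurin's
      formula.\<close>
    define D where "D m r = (if m = 0 then u t (x + r *\<^sub>R v) else if m = 1 then grad (u t) (x + r *\<^sub>R v) \<bullet> v
      else if m = 2 then (\<Sum>i\<in>UNIV. \<Sum>j\<in>UNIV. v $ i * v $ j * H i j t (x + r *\<^sub>R v))
      else if m = 3 then (\<Sum>i\<in>UNIV. \<Sum>j\<in>UNIV. v $ i * v $ j * (grad (H i j t) (x + r *\<^sub>R v) \<bullet> v))
      else (\<Sum>i\<in>UNIV. \<Sum>j\<in>UNIV. v $ i * v $ j * (v \<bullet> (hess (H i j t) (x + r *\<^sub>R v) *v v))))"
      for m :: nat and r
    have "\<forall>m r. m < 4 \<and> 0 \<le> r \<and> r \<le> 1 \<longrightarrow> (D m has_real_derivative D (Suc m) r) (at r)"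
    proof (intro allI impI)
      fix m :: nat and r :: real assume m: "m < 4 \<and> 0 \<le> r \<and> r \<le> 1"
      consider "m = 0" | "m = 1" | "m = 2" | "m = 3" using m by linarith
      thus "(D m has_real_derivative D (Suc m) r) (at r)"
      proof cases
        case 1 thus ?thesis using grad_line_derivative[OF du(1)] by (simp add: D_def[abs_def])
      next
        case 2 thus ?thesis using hess_line_derivative[OF du(2)[of "x + r *\<^sub>R v"]] unfolding q
          by (simp add: D_def[abs_def])
      next
        case 3 thus ?thesis
          by (simp add: D_def[abs_def])
            (intro DERIV_sum DERIV_cmult grad_line_derivative[OF dH(1)])
      next
        case 4 thus ?thesis
          by (simp add: D_def[abs_def])
            (intro DERIV_sum DERIV_cmult hess_line_derivative[OF dH(2)])
      qed
    qed
    from Maclaurin[of 1 4 D "D 0", OF _ _ refl this] obtain r where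
      "D 0 1 = (\<Sum>m<4. (D m 0 / fact m) * 1 ^ m) + (D 4 r / fact 4) * 1 ^ 4" by auto
    moreover have "{..<4} = {0, 1, 2, 3::nat}" by auto
    ultimately have "D 0 1 = D 0 0 + D 1 0 + D 2 0 / 2 + D 3 0 / 6 + D 4 r / 24"
      by (simp add: fact_numeral)
    hence e: "u t (x + v) - u t x - grad (u t) x \<bullet> v - (v \<bullet> (hess (u t) x *v v)) / 2 - C t x v = D 4 r / 24"
      by (simp add: D_def q C_def)
    have "\<bar>v \<bullet> (hess (H i j t) y *v v)\<bar> \<le> K * norm v ^ 2" for i j y
    proof -
      have "\<bar>v \<bullet> (hess (H i j t) y *v v)\<bar> \<le> norm v * (norm (hess (H i j t) y) * norm v)"
        by (rule order_trans[OF Cauchy_Schwarz_ineq2 mult_left_mono[OF norm_matrix_vector_mult_le]]) simp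
      also have "\<dots> \<le> norm v * (K * norm v)" by (intro mult_left_mono mult_right_mono Kh[OF t]) auto
      finally show ?thesis by (simp add: power2_eq_square mult_ac)
    qed
    from double_sum[OF this] have "\<bar>D 4 r\<bar> \<le> N * norm v ^ 4" by (simp add: D_def)
    moreover have "0 \<le> N * norm v ^ 4" using N0 by simp
    ultimately show ?thesis unfolding e by simp
  qed
  have odd: "C t x (- v) = - C t x v" for t x v
    by (simp add: C_def sum_negf)
  show ?thesis by (rule that[OF N0 rem odd Cb])
qed

section \<open>Stability and consistency of one step\<close>

text \<open>One step with \<open>(t, x)\<close> frozen: the second-order coefficient
  \<open>A\<close> is a function of \<open>y\<close> alone and \<open>B\<close> of \<open>y\<close>
  and \<open>z\<close>, so stability and consistency can be stated without reference to (M) or to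
  the strip.\<close>

definition scheme_step ::
  "(real \<Rightarrow> real^'d^'d) \<Rightarrow> (real \<Rightarrow> real^'d \<Rightarrow> real) \<Rightarrow> real^'d^'d \<Rightarrow> real \<Rightarrow> real \<Rightarrow>
   (real^'d \<Rightarrow> real) \<Rightarrow> real^'d \<Rightarrow> real" where
  "scheme_step A B s p h \<phi> x = Dop0 s p h \<phi> x + h *
     ((A (Dop0 s p h \<phi> x) - (1/2) *\<^sub>R (s ** transpose s)) \<bullet> Dop2 s p h \<phi> x
      + B (Dop0 s p h \<phi> x) (Dop1 s p h \<phi> x))"

text \<open>At \<open>S = \<sigma> t x y\<close> this is the derivative of \<open>G\<close> in
  \<gamma>; at \<open>S = \<sigma>0 t x\<close> it is half of the reference diffusion
  \<open>a0\<close>.\<close>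

definition second_order_coeff :: "real^'m^'d \<Rightarrow> real^'d^'d" where
  "second_order_coeff S = (1/2) *\<^sub>R (S ** transpose S)"

definition lower_order_part ::
  "(real \<Rightarrow> real^'m^'d) \<Rightarrow> (real \<Rightarrow> real^'m \<Rightarrow> real^'d) \<Rightarrow> (real \<Rightarrow> real^'m \<Rightarrow> real) \<Rightarrow>
   real \<Rightarrow> real^'d \<Rightarrow> real" where
  "lower_order_part S b f y z = b y (transpose (S y) *v z) \<bullet> z + f y (transpose (S y) *v z)"

lemma quasilinear_G_eq:
  "quasilinear_G \<sigma> b f t x y z \<gamma>
    = second_order_coeff (\<sigma> t x y) \<bullet> \<gamma> + lower_order_part (\<sigma> t x) (b t x) (f t x) y z"
  by (simp add: quasilinear_G_def second_order_coeff_def lower_order_part_def frob_inner)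

lemma T_op_eq:
  "T_op (quasilinear_G \<sigma> b f) \<sigma>0 p t h \<phi> x = scheme_step (\<lambda>y. second_order_coeff (\<sigma> t x y))
     (lower_order_part (\<sigma> t x) (b t x) (f t x)) (\<sigma>0 t x) (p t x) h \<phi> x"
  by (simp add: T_op_def F_of_def quasilinear_G_eq scheme_step_def frob_inner inner_diff_left)

lemma transpose_second_order_coeff:
  fixes S :: "real^'m^'d"
  shows "transpose (second_order_coeff S) = second_order_coeff S"
proof -
  have "transpose (c *\<^sub>R M) = c *\<^sub>R transpose M" for M :: "real^'d^'d" and c
    by (simp add: transpose_def vec_eq_iff)
  thus ?thesis by (simp add: second_order_coeff_def matrix_transpose_mul)
qed

section \<open>Bounds and Lipschitz estimates for the coefficients\<close>

lemma norm_second_order_coeff_le: "norm (second_order_coeff S) \<le> (norm S)\<^sup>2"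
proof -
  have "norm (S ** transpose S) \<le> norm S * norm S"
    using norm_matrix_matrix_mult_le[of S "transpose S"] by (simp add: norm_transpose_real)
  moreover have "0 \<le> norm S * norm S" by simp
  ultimately have "1/2 * norm (S ** transpose S) \<le> norm S * norm S" by linarith
  thus ?thesis by (simp add: second_order_coeff_def power2_eq_square)
qed

lemma second_order_coeff_lipschitz:
  fixes S S' :: "real^'m^'d"
  assumes "norm S \<le> M" "norm S' \<le> M"
  shows "norm (second_order_coeff S - second_order_coeff S') \<le> M * norm (S - S')"
proof -
  have "S ** transpose S - S' ** transpose S' = (S - S') ** transpose S + S' ** transpose (S - S')"
    by (simp add: vec_eq_iff matrix_matrix_mult_def transpose_def algebra_simps sum.distrib sum_subtractf)
  also have "norm \<dots> \<le> norm (S - S') * norm S + norm S' * norm (S - S')"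
    by (intro norm_triangle_le add_mono order_trans[OF norm_matrix_matrix_mult_le])
      (simp_all add: norm_transpose_real)
  also have "\<dots> \<le> norm (S - S') * M + M * norm (S - S')"
    by (intro add_mono mult_left_mono mult_right_mono assms) auto
  finally have "norm (S ** transpose S - S' ** transpose S') \<le> 2 * (M * norm (S - S'))" by (simp add: mult_ac)
  moreover have "second_order_coeff S - second_order_coeff S' = (1/2) *\<^sub>R (S ** transpose S - S' ** transpose S')"
    by (simp add: second_order_coeff_def scaleR_diff_right)
  ultimately show ?thesis by simp
qed

text \<open>Only \<open>z'\<close> is assumed bounded. In the application it is a gradient, exact or
  discrete, of the smooth solution, while \<open>z\<close> may be a discrete gradient of the
  approximation, for which no bound is known.\<close>

lemma lower_order_part_lipschitz:
  fixes S :: "real \<Rightarrow> real^'m^'d"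
  assumes M: "\<And>y. norm (S y) \<le> M" "\<And>y w. norm (b y w) \<le> M"
    and L: "0 \<le> L" "\<And>y y'. norm (S y - S y') \<le> L * \<bar>y - y'\<bar>"
      "\<And>y w y' w'. norm (b y w - b y' w') \<le> L * (\<bar>y - y'\<bar> + norm (w - w'))"
      "\<And>y w y' w'. \<bar>f y w - f y' w'\<bar> \<le> L * (\<bar>y - y'\<bar> + norm (w - w'))"
    and R: "norm z' \<le> R"
  shows "\<bar>lower_order_part S b f y z - lower_order_part S b f y' z'\<bar>
    \<le> (R + 1) * L * (1 + L * R) * \<bar>y - y'\<bar> + (M + (R + 1) * L * M) * norm (z - z')"
proof -
  have M0: "0 \<le> M" using order_trans[OF norm_ge_zero M(1)] .
  have R0: "0 \<le> R" using order_trans[OF norm_ge_zero R] .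
  define w where "w = transpose (S y) *v z"
  define w' where "w' = transpose (S y') *v z'"
  have "w - w' = transpose (S y) *v (z - z') + transpose (S y - S y') *v z'"
    by (simp add: w_def w'_def vec_eq_iff matrix_vector_mult_def transpose_def algebra_simps sum.distrib sum_subtractf)
  also have "norm \<dots> \<le> norm (S y) * norm (z - z') + norm (S y - S y') * norm z'"
    using norm_matrix_vector_mult_le[of "transpose (S y)" "z - z'"]
      norm_matrix_vector_mult_le[of "transpose (S y - S y')" z']
    by (intro norm_triangle_le add_mono) (simp_all add: norm_transpose_real)
  also have "\<dots> \<le> M * norm (z - z') + (L * \<bar>y - y'\<bar>) * R"
    by (intro add_mono mult_right_mono mult_mono M L R) (auto simp: L)
  finally have ww: "norm (w - w') \<le> M * norm (z - z') + L * R * \<bar>y - y'\<bar>" by (simp add: mult_ac)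
  define E where "E = L * ((1 + L * R) * \<bar>y - y'\<bar> + M * norm (z - z'))"
  have LE: "L * (\<bar>y - y'\<bar> + norm (w - w')) \<le> E"
    unfolding E_def using ww L(1) by (intro mult_left_mono) (auto simp: algebra_simps)
  \<comment> \<open>This splitting pairs the difference of the values of \<open>b\<close> with the
    bounded vector \<open>z'\<close>, and the difference of the vectors with a bounded value of
    \<open>b\<close>.\<close>
  have "b y w \<bullet> z - b y' w' \<bullet> z' = b y w \<bullet> (z - z') + (b y w - b y' w') \<bullet> z'"
    by (simp add: inner_diff_left inner_diff_right)
  also have "\<bar>\<dots>\<bar> \<le> norm (b y w) * norm (z - z') + norm (b y w - b y' w') * norm z'"
    by (rule order_trans[OF abs_triangle_ineq add_mono[OF Cauchy_Schwarz_ineq2 Cauchy_Schwarz_ineq2]])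
  also have "\<dots> \<le> M * norm (z - z') + E * R"
    using order_trans[OF L(3) LE] by (intro add_mono mult_right_mono mult_mono M R)
      (auto intro: order_trans[OF norm_ge_zero])
  finally have 1: "\<bar>b y w \<bullet> z - b y' w' \<bullet> z'\<bar> \<le> M * norm (z - z') + E * R" .
  have 2: "\<bar>f y w - f y' w'\<bar> \<le> E" by (rule order_trans[OF L(4) LE])
  have "\<bar>lower_order_part S b f y z - lower_order_part S b f y' z'\<bar> \<le> M * norm (z - z') + E * R + E"
    unfolding lower_order_part_def w_def[symmetric] w'_def[symmetric] using 1 2 by linarith
  also have "\<dots> = (R + 1) * L * (1 + L * R) * \<bar>y - y'\<bar> + (M + (R + 1) * L * M) * norm (z - z')"
    unfolding E_def by (simp add: algebra_simps)
  finally show ?thesis .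
qed

lemma Dop_diff:
  assumes p: "0 < p" "p < 1"
  shows "Dop0 s p h \<phi> x - Dop0 s p h \<psi> x = Dop0 s p h (\<lambda>y. \<phi> y - \<psi> y) x"
    "Dop1 s p h \<phi> x - Dop1 s p h \<psi> x = Dop1 s p h (\<lambda>y. \<phi> y - \<psi> y) x"
    "Dop2 s p h \<phi> x - Dop2 s p h \<psi> x = Dop2 s p h (\<lambda>y. \<phi> y - \<psi> y) x"
  unfolding Dop0_def Dop1_def Dop2_def
  by (simp_all only: Bochner_Integration.integral_diff[OF integrable_xi_pmf[OF p] integrable_xi_pmf[OF p], symmetric]
      scaleR_left_diff_distrib)

text \<open>The first-order term is absorbed into the weights: \<open>C\<^sub>z |D\<^sub>1 \<delta>|\<close> is \<open>\<beta> \<cdot> D\<^sub>1 \<delta>\<close> for a suitable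
  \<open>\<beta>\<close> of norm at most \<open>C\<^sub>z\<close>, so that what remains is an average of \<open>\<delta>\<close> with nonnegative weights.\<close>

lemma scheme_step_stable:
  fixes A :: "real \<Rightarrow> real^'d^'d" and \<phi> \<psi> :: "real^'d \<Rightarrow> real"
  assumes p: "0 < p" "p < 1" and h: "0 < h"
    and \<epsilon>: "\<And>y. \<bar>\<phi> y - \<psi> y\<bar> \<le> \<epsilon>"
    and weight: "\<And>y \<xi> \<beta>. \<xi> \<in> set_pmf (xi_pmf p) \<Longrightarrow> norm \<beta> \<le> Cz \<Longrightarrow>
      0 \<le> 1 + h * ((A y - (1/2) *\<^sub>R (s ** transpose s)) \<bullet> K2 s p h \<xi>) + h * (\<beta> \<bullet> K1 s h \<xi>)"
    and A: "\<And>y y'. \<bar>(A y - A y') \<bullet> Dop2 s p h \<psi> x\<bar> \<le> CA * \<bar>y - y'\<bar>"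
    and B: "\<And>y z y'. \<bar>B y z - B y' (Dop1 s p h \<psi> x)\<bar> \<le> Cy * \<bar>y - y'\<bar> + Cz * norm (z - Dop1 s p h \<psi> x)"
    and C0: "0 \<le> CA" "0 \<le> Cy" "0 \<le> Cz"
  shows "\<bar>scheme_step A B s p h \<phi> x - scheme_step A B s p h \<psi> x\<bar> \<le> (1 + h * (CA + Cy)) * \<epsilon>"
proof -
  note int = integrable_xi_pmf[OF p]
  define \<delta> where "\<delta> = (\<lambda>y. \<phi> y - \<psi> y)"
  define Yd where "Yd = Dop0 s p h \<delta> x"
  define Zd where "Zd = Dop1 s p h \<delta> x"
  let ?Y = "Dop0 s p h \<phi> x" and ?Y' = "Dop0 s p h \<psi> x"
  let ?Z = "Dop1 s p h \<phi> x" and ?Z' = "Dop1 s p h \<psi> x"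
  let ?\<Gamma> = "Dop2 s p h \<phi> x" and ?\<Gamma>' = "Dop2 s p h \<psi> x"
  let ?S = "A ?Y - (1/2) *\<^sub>R (s ** transpose s)"
  define m where "m = Yd + h * (?S \<bullet> Dop2 s p h \<delta> x)"
  have Y: "?Y - ?Y' = Yd" and Z: "?Z - ?Z' = Zd" and G: "?\<Gamma> - ?\<Gamma>' = Dop2 s p h \<delta> x"
    unfolding Yd_def Zd_def \<delta>_def by (rule Dop_diff[OF p])+
  have \<epsilon>0: "0 \<le> \<epsilon>" using order_trans[OF abs_ge_zero \<epsilon>] .
  have Yd: "\<bar>Yd\<bar> \<le> \<epsilon>"
    unfolding Yd_def Dop0_def by (rule xi_expect_abs_le[OF p]) (simp add: \<delta>_def \<epsilon>)
  \<comment> \<open>The left side is an average of \<open>\<delta>\<close> with nonnegative weights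
    of mean one.\<close>
  have key: "\<bar>m + h * (\<beta> \<bullet> Zd)\<bar> \<le> \<epsilon>" if \<beta>: "norm \<beta> \<le> Cz" for \<beta>
  proof -
    define w where "w \<xi> = 1 + h * (?S \<bullet> K2 s p h \<xi>) + h * (\<beta> \<bullet> K1 s h \<xi>)" for \<xi>
    have w0: "0 \<le> w \<xi>" if "\<xi> \<in> set_pmf (xi_pmf p)" for \<xi>
      unfolding w_def by (rule weight[OF that \<beta>])
    have z1: "xi_expect p (\<lambda>\<xi>. \<beta> \<bullet> K1 s h \<xi>) = 0"
      by (rule expectation_xi_odd[OF p]) (simp add: K1_def matrix_vector_mult_minus)
    have z2: "xi_expect p (\<lambda>\<xi>. ?S \<bullet> K2 s p h \<xi>) = 0"
      unfolding inner_K2 by (simp add: expectation_inner_K2_core[OF p])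
    have w1: "xi_expect p w = 1"
      unfolding w_def by (simp add: int z1 z2)
    have e: "m + h * (\<beta> \<bullet> Zd) = xi_expect p (\<lambda>\<xi>. \<delta> (x + sqrt h *\<^sub>R (s *v \<xi>)) * w \<xi>)"
      unfolding m_def Yd_def Zd_def inner_Dop1[OF p] inner_Dop2[OF p] Dop0_def w_def distrib_left
      by (simp add: Bochner_Integration.integral_add int mult.left_commute[of _ h])
    have "\<delta> v * w \<xi> \<le> \<epsilon> * w \<xi>" "- (\<epsilon> * w \<xi>) \<le> \<delta> v * w \<xi>" if "\<xi> \<in> set_pmf (xi_pmf p)" for \<xi> v
      using mult_right_mono[OF _ w0[OF that], of "\<delta> v" \<epsilon>] mult_right_mono[OF _ w0[OF that], of "- \<epsilon>" "\<delta> v"]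
        \<epsilon>[of v] unfolding \<delta>_def by auto
    hence "m + h * (\<beta> \<bullet> Zd) \<le> xi_expect p (\<lambda>\<xi>. \<epsilon> * w \<xi>)"
      "xi_expect p (\<lambda>\<xi>. - (\<epsilon> * w \<xi>)) \<le> m + h * (\<beta> \<bullet> Zd)"
      unfolding e by - (rule xi_expect_mono[OF p], blast)+
    thus ?thesis using w1 by simp
  qed
  have sg: "norm (Cz *\<^sub>R sgn Zd) \<le> Cz" "norm (- (Cz *\<^sub>R sgn Zd)) \<le> Cz"
    using C0 by (auto simp: norm_sgn)
  have "sgn Zd \<bullet> Zd = norm Zd"
    by (cases "Zd = 0") (simp_all add: sgn_div_norm power2_norm_eq_inner[symmetric] power2_eq_square)
  hence sZ: "(Cz *\<^sub>R sgn Zd) \<bullet> Zd = Cz * norm Zd" by simp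
  \<comment> \<open>Using \<beta> with both signs bounds \<open>m\<close> and the first-order term
    together, with no loss beyond \<open>\<epsilon>\<close>; bounding them separately would leave a
    constant larger than 1 in front of \<open>\<epsilon>\<close>.\<close>
  have mZ: "\<bar>m\<bar> + h * (Cz * norm Zd) \<le> \<epsilon>"
    using key[OF sg(1)] key[OF sg(2)] unfolding inner_minus_left sZ mult_minus_right by linarith
  \<comment> \<open>The coefficient at \<open>?Y\<close> is kept with the difference of the discrete
    Hessians, which goes into the weights; the difference of coefficients meets
    \<open>?\<Gamma>'\<close>, the discrete Hessian of \<open>\<psi>\<close>.\<close>
  have "scheme_step A B s p h \<phi> x - scheme_step A B s p h \<psi> x
      = m + h * ((A ?Y - A ?Y') \<bullet> ?\<Gamma>' + (B ?Y ?Z - B ?Y' ?Z'))"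
    unfolding scheme_step_def m_def G[symmetric] Y[symmetric]
    by (simp add: algebra_simps inner_diff_left inner_diff_right)
  also have "\<bar>\<dots>\<bar> \<le> \<bar>m\<bar> + h * (\<bar>(A ?Y - A ?Y') \<bullet> ?\<Gamma>'\<bar> + \<bar>B ?Y ?Z - B ?Y' ?Z'\<bar>)"
    using h by (intro order_trans[OF abs_triangle_ineq] add_left_mono)
      (simp add: abs_mult abs_triangle_ineq)
  also have "\<dots> \<le> \<bar>m\<bar> + h * (CA * \<epsilon> + (Cy * \<epsilon> + Cz * norm Zd))"
  proof -
    have "\<bar>(A ?Y - A ?Y') \<bullet> ?\<Gamma>'\<bar> \<le> CA * \<epsilon>"
      using A[of ?Y ?Y'] mult_left_mono[OF Yd C0(1)] unfolding Y by linarith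
    moreover have "\<bar>B ?Y ?Z - B ?Y' ?Z'\<bar> \<le> Cy * \<epsilon> + Cz * norm Zd"
      using B[of ?Y ?Z ?Y'] mult_left_mono[OF Yd C0(2)] unfolding Y Z by linarith
    ultimately show ?thesis using h by (intro add_left_mono mult_left_mono add_mono) auto
  qed
  also have "\<dots> = (\<bar>m\<bar> + h * (Cz * norm Zd)) + h * (CA + Cy) * \<epsilon>" by (simp add: algebra_simps)
  also have "\<dots> \<le> \<epsilon> + h * (CA + Cy) * \<epsilon>" using mZ by simp
  finally show ?thesis by (simp add: algebra_simps)
qed

text \<open>\<open>Dop0\<close> produces \<open>h\<close> times half the reference diffusion applied
  to the Hessian, which the subtracted term of \<open>F\<close> cancels up to
  O(\<open>h\<^sup>2\<close>). The equation then cancels the first-order time increment. All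
  remaining errors are O(h) inside the bracket multiplied by \<open>h\<close>.\<close>

lemma scheme_step_consistent:
  fixes A :: "real \<Rightarrow> real^'d^'d" and \<psi> :: "real^'d \<Rightarrow> real"
  assumes h: "0 < h" "h \<le> 1"
    and D0: "\<bar>Dop0 s p h \<psi> x - (\<psi> x + h / 2 * ((s ** transpose s) \<bullet> H))\<bar> \<le> e0 * h\<^sup>2"
    and D1: "norm (Dop1 s p h \<psi> x - g) \<le> e1 * h"
    and D2: "\<And>S. transpose S = S \<Longrightarrow> \<bar>S \<bullet> Dop2 s p h \<psi> x - S \<bullet> H\<bar> \<le> norm S * e2 * h"
    and s: "norm s \<le> N"
    and A: "\<And>y. transpose (A y) = A y" "\<And>y. norm (A y) \<le> MA" "\<And>y y'. norm (A y - A y') \<le> LA * \<bar>y - y'\<bar>"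
    and B: "\<And>y z. \<bar>B y z - B u0 g0\<bar> \<le> Cy * \<bar>y - u0\<bar> + Cz * norm (z - g0)"
    and H: "norm H \<le> M" "norm (H - H0) \<le> M * h" and g: "norm (g - g0) \<le> M * h"
    and \<psi>: "\<bar>\<psi> x - u0\<bar> \<le> M * h" "\<bar>\<psi> x - u0 - h * ut\<bar> \<le> M * h\<^sup>2"
    and pde: "- ut = A u0 \<bullet> H0 + B u0 g0"
    and nonneg: "0 \<le> e0" "0 \<le> e2" "0 \<le> LA" "0 \<le> Cy" "0 \<le> Cz"
  shows "\<bar>scheme_step A B s p h \<psi> x - u0\<bar> \<le>
     (e0 + M + (MA + N\<^sup>2) * e2 + LA * (e0 + N\<^sup>2 * M + M) * M + MA * M
      + Cy * (e0 + N\<^sup>2 * M + M) + Cz * (e1 + M)) * h\<^sup>2"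
proof -
  let ?Y = "Dop0 s p h \<psi> x" and ?Z = "Dop1 s p h \<psi> x" and ?\<Gamma> = "Dop2 s p h \<psi> x"
  define a where "a = second_order_coeff s"
  \<comment> \<open>\<open>k * h\<close> bounds the distance of \<open>Dop0\<close> from
    \<open>u0\<close>: local error, diffusion over one step, and time shift.\<close>
  define k where "k = e0 + N\<^sup>2 * M + M"
  have M0: "0 \<le> M" using order_trans[OF norm_ge_zero H(1)] .
  have MA0: "0 \<le> MA" using order_trans[OF norm_ge_zero A(2)] .
  have k0: "0 \<le> k" using nonneg M0 by (simp add: k_def)
  have a_half: "(1/2) *\<^sub>R (s ** transpose s) = a" by (simp add: a_def second_order_coeff_def)
  have aH: "h / 2 * ((s ** transpose s) \<bullet> H) = h * (a \<bullet> H)" by (simp add: a_half[symmetric])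
  have an: "norm a \<le> N\<^sup>2"
    unfolding a_def by (rule order_trans[OF norm_second_order_coeff_le power_mono[OF s]]) simp
  have hh: "h\<^sup>2 \<le> h" using h by (simp add: power2_eq_square mult_left_le)
  have Yu: "\<bar>?Y - u0\<bar> \<le> k * h"
  proof -
    have "\<bar>a \<bullet> H\<bar> \<le> N\<^sup>2 * M"
      by (rule order_trans[OF Cauchy_Schwarz_ineq2 mult_mono[OF an H(1)]]) auto
    hence "h * \<bar>a \<bullet> H\<bar> \<le> h * (N\<^sup>2 * M)" using h by (intro mult_left_mono) auto
    hence 1: "\<bar>h * (a \<bullet> H)\<bar> \<le> N\<^sup>2 * M * h" using h by (simp add: abs_mult mult_ac)
    have 2: "e0 * h\<^sup>2 \<le> e0 * h" using hh nonneg by (intro mult_left_mono) auto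
    show ?thesis using D0 1 2 \<psi>(1) unfolding k_def aH by (simp add: distrib_right)
  qed
  have Zg: "norm (?Z - g0) \<le> (e1 + M) * h"
    using norm_triangle_ineq[of "?Z - g" "g - g0"] D1 g by (simp add: distrib_right)
  have asym: "transpose (A ?Y - a) = A ?Y - a"
    using A(1)[of ?Y] transpose_second_order_coeff[of s]
    by (simp add: a_def transpose_def vec_eq_iff)
  have "norm (A ?Y - a) \<le> MA + N\<^sup>2"
    using norm_triangle_ineq4[of "A ?Y" a] A(2)[of ?Y] an by linarith
  hence "norm (A ?Y - a) * e2 * h \<le> (MA + N\<^sup>2) * e2 * h"
    using h nonneg by (intro mult_right_mono) auto
  hence t1: "\<bar>(A ?Y - a) \<bullet> ?\<Gamma> - (A ?Y - a) \<bullet> H\<bar> \<le> (MA + N\<^sup>2) * e2 * h"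
    using D2[OF asym] by linarith
  have t2: "\<bar>A ?Y \<bullet> H - A u0 \<bullet> H0\<bar> \<le> LA * (k * h) * M + MA * (M * h)"
  proof -
    have "A ?Y \<bullet> H - A u0 \<bullet> H0 = (A ?Y - A u0) \<bullet> H + A u0 \<bullet> (H - H0)"
      by (simp add: inner_diff_left inner_diff_right)
    also have "\<bar>\<dots>\<bar> \<le> norm (A ?Y - A u0) * norm H + norm (A u0) * norm (H - H0)"
      by (rule order_trans[OF abs_triangle_ineq add_mono[OF Cauchy_Schwarz_ineq2 Cauchy_Schwarz_ineq2]])
    also have "\<dots> \<le> LA * (k * h) * M + MA * (M * h)"
      using order_trans[OF A(3) mult_left_mono[OF Yu nonneg(3)]] nonneg k0 h MA0
      by (intro add_mono mult_mono A(2) H) auto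
    finally show ?thesis .
  qed
  have t3: "\<bar>B ?Y ?Z - B u0 g0\<bar> \<le> Cy * (k * h) + Cz * ((e1 + M) * h)"
    using B[of ?Y ?Z] mult_left_mono[OF Yu nonneg(4)] mult_left_mono[OF Zg nonneg(5)] by linarith
  \<comment> \<open>The errors of the discrete Hessian, of evaluating the second-order term at
    \<open>?Y\<close> and \<open>H\<close> instead of \<open>u0\<close> and \<open>H0\<close>, and
    of the lower-order part.\<close>
  define r where "r = (A ?Y - a) \<bullet> ?\<Gamma> - (A ?Y - a) \<bullet> H + (A ?Y \<bullet> H - A u0 \<bullet> H0) + (B ?Y ?Z - B u0 g0)"
  have "scheme_step A B s p h \<psi> x - u0
     = (?Y - (\<psi> x + h * (a \<bullet> H))) + (\<psi> x - u0 - h * ut) + h * r"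
  proof -
    have "ut = - (A u0 \<bullet> H0 + B u0 g0)" using pde by linarith
    hence "h * ut = - (h * (A u0 \<bullet> H0 + B u0 g0))" by (simp only: mult_minus_right)
    thus ?thesis unfolding scheme_step_def a_half r_def by (simp add: algebra_simps inner_diff_left)
  qed
  moreover have "\<bar>h * r\<bar> \<le> h * ((MA + N\<^sup>2) * e2 * h + (LA * (k * h) * M + MA * (M * h)) + (Cy * (k * h) + Cz * ((e1 + M) * h)))"
    unfolding abs_mult using h t1 t2 t3 by (intro mult_mono) (auto simp: r_def)
  ultimately have "\<bar>scheme_step A B s p h \<psi> x - u0\<bar> \<le> e0 * h\<^sup>2 + M * h\<^sup>2 +
      h * ((MA + N\<^sup>2) * e2 * h + (LA * (k * h) * M + MA * (M * h)) + (Cy * (k * h) + Cz * ((e1 + M) * h)))"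
    using D0 \<psi>(2) unfolding aH by linarith
  thus ?thesis unfolding k_def by (simp add: algebra_simps power2_eq_square)
qed

section \<open>Assembly of the estimates on the solution, and error propagation\<close>

lemma C4b_estimates:
  fixes u :: "real \<Rightarrow> real^'d \<Rightarrow> real"
  assumes u: "C4b T u"
  obtains M C where "0 \<le> M"
    "\<And>t x. t \<in> {0..T} \<Longrightarrow> norm (grad (u t) x) \<le> M"
    "\<And>t x. t \<in> {0..T} \<Longrightarrow> norm (hess (u t) x) \<le> M"
    "\<And>s t x. s \<in> {0..T} \<Longrightarrow> t \<in> {0..T} \<Longrightarrow> \<bar>u s x - u t x\<bar> \<le> M * \<bar>s - t\<bar>"
    "\<And>s t x. s \<in> {0..T} \<Longrightarrow> t \<in> {0..T} \<Longrightarrow> norm (grad (u s) x - grad (u t) x) \<le> M * \<bar>s - t\<bar>"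
    "\<And>s t x. s \<in> {0..T} \<Longrightarrow> t \<in> {0..T} \<Longrightarrow> norm (hess (u s) x - hess (u t) x) \<le> M * \<bar>s - t\<bar>"
    "\<And>s t x. s \<in> {0..T} \<Longrightarrow> t \<in> {0..T} \<Longrightarrow> \<bar>u s x - u t x - (s - t) * dt T u t x\<bar> \<le> M * \<bar>s - t\<bar>\<^sup>2"
    "\<And>t x v. t \<in> {0..T} \<Longrightarrow>
       \<bar>u t (x + v) - u t x - grad (u t) x \<bullet> v - (v \<bullet> (hess (u t) x *v v)) / 2 - C t x v\<bar> \<le> M * norm v ^ 4"
    "\<And>t x v. C t x (- v) = - C t x v"
    "\<And>t x v. t \<in> {0..T} \<Longrightarrow> \<bar>C t x v\<bar> \<le> M * norm v ^ 3"
proof -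
  have u2: "C2b T u" and ut: "C2b T (dt T u)" and ug: "\<And>i. C2b T (\<lambda>t x. grad (u t) x $ i)"
    and uH: "\<And>i j. C2b T (\<lambda>t x. hess (u t) x $ i $ j)"
    using u unfolding C4b_def by blast+
  obtain m1 where m1: "0 \<le> m1" "\<And>t x. t \<in> {0..T} \<Longrightarrow> norm (grad (u t) x) \<le> m1"
    using u2 bounded_strip_obtain[of "\<lambda>t x. grad (u t) x" T] unfolding C2b_def by blast
  obtain m2 where m2: "0 \<le> m2" "\<And>t x. t \<in> {0..T} \<Longrightarrow> norm (hess (u t) x) \<le> m2"
    using u2 bounded_strip_obtain[of "\<lambda>t x. hess (u t) x" T] unfolding C2b_def by blast
  obtain m3 where m3: "0 \<le> m3"
    "\<And>s t x. s \<in> {0..T} \<Longrightarrow> t \<in> {0..T} \<Longrightarrow> \<bar>u s x - u t x\<bar> \<le> m3 * \<bar>s - t\<bar>"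
    using C2b_time_lipschitz[OF u2] by metis
  \<comment> \<open>Gradient and Hessian entries share one index pair, so that a single constant
    covers both; only the first index matters for the gradient.\<close>
  define P where "P ij M \<longleftrightarrow> (\<forall>s\<in>{0..T}. \<forall>t\<in>{0..T}. \<forall>x.
     \<bar>grad (u s) x $ fst ij - grad (u t) x $ fst ij\<bar> \<le> M * \<bar>s - t\<bar> \<and>
     \<bar>hess (u s) x $ fst ij $ snd ij - hess (u t) x $ fst ij $ snd ij\<bar> \<le> M * \<bar>s - t\<bar>)" for ij :: "'d \<times> 'd" and M
  have ex: "\<exists>M\<ge>0. P ij M" for ij
  proof -
    obtain a where a: "0 \<le> a" "\<And>s t x. s \<in> {0..T} \<Longrightarrow> t \<in> {0..T} \<Longrightarrow>
      \<bar>grad (u s) x $ fst ij - grad (u t) x $ fst ij\<bar> \<le> a * \<bar>s - t\<bar>"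
      using C2b_time_lipschitz[OF ug[of "fst ij"]] by metis
    obtain b where b: "0 \<le> b" "\<And>s t x. s \<in> {0..T} \<Longrightarrow> t \<in> {0..T} \<Longrightarrow>
      \<bar>hess (u s) x $ fst ij $ snd ij - hess (u t) x $ fst ij $ snd ij\<bar> \<le> b * \<bar>s - t\<bar>"
      using C2b_time_lipschitz[OF uH[of "fst ij" "snd ij"]] by metis
    have "a * \<bar>s - t\<bar> \<le> (a + b) * \<bar>s - t\<bar>" "b * \<bar>s - t\<bar> \<le> (a + b) * \<bar>s - t\<bar>" for s t :: real
      using a(1) b(1) by (auto intro: mult_right_mono)
    hence "P ij (a + b)" unfolding P_def using a(2) b(2) by (meson order_trans)
    thus ?thesis using a(1) b(1) by (intro exI[of _ "a + b"]) auto
  qed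
  have mono: "P ij M'" if "P ij M" "M \<le> M'" for ij M M'
    using that unfolding P_def by (meson order_trans mult_right_mono abs_ge_zero)
  obtain k where k: "0 \<le> k" "\<And>ij. P ij k"
    by (rule finite_uniform_bound[of P]) (use ex mono in blast)+
  define m4 where "m4 = real CARD('d) * k"
  have m4: "0 \<le> m4" using k by (simp add: m4_def)
  have m4g: "norm (grad (u s) x - grad (u t) x) \<le> m4 * \<bar>s - t\<bar>" if "s \<in> {0..T}" "t \<in> {0..T}" for s t x
  proof -
    have "norm (grad (u s) x - grad (u t) x) \<le> (\<Sum>i\<in>UNIV. \<bar>(grad (u s) x - grad (u t) x) $ i\<bar>)"
      by (rule norm_le_l1_cart)
    also have "\<dots> \<le> (\<Sum>i\<in>(UNIV::'d set). k * \<bar>s - t\<bar>)"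
    proof (rule sum_mono)
      fix i
      show "\<bar>(grad (u s) x - grad (u t) x) $ i\<bar> \<le> k * \<bar>s - t\<bar>"
        using k(2)[of "(i, i)"] that unfolding P_def by simp
    qed
    finally show ?thesis by (simp add: m4_def)
  qed
  have m4h: "norm (hess (u s) x - hess (u t) x) \<le> m4 * \<bar>s - t\<bar>" if "s \<in> {0..T}" "t \<in> {0..T}" for s t x
  proof -
    have "norm (hess (u s) x - hess (u t) x) \<le> real CARD('d) * (k * \<bar>s - t\<bar>)"
    proof (rule norm_matrix_le_card)
      fix i j
      show "\<bar>(hess (u s) x - hess (u t) x) $ i $ j\<bar> \<le> k * \<bar>s - t\<bar>"
        using k(2)[of "(i, j)"] that unfolding P_def by simp
    qed
    thus ?thesis by (simp add: m4_def)
  qed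
  obtain m5 where m5: "0 \<le> m5"
    "\<And>s t x. s \<in> {0..T} \<Longrightarrow> t \<in> {0..T} \<Longrightarrow> \<bar>u s x - u t x - (s - t) * dt T u t x\<bar> \<le> m5 * \<bar>s - t\<bar>\<^sup>2"
    using C2b_time_taylor[OF u2 ut] by metis
  obtain m6 C where m6: "0 \<le> m6"
    and jet: "\<And>t x v. t \<in> {0..T} \<Longrightarrow>
       \<bar>u t (x + v) - u t x - grad (u t) x \<bullet> v - (v \<bullet> (hess (u t) x *v v)) / 2 - C t x v\<bar> \<le> m6 * norm v ^ 4"
    and odd: "\<And>t x v. C t x (- v) = - C t x v"
    and cub: "\<And>t x v. t \<in> {0..T} \<Longrightarrow> \<bar>C t x v\<bar> \<le> m6 * norm v ^ 3"
    using C4b_space_taylor[OF u] by blast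
  define M where "M = m1 + m2 + m3 + m4 + m5 + m6"
  have le: "m1 \<le> M" "m2 \<le> M" "m3 \<le> M" "m4 \<le> M" "m5 \<le> M" "m6 \<le> M" "0 \<le> M"
    using m1(1) m2(1) m3(1) m4 m5(1) m6 by (auto simp: M_def)
  show ?thesis
    using that[of M C, OF le(7) order_trans[OF m1(2) le(1)] order_trans[OF m2(2) le(2)]
      order_trans[OF m3(2) mult_right_mono[OF le(3) abs_ge_zero]]
      order_trans[OF m4g mult_right_mono[OF le(4) abs_ge_zero]]
      order_trans[OF m4h mult_right_mono[OF le(4) abs_ge_zero]]
      order_trans[OF m5(2) mult_right_mono[OF le(5) zero_le_power2]]
      order_trans[OF jet mult_right_mono[OF le(6) zero_le_power[OF norm_ge_zero]]] odd
      order_trans[OF cub mult_right_mono[OF le(6) zero_le_power[OF norm_ge_zero]]]] .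
qed

text \<open>A discrete Gronwall argument backwards from the terminal time. A time off the grid is
  reached by one step shorter than \<open>h\<close> from the next grid point, so it obeys the same
  bound.\<close>

lemma approx_solution_error:
  fixes u v :: "real \<Rightarrow> real^'d \<Rightarrow> real"
  assumes T: "0 < T" and n: "n \<ge> 1" and v: "approx_solution T G \<sigma>0 p g n v"
    and uT: "\<And>x. u T x = g x" and C: "0 \<le> C" and h0: "T / real n \<le> h0"
    and step: "\<And>t h \<phi> \<epsilon> x. 0 \<le> t \<Longrightarrow> 0 < h \<Longrightarrow> h \<le> h0 \<Longrightarrow> t + h \<le> T \<Longrightarrow>
      (\<And>y. \<bar>\<phi> y - u (t + h) y\<bar> \<le> \<epsilon>) \<Longrightarrow>
      \<bar>T_op G \<sigma>0 p t h \<phi> x - u t x\<bar> \<le> (1 + C * h) * \<epsilon> + C * h\<^sup>2"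
    and t: "t \<in> {0..T}"
  shows "\<bar>v t x - u t x\<bar> \<le> exp (C * T) * (T / real n)"
proof -
  define h where "h = T / real n"
  define tm where "tm i = real i * h" for i
  \<comment> \<open>The exact solution of the error recursion
    \<open>E (Suc k) = (1 + C * h) * E k + C * h\<^sup>2\<close> with \<open>E 0 = 0\<close>; it is
    at most \<open>exp (C * T) * h\<close> for \<open>k \<le> n\<close>.\<close>
  define E where "E k = h * ((1 + C * h) ^ k - 1)" for k
  have h: "0 < h" using T n by (simp add: h_def)
  have tmT: "tm n = T" using n by (simp add: tm_def h_def)
  have vT: "v (tm n) = g" using v unfolding approx_solution_def Let_def tm_def h_def by simp
  have E0: "0 \<le> E k" for k
    using C h by (simp add: E_def one_le_power)
  have ES: "(1 + C * h) * E k + C * h\<^sup>2 = E (Suc k)" for k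
    by (simp add: E_def algebra_simps power2_eq_square)
  have E_le: "E k \<le> exp (C * T) * h" if "k \<le> n" for k
  proof -
    have "(1 + C * h) ^ k \<le> exp (C * h) ^ k"
      using C h by (intro power_mono exp_ge_add_one_self) auto
    also have "\<dots> = exp (real k * (C * h))" by (simp add: exp_of_nat_mult)
    also have "\<dots> \<le> exp (C * T)"
    proof -
      have "real k * h \<le> real n * h" using that h by (intro mult_right_mono) auto
      hence "C * (real k * h) \<le> C * T" using C tmT by (intro mult_left_mono) (auto simp: tm_def)
      thus ?thesis by (simp add: mult_ac)
    qed
    finally show ?thesis using h by (simp add: E_def mult.commute[of _ h])
  qed
  have local_step: "\<bar>v t x - u t x\<bar> \<le> E (Suc k)"
    if i: "i < n" and t: "t \<in> {tm i..<tm (Suc i)}"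
      and IH: "\<And>y. \<bar>v (tm (Suc i)) y - u (tm (Suc i)) y\<bar> \<le> E k" for i t x k
  proof -
    let ?h = "tm (Suc i) - t"
    have "\<forall>i\<in>{1..n}. \<forall>t\<in>{tm (i - 1)..<tm i}. v t = T_op G \<sigma>0 p t (tm i - t) (v (tm i))"
      using v unfolding approx_solution_def Let_def tm_def h_def by blast
    from bspec[OF this, of "Suc i"] i t have vt: "v t = T_op G \<sigma>0 p t ?h (v (tm (Suc i)))" by simp
    have hh: "0 < ?h" "?h \<le> h" using t by (auto simp: tm_def algebra_simps)
    have "real (Suc i) * h \<le> real n * h" using i h by (intro mult_right_mono) auto
    hence le: "tm (Suc i) \<le> T" using tmT by (simp add: tm_def)
    have t0: "0 \<le> t" using t h by (auto simp: tm_def intro: order_trans[rotated])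
    have "\<bar>v t x - u t x\<bar> \<le> (1 + C * ?h) * E k + C * ?h\<^sup>2"
      unfolding vt by (rule step) (use t0 hh h0 le IH h_def in auto)
    also have "\<dots> \<le> (1 + C * h) * E k + C * h\<^sup>2"
      using hh C E0 by (intro add_mono mult_right_mono mult_left_mono power_mono) auto
    finally show ?thesis by (simp add: ES)
  qed
  have layer: "\<forall>x. \<bar>v (tm i) x - u (tm i) x\<bar> \<le> E (n - i)" if "i \<le> n" for i
    using that
  proof (induction rule: inc_induct)
    case base
    show ?case using vT uT tmT by (simp add: E_def)
  next
    case (step i)
    have "tm i \<in> {tm i..<tm (Suc i)}" using h by (simp add: tm_def)
    from local_step[OF step(2) this, of "n - Suc i"] step(3)
    have "\<bar>v (tm i) x - u (tm i) x\<bar> \<le> E (Suc (n - Suc i))" for x by blast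
    thus ?case using step(2) by (simp add: Suc_diff_Suc)
  qed
  show ?thesis
  \<comment> \<open>The half-open time intervals do not contain the terminal time, where the error
    is zero.\<close>
  proof (cases "t = T")
    case True
    have "0 \<le> exp (C * T) * h" using h by simp
    with True show ?thesis using vT uT tmT by (simp add: h_def)
  next
    case False
    define i where "i = nat \<lfloor>t / h\<rfloor>"
    have "0 \<le> t / h" using t h by simp
    hence "real i \<le> t / h" "t / h < real i + 1" by (auto simp: i_def)
    hence ti: "t \<in> {tm i..<tm (Suc i)}" using h by (auto simp: tm_def field_simps)
    have "tm i < tm n" using ti t False tmT by auto
    hence i: "i < n" using h by (simp add: tm_def)
    have "\<bar>v t x - u t x\<bar> \<le> E (Suc (n - Suc i))"
      using local_step[OF i ti, of "n - Suc i"] layer[of "Suc i"] i by auto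
    also have "\<dots> \<le> exp (C * T) * h" using i by (intro E_le) simp
    finally show ?thesis by (simp add: h_def)
  qed
qed

lemma lipschitz_on_UNIV_snd:
  fixes w :: "'a::metric_space \<Rightarrow> real \<Rightarrow> 'b::real_normed_vector"
  assumes "L-lipschitz_on UNIV (\<lambda>(x, y). w x y)"
  shows "norm (w x y - w x y') \<le> L * \<bar>y - y'\<bar>"
  using lipschitz_onD[OF assms, of "(x, y)" "(x, y')"] by (simp add: dist_Pair_Pair dist_norm)

lemma lipschitz_on_UNIV_snd_snd:
  fixes w :: "'a::metric_space \<Rightarrow> real \<Rightarrow> 'c::real_normed_vector \<Rightarrow> 'b::real_normed_vector"
  assumes "L-lipschitz_on UNIV (\<lambda>(x, y, z). w x y z)"
  shows "norm (w x y z - w x y' z') \<le> L * (\<bar>y - y'\<bar> + norm (z - z'))"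
proof -
  have "norm (w x y z - w x y' z') \<le> L * dist (x, y, z) (x, y', z')"
    using lipschitz_onD[OF assms, of "(x, y, z)" "(x, y', z')"] by (simp add: dist_norm)
  also have "dist (x, y, z) (x, y', z') \<le> \<bar>y - y'\<bar> + norm (z - z')"
    using sqrt_sum_squares_le_sum[of "\<bar>y - y'\<bar>" "norm (z - z')"]
    by (simp add: dist_Pair_Pair dist_norm norm_Pair)
  finally show ?thesis using lipschitz_on_nonneg[OF assms] by (simp add: mult_left_mono)
qed

text \<open>The point is uniformity: all constants are fixed before \<open>t\<close>,
  \<open>x\<close>, \<open>h\<close>, \<open>\<phi>\<close> and \<open>\<epsilon>\<close>, so that
  the one-step estimate can be iterated over any number of layers.\<close>

lemma scheme_one_step:
  fixes T :: real
    and \<sigma> :: "real \<Rightarrow> real^'d \<Rightarrow> real \<Rightarrow> real^'m^'d"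
    and b :: "real \<Rightarrow> real^'d \<Rightarrow> real \<Rightarrow> real^'m \<Rightarrow> real^'d"
    and f :: "real \<Rightarrow> real^'d \<Rightarrow> real \<Rightarrow> real^'m \<Rightarrow> real"
    and u :: "real \<Rightarrow> real^'d \<Rightarrow> real"
  assumes T: "0 < T"
    and bs: "bounded ((\<lambda>(t, x, y). \<sigma> t x y) ` ({0..T} \<times> UNIV))"
    and bb: "bounded ((\<lambda>(t, x, y, z). b t x y z) ` ({0..T} \<times> UNIV))"
    and ls: "\<exists>L. \<forall>t\<in>{0..T}. L-lipschitz_on UNIV (\<lambda>(x, y). \<sigma> t x y)"
    and lb: "\<exists>L. \<forall>t\<in>{0..T}. L-lipschitz_on UNIV (\<lambda>(x, y, z). b t x y z)"
    and lf: "\<exists>L. \<forall>t\<in>{0..T}. L-lipschitz_on UNIV (\<lambda>(x, y, z). f t x y z)"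
    and M: "satisfies_M T (quasilinear_G \<sigma> b f) \<sigma>0 p"
    and sol: "classical_solution T (quasilinear_G \<sigma> b f) g u" and u: "C4b T u"
  shows "\<exists>C h0. 0 < h0 \<and> 0 \<le> C \<and> (\<forall>t h \<phi> \<epsilon> x. 0 \<le> t \<longrightarrow> 0 < h \<longrightarrow> h \<le> h0 \<longrightarrow> t + h \<le> T \<longrightarrow>
      (\<forall>y. \<bar>\<phi> y - u (t + h) y\<bar> \<le> \<epsilon>) \<longrightarrow>
      \<bar>T_op (quasilinear_G \<sigma> b f) \<sigma>0 p t h \<phi> x - u t x\<bar> \<le> (1 + C * h) * \<epsilon> + C * h\<^sup>2)"
proof -
  let ?G = "quasilinear_G \<sigma> b f" and ?d = "real CARD('d)"
  obtain Ms where Ms: "0 \<le> Ms" "\<And>t x y. t \<in> {0..T} \<Longrightarrow> norm (\<sigma> t x y) \<le> Ms"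
    using bounded_strip_obtain[of "\<lambda>t (x, y). \<sigma> t x y" T, OF bs] by (metis case_prod_conv)
  obtain Mb where Mb: "0 \<le> Mb" "\<And>t x y z. t \<in> {0..T} \<Longrightarrow> norm (b t x y z) \<le> Mb"
    using bounded_strip_obtain[of "\<lambda>t (x, y, z). b t x y z" T, OF bb] by (metis case_prod_conv)
  define Mc where "Mc = Ms + Mb"
  have Mc: "norm (\<sigma> t x y) \<le> Mc" "norm (b t x y z) \<le> Mc" if "t \<in> {0..T}" for t x y z
    using Ms(1) Mb(1) Ms(2)[OF that, of x y] Mb(2)[OF that, of x y z] by (auto simp: Mc_def)
  have Mc0: "0 \<le> Mc" using Ms Mb by (simp add: Mc_def)
  obtain Ls where Ls: "\<And>t. t \<in> {0..T} \<Longrightarrow> Ls-lipschitz_on UNIV (\<lambda>(x, y). \<sigma> t x y)" using ls by blast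
  obtain Lb where Lb: "\<And>t. t \<in> {0..T} \<Longrightarrow> Lb-lipschitz_on UNIV (\<lambda>(x, y, z). b t x y z)" using lb by blast
  obtain Lf where Lf: "\<And>t. t \<in> {0..T} \<Longrightarrow> Lf-lipschitz_on UNIV (\<lambda>(x, y, z). f t x y z)" using lf by blast
  have T0: "0 \<in> {0..T}" using T by simp
  have L3: "0 \<le> Ls" "0 \<le> Lb" "0 \<le> Lf"
    using lipschitz_on_nonneg[OF Ls[OF T0]] lipschitz_on_nonneg[OF Lb[OF T0]] lipschitz_on_nonneg[OF Lf[OF T0]] by auto
  define L where "L = Ls + Lb + Lf"
  have L0: "0 \<le> L" and Lle: "Ls \<le> L" "Lb \<le> L" "Lf \<le> L" using L3 by (auto simp: L_def)
  have Lsig: "norm (\<sigma> t x y - \<sigma> t x y') \<le> L * \<bar>y - y'\<bar>" if "t \<in> {0..T}" for t x y y'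
    by (rule order_trans[OF lipschitz_on_UNIV_snd[OF Ls[OF that]] mult_right_mono[OF Lle(1)]]) simp
  have Lbb: "norm (b t x y w - b t x y' w') \<le> L * (\<bar>y - y'\<bar> + norm (w - w'))" if "t \<in> {0..T}" for t x y w y' w'
    by (rule order_trans[OF lipschitz_on_UNIV_snd_snd[OF Lb[OF that]] mult_right_mono[OF Lle(2)]]) simp
  have Lff: "\<bar>f t x y w - f t x y' w'\<bar> \<le> L * (\<bar>y - y'\<bar> + norm (w - w'))" if "t \<in> {0..T}" for t x y w y' w'
    using order_trans[OF lipschitz_on_UNIV_snd_snd[OF Lf[OF that]] mult_right_mono[OF Lle(3)], of y y' w w' x] by simp

  have sd: "scheme_data T \<sigma>0 p" and M1: "assumption_M1 T ?G \<sigma>0" and M2: "assumption_M2 T ?G \<sigma>0 p"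
    using M unfolding satisfies_M_def by blast+
  obtain n1 where n1: "0 \<le> n1" "\<And>t x. t \<in> {0..T} \<Longrightarrow> norm (\<sigma>0 t x) \<le> n1"
    using sd bounded_strip_obtain[of "\<lambda>t x. \<sigma>0 t x" T] unfolding scheme_data_def by blast
  obtain n2 where n2: "0 \<le> n2" "\<And>t x. t \<in> {0..T} \<Longrightarrow> norm (matrix_inv (\<sigma>0 t x)) \<le> n2"
    using sd bounded_strip_obtain[of "\<lambda>t x. matrix_inv (\<sigma>0 t x)" T] unfolding scheme_data_def by blast
  obtain n3 where n3: "0 \<le> n3" "\<And>t x. t \<in> {0..T} \<Longrightarrow> norm (inverse (p t x)) \<le> n3"
    using sd bounded_strip_obtain[of "\<lambda>t x. inverse (p t x)" T] unfolding scheme_data_def by blast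
  define N where "N = n1 + n2 + n3"
  have N0: "0 \<le> N" using n1 n2 n3 by (simp add: N_def)
  have N: "norm (\<sigma>0 t x) \<le> N" "norm (matrix_inv (\<sigma>0 t x)) \<le> N" "1 / p t x \<le> N" if "t \<in> {0..T}" for t x
    using n1(1) n2(1) n3(1) n1(2)[OF that, of x] n2(2)[OF that, of x] n3(2)[OF that, of x]
      abs_ge_self[of "inverse (p t x)"]
    unfolding N_def divide_inverse real_norm_def by linarith+
  have inv: "invertible (\<sigma>0 t x)" and p0: "0 < p t x" "p t x < 1" if "t \<in> {0..T}" for t x
    using sd that unfolding scheme_data_def by auto
  have p3: "p t x \<le> 1/3" if "t \<in> {0..T}" for t x
  proof -
    have "p t x \<in> p_range ?G \<sigma>0 t x" using M2 that unfolding assumption_M2_def by blast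
    thus ?thesis unfolding p_range_def Let_def by simp
  qed
  \<comment> \<open>(M2) at a single point bounds \<open>lambda_star\<close> above by a real number,
    and (M1) bounds it below by 0.\<close>
  obtain l where l: "lambda_star T ?G \<sigma>0 = ereal l" "0 < l"
  proof -
    have "lambda_star T ?G \<sigma>0 / 2 \<le> ereal (lambda_p ?G \<sigma>0 0 0 (p 0 0))"
      using M2 T0 unfolding assumption_M2_def by blast
    moreover have "0 < lambda_star T ?G \<sigma>0" using M1 unfolding assumption_M1_def by blast
    ultimately have "\<bar>lambda_star T ?G \<sigma>0\<bar> \<noteq> \<infinity>" by auto
    then obtain l where "lambda_star T ?G \<sigma>0 = ereal l" by auto
    with \<open>0 < lambda_star T ?G \<sigma>0\<close> show ?thesis using that by simp
  qed
  have th2: "theta ?G \<sigma>0 t x \<le> 2" if "t \<in> {0..T}" for t x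
    using M1 that unfolding assumption_M1_def by blast

  obtain Mu C3 where Mu: "0 \<le> Mu"
    and ug: "\<And>t x. t \<in> {0..T} \<Longrightarrow> norm (grad (u t) x) \<le> Mu"
    and uH: "\<And>t x. t \<in> {0..T} \<Longrightarrow> norm (hess (u t) x) \<le> Mu"
    and tu: "\<And>s t x. s \<in> {0..T} \<Longrightarrow> t \<in> {0..T} \<Longrightarrow> \<bar>u s x - u t x\<bar> \<le> Mu * \<bar>s - t\<bar>"
    and tg: "\<And>s t x. s \<in> {0..T} \<Longrightarrow> t \<in> {0..T} \<Longrightarrow> norm (grad (u s) x - grad (u t) x) \<le> Mu * \<bar>s - t\<bar>"
    and tH: "\<And>s t x. s \<in> {0..T} \<Longrightarrow> t \<in> {0..T} \<Longrightarrow> norm (hess (u s) x - hess (u t) x) \<le> Mu * \<bar>s - t\<bar>"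
    and tt: "\<And>s t x. s \<in> {0..T} \<Longrightarrow> t \<in> {0..T} \<Longrightarrow> \<bar>u s x - u t x - (s - t) * dt T u t x\<bar> \<le> Mu * \<bar>s - t\<bar>\<^sup>2"
    and jet: "\<And>t x v. t \<in> {0..T} \<Longrightarrow>
       \<bar>u t (x + v) - u t x - grad (u t) x \<bullet> v - (v \<bullet> (hess (u t) x *v v)) / 2 - C3 t x v\<bar> \<le> Mu * norm v ^ 4"
    and odd: "\<And>t x v. C3 t x (- v) = - C3 t x v"
    and cub: "\<And>t x v. t \<in> {0..T} \<Longrightarrow> \<bar>C3 t x v\<bar> \<le> Mu * norm v ^ 3"
    using C4b_estimates[OF u] by blast

  \<comment> \<open>\<open>Rx\<close> bounds the increments \<xi> and \<open>\<rho>\<close> their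
    images under \<sigma>0, uniformly in \<open>(t, x)\<close>.\<close>
  define Rx where "Rx = sqrt (?d * N)"
  define \<rho> where "\<rho> = N * Rx"
  define e0 where "e0 = Mu * \<rho>^4"
  define e1 where "e1 = Mu * (\<rho>^3 + \<rho>^4) * (N * Rx)"
  define e2 where "e2 = Mu * \<rho>^4 * (N\<^sup>2 * (6 * ?d * N))"
  \<comment> \<open>For \<open>h \<le> 1\<close> this bounds both the gradient of the solution and
    its discrete gradient, the two vectors that play the role of \<open>z'\<close> in
    \<open>lower_order_part_lipschitz\<close>.\<close>
  define R where "R = Mu + e1"
  define Cy where "Cy = (R + 1) * L * (1 + L * R)"
  define Cz where "Cz = Mc + (R + 1) * L * Mc"
  define CA where "CA = Mc * L * (Mu + e2)"
  define MA where "MA = Mc\<^sup>2"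
  define LA where "LA = Mc * L"
  define K where "K = e0 + Mu + (MA + N\<^sup>2) * e2 + LA * (e0 + N\<^sup>2 * Mu + Mu) * Mu + MA * Mu
      + Cy * (e0 + N\<^sup>2 * Mu + Mu) + Cz * (e1 + Mu)"
  \<comment> \<open>Chosen so that \<open>sqrt h * (Cz * sqrt d) \<le> l / 2\<close>; the added 1
    keeps the denominator positive when \<open>Cz = 0\<close>.\<close>
  define h0 where "h0 = min 1 ((l / (2 * (Cz * sqrt ?d + 1)))\<^sup>2)"
  have nn: "0 \<le> Rx" "0 \<le> \<rho>" "0 \<le> e0" "0 \<le> e1" "0 \<le> e2" "0 \<le> R"
    using N0 Mu by (simp_all add: Rx_def \<rho>_def e0_def e1_def e2_def R_def)
  have nn2: "0 \<le> Cy" "0 \<le> Cz" "0 \<le> CA" "0 \<le> MA" "0 \<le> LA"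
    using nn Mu L0 Mc0 by (simp_all add: Cy_def Cz_def CA_def MA_def LA_def)
  have nn3: "0 \<le> K"
    using nn nn2 Mu by (simp add: K_def)
  have "0 < Cz * sqrt ?d + 1" using nn2 by (intro add_nonneg_pos) auto
  hence q0: "0 < l / (2 * (Cz * sqrt ?d + 1))" using l by simp
  have h00: "0 < h0"
    unfolding h0_def min_less_iff_conj by (intro conjI zero_less_one zero_less_power[OF q0])
  have h0sqrt: "sqrt h * (Cz * sqrt ?d) \<le> l / 2" if "0 < h" "h \<le> h0" for h
  proof -
    have "sqrt h \<le> sqrt ((l / (2 * (Cz * sqrt ?d + 1)))\<^sup>2)"
      using that unfolding h0_def by (intro real_sqrt_le_mono) simp
    hence "sqrt h \<le> l / (2 * (Cz * sqrt ?d + 1))" unfolding real_sqrt_abs abs_of_pos[OF q0] .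
    hence "sqrt h * (2 * (Cz * sqrt ?d + 1)) \<le> l"
      using \<open>0 < Cz * sqrt ?d + 1\<close> by (simp add: pos_le_divide_eq)
    hence "2 * (sqrt h * (Cz * sqrt ?d)) + 2 * sqrt h \<le> l" by (simp add: algebra_simps)
    moreover have "0 \<le> sqrt h" using that by simp
    ultimately show ?thesis by linarith
  qed

  have main: "\<bar>T_op ?G \<sigma>0 p t h \<phi> x - u t x\<bar> \<le> (1 + h * (CA + Cy)) * \<epsilon> + K * h\<^sup>2"
    if t0: "0 \<le> t" and h: "0 < h" "h \<le> h0" and thT: "t + h \<le> T"
      and \<epsilon>: "\<And>y. \<bar>\<phi> y - u (t + h) y\<bar> \<le> \<epsilon>" for t h \<phi> \<epsilon> x
  proof -
    have t: "t \<in> {0..T}" and th: "t + h \<in> {0..T}" and tT: "t < T" using t0 h thT by auto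
    have h1: "h \<le> 1" using h(2) by (simp add: h0_def)
    let ?s = "\<sigma>0 t x" and ?p = "p t x" and ?\<psi> = "u (t + h)"
    let ?A = "\<lambda>y. second_order_coeff (\<sigma> t x y)"
    let ?B = "lower_order_part (\<sigma> t x) (b t x) (f t x)"
    note pp = p0[OF t, of x] and pp3 = p3[OF t, of x] and NN = N[OF t, of x] and si = inv[OF t, of x]
    have \<xi>R: "norm \<xi> \<le> Rx" if "\<xi> \<in> set_pmf (xi_pmf ?p)" for \<xi> :: "real^'d"
    proof -
      have "sqrt (?d / ?p) \<le> sqrt (?d * N)"
        using mult_left_mono[OF NN(3), of ?d] by (intro real_sqrt_le_mono) simp
      with norm_xi_le[OF pp that] show ?thesis unfolding Rx_def by (rule order_trans)
    qed
    have \<xi>\<rho>: "norm (?s *v \<xi>) \<le> \<rho>" if "\<xi> \<in> set_pmf (xi_pmf ?p)" for \<xi>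
      unfolding \<rho>_def
      by (rule order_trans[OF norm_matrix_vector_mult_le mult_mono[OF NN(1) \<xi>R[OF that] N0 norm_ge_zero]])
    have D0: "\<bar>Dop0 ?s ?p h ?\<psi> x - (?\<psi> x + h / 2 * ((?s ** transpose ?s) \<bullet> hess ?\<psi> x))\<bar> \<le> e0 * h\<^sup>2"
      unfolding e0_def by (rule Dop0_consistency[OF pp less_imp_le[OF h(1)] Mu jet[OF th] odd \<xi>\<rho>])
    have D1: "norm (Dop1 ?s ?p h ?\<psi> x - grad ?\<psi> x) \<le> e1 * h"
    proof -
      have "norm (Dop1 ?s ?p h ?\<psi> x - grad ?\<psi> x) \<le> Mu * (\<rho>^3 + \<rho>^4) * (norm (matrix_inv ?s) * Rx) * h"
        by (rule Dop1_consistency[OF pp h(1) h1 Mu jet[OF th] cub[OF th] si \<xi>\<rho> nn(2) \<xi>R nn(1)])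
      also have "\<dots> \<le> e1 * h"
        unfolding e1_def using h nn Mu NN(2)
        by (intro mult_right_mono mult_left_mono) auto
      finally show ?thesis .
    qed
    have D2: "\<bar>S \<bullet> Dop2 ?s ?p h ?\<psi> x - S \<bullet> hess ?\<psi> x\<bar> \<le> norm S * e2 * h" if S: "transpose S = S" for S
    proof -
      have "\<bar>S \<bullet> Dop2 ?s ?p h ?\<psi> x - S \<bullet> hess ?\<psi> x\<bar>
          \<le> norm S * (Mu * \<rho>^4 * ((norm (matrix_inv ?s))\<^sup>2 * (6 * ?d / ?p))) * h"
        by (rule Dop2_consistency[OF pp(1) pp3 h(1) Mu jet[OF th] odd si S \<xi>\<rho>])
      also have "\<dots> \<le> norm S * e2 * h"
      proof -
        have "6 * ?d / ?p \<le> 6 * ?d * N" using mult_left_mono[OF NN(3), of "6 * ?d"] by simp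
        moreover have "(norm (matrix_inv ?s))\<^sup>2 \<le> N\<^sup>2" by (intro power_mono NN) auto
        ultimately have "(norm (matrix_inv ?s))\<^sup>2 * (6 * ?d / ?p) \<le> N\<^sup>2 * (6 * ?d * N)"
          using pp by (intro mult_mono) auto
        thus ?thesis unfolding e2_def using h Mu nn by (intro mult_right_mono mult_left_mono) auto
      qed
      finally show ?thesis .
    qed
    have Asym: "transpose (?A y) = ?A y" for y by (rule transpose_second_order_coeff)
    have AM: "norm (?A y) \<le> MA" for y
      unfolding MA_def by (rule order_trans[OF norm_second_order_coeff_le power_mono[OF Mc(1)[OF t]]]) simp
    have AL: "norm (?A y - ?A y') \<le> LA * \<bar>y - y'\<bar>" for y y'
      using order_trans[OF second_order_coeff_lipschitz[OF Mc(1)[OF t] Mc(1)[OF t]] mult_left_mono[OF Lsig[OF t] Mc0]]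
      unfolding LA_def mult.assoc .
    have BL: "\<bar>?B y z - ?B y' z'\<bar> \<le> Cy * \<bar>y - y'\<bar> + Cz * norm (z - z')" if "norm z' \<le> R" for y z y' z'
      unfolding Cy_def Cz_def
      by (rule lower_order_part_lipschitz[OF Mc(1)[OF t] Mc(2)[OF t] L0 Lsig[OF t] Lbb[OF t] Lff[OF t] that])
    have abs_h: "\<bar>t + h - t\<bar> = h" using h by simp
    have pde: "- dt T u t x = ?A (u t x) \<bullet> hess (u t) x + ?B (u t x) (grad (u t) x)"
    proof -
      have "- dt T u t x - ?G t x (u t x) (grad (u t) x) (hess (u t) x) = 0"
        using sol t0 tT unfolding classical_solution_def by simp
      thus ?thesis unfolding quasilinear_G_eq by linarith
    qed
    have gR: "norm (grad (u t) x) \<le> R" using ug[OF t, of x] nn by (simp add: R_def)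
    have cons: "\<bar>scheme_step ?A ?B ?s ?p h ?\<psi> x - u t x\<bar> \<le> K * h\<^sup>2"
      unfolding K_def
    proof (rule scheme_step_consistent[OF h(1) h1 D0 D1 D2 NN(1) Asym AM AL BL[OF gR] uH[OF th]])
      show "norm (hess ?\<psi> x - hess (u t) x) \<le> Mu * h" using tH[OF th t, of x] unfolding abs_h .
      show "norm (grad ?\<psi> x - grad (u t) x) \<le> Mu * h" using tg[OF th t, of x] unfolding abs_h .
      show "\<bar>?\<psi> x - u t x\<bar> \<le> Mu * h" using tu[OF th t, of x] unfolding abs_h .
      show "\<bar>?\<psi> x - u t x - h * dt T u t x\<bar> \<le> Mu * h\<^sup>2" using tt[OF th t, of x] unfolding abs_h by simp
    qed (use pde nn nn2 in auto)
    have ZR: "norm (Dop1 ?s ?p h ?\<psi> x) \<le> R"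
    proof -
      have "e1 * h \<le> e1" using nn h1 by (simp add: mult_left_le)
      thus ?thesis
        using D1 ug[OF th, of x] norm_triangle_ineq[of "Dop1 ?s ?p h ?\<psi> x - grad ?\<psi> x" "grad ?\<psi> x"]
        by (simp add: R_def)
    qed
    have CAb: "\<bar>(?A y - ?A y') \<bullet> Dop2 ?s ?p h ?\<psi> x\<bar> \<le> CA * \<bar>y - y'\<bar>" for y y'
    proof -
      let ?S = "?A y - ?A y'"
      \<comment> \<open>The discrete Hessian is controlled when paired with symmetric matrices, and
        a difference of coefficients is one; this avoids bounding its norm.\<close>
      have "transpose ?S = ?S" using Asym[of y] Asym[of y'] by (simp add: transpose_def vec_eq_iff)
      hence "\<bar>?S \<bullet> Dop2 ?s ?p h ?\<psi> x - ?S \<bullet> hess ?\<psi> x\<bar> \<le> norm ?S * e2 * h" by (rule D2)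
      also have "\<dots> \<le> norm ?S * e2" using nn h1 by (intro mult_left_le) auto
      finally have "\<bar>?S \<bullet> Dop2 ?s ?p h ?\<psi> x - ?S \<bullet> hess ?\<psi> x\<bar> \<le> norm ?S * e2" .
      moreover have "\<bar>?S \<bullet> hess ?\<psi> x\<bar> \<le> norm ?S * Mu"
        by (rule order_trans[OF Cauchy_Schwarz_ineq2 mult_left_mono[OF uH[OF th]]]) simp
      ultimately have "\<bar>?S \<bullet> Dop2 ?s ?p h ?\<psi> x\<bar> \<le> norm ?S * (Mu + e2)"
        unfolding distrib_left by linarith
      also have "\<dots> \<le> (LA * \<bar>y - y'\<bar>) * (Mu + e2)" using Mu nn by (intro mult_right_mono AL) auto
      finally show ?thesis by (simp add: CA_def LA_def mult_ac)
    qed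
    have weight: "0 \<le> 1 + h * ((?A y - (1/2) *\<^sub>R (?s ** transpose ?s)) \<bullet> K2 ?s ?p h \<xi>) + h * (\<beta> \<bullet> K1 ?s h \<xi>)"
      if \<xi>: "\<xi> \<in> set_pmf (xi_pmf ?p)" and \<beta>: "norm \<beta> \<le> Cz" for y \<xi> \<beta>
    proof -
      let ?P = "norm (matrix_inv ?s)"
      let ?w = "1 + h * ((?A y - (1/2) *\<^sub>R (?s ** transpose ?s)) \<bullet> K2 ?s ?p h \<xi>)"
      have w: "l / 2 * ?P / sqrt ?p \<le> (1 - ?p) * ?w"
        unfolding second_order_coeff_def
        by (rule scheme_weight_ge[OF sd M2 th2[OF t] l(1) t Ms(2)[OF t] \<xi> h(1)])
      have "0 \<le> l / 2 * ?P / sqrt ?p" using l pp by simp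
      hence "0 \<le> (1 - ?p) * ?w" using w by linarith
      hence "0 \<le> ?w" using pp by (simp add: zero_le_mult_iff)
      hence "0 \<le> ?p * ?w" using pp by (intro mult_nonneg_nonneg) auto
      hence "(1 - ?p) * ?w \<le> ?w" by (simp only: left_diff_distrib mult_1_left)
      with w have w': "l / 2 * ?P / sqrt ?p \<le> ?w" by linarith
      have "\<bar>\<beta> \<bullet> K1 ?s h \<xi>\<bar> \<le> norm \<beta> * (?P * sqrt (?d / ?p)) / sqrt h"
        by (rule inner_K1_le[OF h(1) norm_xi_le[OF pp \<xi>]])
      also have "\<dots> \<le> Cz * (?P * sqrt (?d / ?p)) / sqrt h"
        using h pp \<beta> by (intro divide_right_mono mult_right_mono) auto
      finally have "h * \<bar>\<beta> \<bullet> K1 ?s h \<xi>\<bar> \<le> h * (Cz * (?P * sqrt (?d / ?p)) / sqrt h)"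
        using h by (intro mult_left_mono) auto
      also have "\<dots> = (h / sqrt h) * (Cz * (?P * sqrt (?d / ?p)))" by simp
      also have "h / sqrt h = sqrt h" using h by (simp add: real_div_sqrt)
      \<comment> \<open>The factor \<open>?P / sqrt ?p\<close> is separated off: it also occurs in
        the lower bound \<open>w'\<close>, so the comparison involves only \<open>h\<close>,
        \<open>Cz\<close>, the dimension and \<open>l\<close>.\<close>
      also have "sqrt h * (Cz * (?P * sqrt (?d / ?p))) = (sqrt h * (Cz * sqrt ?d)) * (?P / sqrt ?p)"
        by (simp add: real_sqrt_divide)
      also have "\<dots> \<le> l / 2 * (?P / sqrt ?p)"
        using pp by (intro mult_right_mono h0sqrt h) auto
      finally have "h * \<bar>\<beta> \<bullet> K1 ?s h \<xi>\<bar> \<le> ?w" using w' by simp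
      moreover have "- (h * \<bar>\<beta> \<bullet> K1 ?s h \<xi>\<bar>) \<le> h * (\<beta> \<bullet> K1 ?s h \<xi>)"
        using mult_left_mono[of "- \<bar>\<beta> \<bullet> K1 ?s h \<xi>\<bar>" "\<beta> \<bullet> K1 ?s h \<xi>" h] h by simp
      ultimately show ?thesis by linarith
    qed
    have "\<bar>scheme_step ?A ?B ?s ?p h \<phi> x - scheme_step ?A ?B ?s ?p h ?\<psi> x\<bar> \<le> (1 + h * (CA + Cy)) * \<epsilon>"
      by (rule scheme_step_stable[OF pp h(1) \<epsilon> weight CAb BL[OF ZR] nn2(3,1,2)])
    with cons show ?thesis unfolding T_op_eq by linarith
  qed
  \<comment> \<open>One constant is used for both the growth factor and the local error, which is
    what gives the error recursion its closed form.\<close>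
  have "\<bar>T_op ?G \<sigma>0 p t h \<phi> x - u t x\<bar> \<le> (1 + (CA + Cy + K) * h) * \<epsilon> + (CA + Cy + K) * h\<^sup>2"
    if "0 \<le> t" "0 < h" "h \<le> h0" "t + h \<le> T" "\<And>y. \<bar>\<phi> y - u (t + h) y\<bar> \<le> \<epsilon>" for t h \<phi> \<epsilon> x
  proof -
    have e: "0 \<le> \<epsilon>" using order_trans[OF abs_ge_zero that(5)] .
    have "\<bar>T_op ?G \<sigma>0 p t h \<phi> x - u t x\<bar> \<le> (1 + h * (CA + Cy)) * \<epsilon> + K * h\<^sup>2"
      by (rule main[OF that])
    also have "h * (CA + Cy) \<le> (CA + Cy + K) * h" using that(2) nn3 by (simp add: algebra_simps)
    hence "(1 + h * (CA + Cy)) * \<epsilon> + K * h\<^sup>2 \<le> (1 + (CA + Cy + K) * h) * \<epsilon> + (CA + Cy + K) * h\<^sup>2"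
      using e nn2 by (intro add_mono mult_right_mono) auto
    finally show ?thesis .
  qed
  moreover have "0 \<le> CA + Cy + K" using nn2 nn3 by simp
  ultimately show ?thesis using h00
    by - (rule exI[of _ "CA + Cy + K"], rule exI[of _ h0], simp)
qed

theorem theorem4p1:
  fixes T :: real
    and \<sigma> :: "real \<Rightarrow> real^'d \<Rightarrow> real \<Rightarrow> real^'m^'d"
    and b :: "real \<Rightarrow> real^'d \<Rightarrow> real \<Rightarrow> real^'m \<Rightarrow> real^'d"
    and f :: "real \<Rightarrow> real^'d \<Rightarrow> real \<Rightarrow> real^'m \<Rightarrow> real"
    and g :: "real^'d \<Rightarrow> real"
    and \<sigma>0 :: "real \<Rightarrow> real^'d \<Rightarrow> real^'d^'d"
    and p :: "real \<Rightarrow> real^'d \<Rightarrow> real"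
    and u :: "real \<Rightarrow> real^'d \<Rightarrow> real"
    and uh :: "nat \<Rightarrow> real \<Rightarrow> real^'d \<Rightarrow> real"
  assumes "0 < T"
    and "bounded ((\<lambda>(t, x, y). \<sigma> t x y) ` ({0..T} \<times> UNIV))"
    and "bounded ((\<lambda>(t, x, y, z). b t x y z) ` ({0..T} \<times> UNIV))"
    and "bounded ((\<lambda>(t, x, y, z). f t x y z) ` ({0..T} \<times> UNIV))"
    and "bounded (range g)"
    and "continuous_on ({0..T} \<times> UNIV) (\<lambda>(t, x, y). \<sigma> t x y)"
    and "continuous_on ({0..T} \<times> UNIV) (\<lambda>(t, x, y, z). b t x y z)"
    and "continuous_on ({0..T} \<times> UNIV) (\<lambda>(t, x, y, z). f t x y z)"
    and "continuous_on UNIV g"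
    and "\<exists>L. \<forall>t\<in>{0..T}. L-lipschitz_on UNIV (\<lambda>(x, y). \<sigma> t x y)"
    and "\<exists>L. \<forall>t\<in>{0..T}. L-lipschitz_on UNIV (\<lambda>(x, y, z). b t x y z)"
    and "\<exists>L. \<forall>t\<in>{0..T}. L-lipschitz_on UNIV (\<lambda>(x, y, z). f t x y z)"
    and "\<exists>L. L-lipschitz_on UNIV g"
    and "satisfies_M T (quasilinear_G \<sigma> b f) \<sigma>0 p"
    and "classical_solution T (quasilinear_G \<sigma> b f) g u" and "C4b T u"
    and "\<And>n. n \<ge> 1 \<Longrightarrow> approx_solution T (quasilinear_G \<sigma> b f) \<sigma>0 p g n (uh n)"
  shows "\<exists>C. \<exists>h0>0. \<forall>n\<ge>1. T / real n \<le> h0 \<longrightarrow>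
           (\<forall>t\<in>{0..T}. \<forall>x. \<bar>uh n t x - u t x\<bar> \<le> C * (T / real n))"
proof -
  obtain C h0 where "0 < h0" "0 \<le> C" and one_step:
    "\<forall>t h \<phi> \<epsilon> x. 0 \<le> t \<longrightarrow> 0 < h \<longrightarrow> h \<le> h0 \<longrightarrow> t + h \<le> T \<longrightarrow>
      (\<forall>y. \<bar>\<phi> y - u (t + h) y\<bar> \<le> \<epsilon>) \<longrightarrow>
      \<bar>T_op (quasilinear_G \<sigma> b f) \<sigma>0 p t h \<phi> x - u t x\<bar> \<le> (1 + C * h) * \<epsilon> + C * h\<^sup>2"
    using scheme_one_step[OF assms(1-3,10-12,14-16)] by (elim exE conjE)
  have step: "\<bar>T_op (quasilinear_G \<sigma> b f) \<sigma>0 p t h \<phi> x - u t x\<bar> \<le> (1 + C * h) * \<epsilon> + C * h\<^sup>2"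
    if "0 \<le> t" "0 < h" "h \<le> h0" "t + h \<le> T" "\<And>y. \<bar>\<phi> y - u (t + h) y\<bar> \<le> \<epsilon>" for t h \<phi> \<epsilon> x
    using one_step that by simp
  have uT: "u T x = g x" for x using assms(15) unfolding classical_solution_def by blast
  show ?thesis
  proof (rule exI[of _ "exp (C * T)"], rule exI[of _ h0], intro conjI \<open>0 < h0\<close> allI impI ballI)
    fix n t x assume n: "1 \<le> n" and h: "T / real n \<le> h0" and t: "t \<in> {0..T}"
    show "\<bar>uh n t x - u t x\<bar> \<le> exp (C * T) * (T / real n)"
      by (rule approx_solution_error[OF assms(1) n assms(17)[OF n] uT \<open>0 \<le> C\<close> h step t])
  qed
qed

end
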